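(* Let $\Omega$ be a hyperbolic domain in $\widehat{\mathbb{C}}$. Then the following conditions are equivalent: (1) $\partial\Omega$ is uniformly perfect. (2) $\widetilde{C}(\Omega)>0$. (3) $\widehat{C}(\Omega)>0$.
   Context: $\widehat{\mathbb{C}}=\mathbb{C}\cup\{\infty\}$ is the Riemann sphere and $\mathbb{D}=\{z\in\mathbb{C}:|z|<1\}$. Boundaries $\partial\Omega$ are taken in $\widehat{\mathbb{C}}$. A domain $\Omega\subset\widehat{\mathbb{C}}$ is called hyperbolic if $\partial\Omega$ contains at least three points. The hyperbolic metric $\lambda_\Omega(z)|dz|$ (normalized to have curvature $-4$) is the conformal metric on $\Omega$ determined by $\lambda_{\mathbb{D}}(z)=1/(1-|z|^2)$ and $\lambda_{\mathbb{D}}(z)=\lambda_\Omega(p(z))|p'(z)|$ for $z\in\mathbb{D}$, where $p:\mathbb{D}\to\Omega$ is an analytic universal covering projection (at points mapped to $\infty$ this is understood in the local coordinate $1/z$). A compact set $E\subset\widehat{\mathbb{C}}$ containing at least two points is uniformly perfect if there is a constant $k\in(0,1)$ such that $\{z\in E: kr<|z-a|<r\}\neq\emptyset$ for every $a\in E\setminus\{\infty\}$ and every $0<r<d(E)$, where $d(E)$ is the Euclidean diameter of $E$, with $d(E)=+\infty$ whenever $\infty\in E$. The spherical (chordal) distance is $\sigma(z,w)=\dfrac{|z-w|}{\sqrt{(1+|z|^2)(1+|w|^2)}}$ for $z,w\in\mathbb{C}$ and $\sigma(z,\infty)=1/\sqrt{1+|z|^2}$ for $z\in\mathbb{C}$ (and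 $\sigma(\infty,\infty)=0$). Also $\tau(z,w)=\left|\dfrac{z-w}{1+z\bar w}\right|$, with values in $[0,+\infty]$; equivalently $\tau(z,w)=\sigma(z,w)/\sqrt{1-\sigma(z,w)^2}$ for all $z,w\in\widehat{\mathbb{C}}$, which is $+\infty$ exactly when $\sigma(z,w)=1$. For $z\in\Omega$ put $\delta_\Omega(z)=\min_{a\in\partial\Omega}\sigma(z,a)$, $\varepsilon_\Omega(z)=\min_{a\in\partial\Omega}\tau(z,a)$, and let $\mu_\Omega(z)=(1+|z|^2)\lambda_\Omega(z)$ be the spherical density of the hyperbolic metric, i.e. the ratio of $\lambda_\Omega(z)|dz|$ to the spherical metric $|dz|/(1+|z|^2)$ (extended continuously to $z=\infty$ if $\infty\in\Omega$). Define $$\widetilde{C}(\Omega)=\inf_{z\in\Omega}\delta_\Omega(z)\mu_\Omega(z),\qquad \widehat{C}(\Omega)=\inf_{z\in\Omega}\varepsilon_\Omega(z)\mu_\Omega(z).$$ *)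

theory Defs
  imports "HOL-Complex_Analysis.Complex_Analysis"
begin

section \<open>The Riemann sphere with the chordal metric\<close>

datatype csphere = Fin complex | Infty

fun chordal :: "csphere \<Rightarrow> csphere \<Rightarrow> real" where
  "chordal (Fin z) (Fin w) = cmod (z - w) / sqrt ((1 + (cmod z)\<^sup>2) * (1 + (cmod w)\<^sup>2))"
| "chordal (Fin z) Infty = 1 / sqrt (1 + (cmod z)\<^sup>2)"
| "chordal Infty (Fin w) = 1 / sqrt (1 + (cmod w)\<^sup>2)"
| "chordal Infty Infty = 0"

text \<open>Stereographic projection onto the sphere of diameter 1 with south pole at the origin;
  it turns the chordal distance into the Euclidean one and so gives the triangle inequality.\<close>

fun stereo :: "csphere \<Rightarrow> complex \<times> real" where
  "stereo (Fin z) = (z /\<^sub>R (1 + (cmod z)\<^sup>2), (cmod z)\<^sup>2 / (1 + (cmod z)\<^sup>2))"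
| "stereo Infty = (0, 1)"

lemma one_plus_norm_sq_pos: "1 + (cmod z)\<^sup>2 > 0"
  by (simp add: add_pos_nonneg)

lemma dist_stereo_Fin_Fin: "dist (stereo (Fin z)) (stereo (Fin w)) = chordal (Fin z) (Fin w)"
proof -
  define a where "a = 1 + (cmod z)\<^sup>2"
  define b where "b = 1 + (cmod w)\<^sup>2"
  have pos: "a > 0" "b > 0"
    using one_plus_norm_sq_pos by (auto simp: a_def b_def)
  have a': "a = 1 + (Re z)\<^sup>2 + (Im z)\<^sup>2" and b': "b = 1 + (Re w)\<^sup>2 + (Im w)\<^sup>2"
    by (simp_all add: a_def b_def cmod_power2)
  have "(dist (z /\<^sub>R a) (w /\<^sub>R b))\<^sup>2 = (Re z / a - Re w / b)\<^sup>2 + (Im z / a - Im w / b)\<^sup>2"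
    by (simp add: dist_norm cmod_power2 divide_inverse mult.commute)
  moreover have "(dist ((a - 1) / a) ((b - 1) / b))\<^sup>2 = ((a - 1) / a - (b - 1) / b)\<^sup>2"
    by (simp add: dist_real_def)
  moreover have "(Re z / a - Re w / b)\<^sup>2 + (Im z / a - Im w / b)\<^sup>2 + ((a - 1) / a - (b - 1) / b)\<^sup>2
      = ((Re z - Re w)\<^sup>2 + (Im z - Im w)\<^sup>2) / (a * b)"
  proof -
    have *: "(b * Re z - a * Re w)\<^sup>2 + (b * Im z - a * Im w)\<^sup>2 + (a - b)\<^sup>2
        = ((Re z - Re w)\<^sup>2 + (Im z - Im w)\<^sup>2) * (a * b)"
      unfolding a' b' by algebra
    have "Re z / a - Re w / b = (b * Re z - a * Re w) / (a * b)"
      "Im z / a - Im w / b = (b * Im z - a * Im w) / (a * b)"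
      "(a - 1) / a - (b - 1) / b = (a - b) / (a * b)"
      using pos by (auto simp: field_simps)
    hence "(Re z / a - Re w / b)\<^sup>2 + (Im z / a - Im w / b)\<^sup>2 + ((a - 1) / a - (b - 1) / b)\<^sup>2
      = ((b * Re z - a * Re w)\<^sup>2 + (b * Im z - a * Im w)\<^sup>2 + (a - b)\<^sup>2) / (a * b)\<^sup>2"
      by (simp only: power_divide add_divide_distrib)
    also have "\<dots> = ((Re z - Re w)\<^sup>2 + (Im z - Im w)\<^sup>2) / (a * b)"
      unfolding * using pos by (simp add: power2_eq_square)
    finally show ?thesis .
  qed
  ultimately have "(dist (z /\<^sub>R a) (w /\<^sub>R b))\<^sup>2 + (dist ((a - 1) / a) ((b - 1) / b))\<^sup>2
      = (cmod (z - w))\<^sup>2 / (a * b)"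
    by (simp add: cmod_power2)
  moreover have "stereo (Fin z) = (z /\<^sub>R a, (a - 1) / a)" "stereo (Fin w) = (w /\<^sub>R b, (b - 1) / b)"
    by (simp_all add: a_def b_def)
  ultimately show ?thesis
    by (simp add: dist_Pair_Pair real_sqrt_divide flip: a_def b_def del: stereo.simps)
qed

lemma dist_stereo_Fin_Infty: "dist (stereo (Fin z)) (stereo Infty) = 1 / sqrt (1 + (cmod z)\<^sup>2)"
proof -
  define a where "a = 1 + (cmod z)\<^sup>2"
  have pos: "a > 0"
    using one_plus_norm_sq_pos by (auto simp: a_def)
  have s: "stereo (Fin z) = (z /\<^sub>R a, (a - 1) / a)"
    by (simp add: a_def)
  have "(cmod (z /\<^sub>R a))\<^sup>2 + ((a - 1) / a - 1)\<^sup>2 = (a - 1) / a\<^sup>2 + (1 / a)\<^sup>2"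
    using pos by (simp add: a_def power_divide divide_simps)
  also have "\<dots> = 1 / a"
    using pos by (simp add: field_simps power2_eq_square)
  finally show ?thesis
    by (simp add: s dist_Pair_Pair dist_real_def real_sqrt_divide flip: a_def del: stereo.simps(1))
qed

lemma dist_stereo: "dist (stereo x) (stereo y) = chordal x y"
  by (cases x; cases y)
     (simp_all add: dist_stereo_Fin_Fin dist_stereo_Fin_Infty
        dist_commute[of "stereo Infty"] del: stereo.simps)

instantiation csphere :: metric_space
begin

definition dist_csphere :: "csphere \<Rightarrow> csphere \<Rightarrow> real" where
  "dist_csphere = chordal"

definition uniformity_csphere :: "(csphere \<times> csphere) filter" where
  "uniformity_csphere = (INF e\<in>{0<..}. principal {(x, y). dist x y < e})"

definition open_csphere :: "csphere set \<Rightarrow> bool" where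
  "open_csphere U \<longleftrightarrow> (\<forall>x\<in>U. eventually (\<lambda>(x', y). x' = x \<longrightarrow> y \<in> U) uniformity)"

instance
proof
  fix x y z :: csphere
  have "chordal x y = 0 \<Longrightarrow> x = y"
    using one_plus_norm_sq_pos by (cases x; cases y) (auto simp: less_le)
  moreover have "chordal x x = 0"
    by (simp flip: dist_stereo)
  ultimately show "dist x y = 0 \<longleftrightarrow> x = y"
    by (auto simp: dist_csphere_def)
  show "dist x y \<le> dist x z + dist y z"
    unfolding dist_csphere_def dist_stereo[symmetric] by (rule dist_triangle2)
qed (simp_all add: uniformity_csphere_def open_csphere_def)

end

text \<open>\<open>fin_chart Infty\<close> and \<open>inf_chart (Fin 0)\<close> are junk values; the charts are only used
  away from these points.\<close>

fun fin_chart :: "csphere \<Rightarrow> complex" where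
  "fin_chart (Fin z) = z"
| "fin_chart Infty = 0"

fun inf_chart :: "csphere \<Rightarrow> complex" where
  "inf_chart (Fin z) = inverse z"
| "inf_chart Infty = 0"

text \<open>The quotient \<open>\<sigma>/\<surd>(1 - \<sigma>\<^sup>2)\<close> also covers \<open>Infty\<close>; \<open>tau_Fin_Fin\<close> below gives the usual
  formula at finite points.\<close>

definition tau :: "csphere \<Rightarrow> csphere \<Rightarrow> ennreal" where
  "tau x y = (if dist x y = 1 then \<infinity> else ennreal (dist x y / sqrt (1 - (dist x y)\<^sup>2)))"

lemma tau_Fin_Fin:
  "tau (Fin z) (Fin w) =
     (if 1 + z * cnj w = 0 then \<infinity> else ennreal (cmod ((z - w) / (1 + z * cnj w))))"
proof -
  define s where "s = (1 + (cmod z)\<^sup>2) * (1 + (cmod w)\<^sup>2)"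
  have s: "s > 0"
    using one_plus_norm_sq_pos by (simp add: s_def)
  have d: "dist (Fin z) (Fin w) = cmod (z - w) / sqrt s"
    by (simp add: dist_csphere_def s_def)
  have "(cmod (z - w))\<^sup>2 + (cmod (1 + z * cnj w))\<^sup>2 = s"
    unfolding s_def cmod_power2 by (simp add: algebra_simps power2_eq_square)
  hence e: "1 - (dist (Fin z) (Fin w))\<^sup>2 = (cmod (1 + z * cnj w))\<^sup>2 / s"
    using s by (simp add: d power_divide field_simps)
  have "dist (Fin z) (Fin w) = 1 \<longleftrightarrow> 1 - (dist (Fin z) (Fin w))\<^sup>2 = 0"
    using zero_le_dist[of "Fin z" "Fin w"]
    by (smt (verit) power2_eq_1_iff)
  also have "\<dots> \<longleftrightarrow> 1 + z * cnj w = 0"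
    unfolding e using s by simp
  finally have iff: "dist (Fin z) (Fin w) = 1 \<longleftrightarrow> 1 + z * cnj w = 0" .
  have "sqrt (1 - (dist (Fin z) (Fin w))\<^sup>2) = cmod (1 + z * cnj w) / sqrt s"
    unfolding e by (simp add: real_sqrt_divide)
  hence "dist (Fin z) (Fin w) / sqrt (1 - (dist (Fin z) (Fin w))\<^sup>2)
      = cmod ((z - w) / (1 + z * cnj w))"
    using s by (simp add: d norm_divide)
  thus ?thesis
    unfolding tau_def iff by simp
qed


section \<open>Hyperbolic domains and the hyperbolic metric\<close>

definition hyperbolic_domain :: "csphere set \<Rightarrow> bool" where
  "hyperbolic_domain \<Omega> \<longleftrightarrow>
     open \<Omega> \<and> connected \<Omega> \<and> \<Omega> \<noteq> {} \<and> (\<exists>A. A \<subseteq> frontier \<Omega> \<and> card A = 3)"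

text \<open>Analytic maps into the sphere, for open domains of definition. Continuity makes the two
  sets on which the charts are applied open.\<close>

definition sphere_holomorphic_on :: "(complex \<Rightarrow> csphere) \<Rightarrow> complex set \<Rightarrow> bool" where
  "sphere_holomorphic_on f S \<longleftrightarrow>
     continuous_on S f \<and>
     (fin_chart \<circ> f) holomorphic_on {z\<in>S. f z \<noteq> Infty} \<and>
     (inf_chart \<circ> f) holomorphic_on {z\<in>S. f z \<noteq> Fin 0}"

text \<open>Coverings of \<open>\<Omega>\<close> by the disk are automatically universal, the disk being simply connected.\<close>

definition analytic_universal_covering :: "(complex \<Rightarrow> csphere) \<Rightarrow> csphere set \<Rightarrow> bool" where
  "analytic_universal_covering p \<Omega> \<longleftrightarrow>
     sphere_holomorphic_on p (ball 0 1) \<and> covering_space (ball 0 1) p \<Omega>"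

text \<open>The derivative in the coordinate \<open>z\<close> of the target, or in \<open>1/z\<close> where the value is \<open>Infty\<close>.\<close>

definition sphere_deriv :: "(complex \<Rightarrow> csphere) \<Rightarrow> complex \<Rightarrow> complex" where
  "sphere_deriv f z = (if f z = Infty then deriv (inf_chart \<circ> f) z else deriv (fin_chart \<circ> f) z)"

text \<open>The density of the metric of curvature -4. It exists by the uniformization theorem, and is
  unique because any two universal coverings differ by an automorphism of the disk. At
  \<open>Infty\<close> it is the density with respect to the coordinate \<open>1/z\<close>.\<close>

definition hyp_density :: "csphere set \<Rightarrow> csphere \<Rightarrow> real" where
  "hyp_density \<Omega> w =
     (THE l. \<exists>p z. analytic_universal_covering p \<Omega> \<and> z \<in> ball 0 1 \<and> p z = w \<and>
                   1 / (1 - (cmod z)\<^sup>2) = l * cmod (sphere_deriv p z))"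

fun sph_hyp_density :: "csphere set \<Rightarrow> csphere \<Rightarrow> real" where
  "sph_hyp_density \<Omega> (Fin z) = (1 + (cmod z)\<^sup>2) * hyp_density \<Omega> (Fin z)"
| "sph_hyp_density \<Omega> Infty = Lim at_infinity (\<lambda>z. (1 + (cmod z)\<^sup>2) * hyp_density \<Omega> (Fin z))"

definition delta :: "csphere set \<Rightarrow> csphere \<Rightarrow> real" where
  "delta \<Omega> z = infdist z (frontier \<Omega>)"

definition epsilon :: "csphere set \<Rightarrow> csphere \<Rightarrow> ennreal" where
  "epsilon \<Omega> z = (INF a\<in>frontier \<Omega>. tau z a)"

definition C_tilde :: "csphere set \<Rightarrow> real" where
  "C_tilde \<Omega> = (INF z\<in>\<Omega>. delta \<Omega> z * sph_hyp_density \<Omega> z)"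

definition C_hat :: "csphere set \<Rightarrow> ennreal" where
  "C_hat \<Omega> = (INF z\<in>\<Omega>. epsilon \<Omega> z * ennreal (sph_hyp_density \<Omega> z))"


section \<open>Uniformly perfect sets\<close>

definition euclid_diameter :: "csphere set \<Rightarrow> ereal" where
  "euclid_diameter E = (if Infty \<in> E then \<infinity> else ereal (diameter (Fin -` E)))"

text \<open>The point \<open>Infty\<close> never lies in the annulus, so \<open>z\<close> below may be taken finite. The compact
  \<open>E\<close> not containing \<open>Infty\<close> are bounded in the plane, so \<open>diameter\<close> is meaningful.\<close>

definition uniformly_perfect :: "csphere set \<Rightarrow> bool" where
  "uniformly_perfect E \<longleftrightarrow>
     compact E \<and> (\<exists>x\<in>E. \<exists>y\<in>E. x \<noteq> y) \<and>
     (\<exists>k. 0 < k \<and> k < 1 \<and>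
        (\<forall>a r. Fin a \<in> E \<longrightarrow> 0 < r \<longrightarrow> ereal r < euclid_diameter E \<longrightarrow>
           (\<exists>z. Fin z \<in> E \<and> k * r < cmod (z - a) \<and> cmod (z - a) < r)))"

end

(* Uniformization. A hyperbolic domain can be moved into the plane, where it omits two points a, b.
   Removing a small disk around a makes it equivalent to a bounded domain, and among the coverings of
   such a domain by subdomains of the disk Koebe's square-root step shows that those with nearly
   minimal |h'(0)| are defined on nearly the whole disk. By Schottky's and Montel's theorems these
   coverings subconverge, as the removed disks shrink, to a covering by the full disk. Lifting along
   coverings and the Schwarz-Pick lemma then identify the hyperbolic density.

   Estimates. For boundary points a, b, c the cross ratio of the covering map with a, b, c omits 0 and 1,
   so Schottky's theorem bounds its derivative; this bounds the spherical density from below by chordal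
   cross ratios of w, a, b, c. With a nearest to w and with b at a comparable distance from a, as given
   by uniform perfectness, one gets delta * mu >= const. Conversely, if a thick annulus separates the
   boundary then a + (z - a) exp (l x) maps the disk into it, so the density is small on the middle
   circle. Finally delta and epsilon are comparable unless delta is large, and mu is always bounded
   away from 0. *)

theory Submission
  imports Defs
begin

text \<open>Koebe's extremal argument starts from a nonempty family of coverings by subdomains of
  the disk, which is at hand once the domain omits a whole disk, and it is run only with
  near-minimizers of |h'(0)|. Both defects are sent to zero along one sequence: the n-th covering
  lives over the domain minus a disk of radius \<open>D n\<close> and is defined at least on the
  closed disk of radius \<open>T n\<close>; Montel's theorem is applied to the rescaled maps. The
  covering property itself is not visibly closed under limits. Its local form is: holomorphic
  inverse branches over every disk, through every point of the fibre. These branches take values in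
  the unit disk, so they are a normal family by themselves.

  The density is a \<open>THE\<close> at finite points and a \<open>Lim\<close> at
  \<open>Infty\<close>, so every estimate is made at finite points and carried to
  \<open>Infty\<close> by continuity. Cross ratios suit this because their modulus and spherical
  derivative are quotients of chordal distances, which treat points near \<open>Infty\<close> like
  all others. Uniform perfectness, by contrast, is a Euclidean condition centred at finite points
  and is first converted into chordal form.\<close>

section \<open>Uniformization of plane domains\<close>

text \<open>A stand-in for ``covering of \<open>U\<close>'' that passes to locally uniform limits.\<close>

definition disc_sections :: "complex set \<Rightarrow> (complex \<Rightarrow> complex) \<Rightarrow> complex set \<Rightarrow> bool" where
  "disc_sections G h U \<longleftrightarrow>
     (\<forall>c r z. cball c r \<subseteq> U \<longrightarrow> z \<in> G \<longrightarrow> h z \<in> ball c r \<longrightarrow>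
        (\<exists>s. s holomorphic_on ball c r \<and> s ` ball c r \<subseteq> G \<and> s (h z) = z \<and>
             (\<forall>w\<in>ball c r. h (s w) = w)))"

lemma disc_sectionsE:
  assumes "disc_sections G h U" "cball c r \<subseteq> U" "z \<in> G" "h z \<in> ball c r"
  obtains s where "s holomorphic_on ball c r" "s ` ball c r \<subseteq> G" "s (h z) = z"
    "\<And>w. w \<in> ball c r \<Longrightarrow> h (s w) = w"
  using assms unfolding disc_sections_def by meson

text \<open>The base point sits at 0 because |h'(0)| is the quantity to be minimized.
  \<open>G\<close> may be disconnected, so the full preimage taken in the square-root step stays in
  the class without passing to a component.\<close>

definition pointed_cover ::
  "complex set \<Rightarrow> (complex \<Rightarrow> complex) \<Rightarrow> complex set \<Rightarrow> complex \<Rightarrow> bool" where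
  "pointed_cover G h U w \<longleftrightarrow>
     open G \<and> 0 \<in> G \<and> G \<subseteq> ball 0 1 \<and> h holomorphic_on G \<and> h ` G \<subseteq> U \<and> h 0 = w \<and>
     disc_sections G h U"

lemma pointed_coverD:
  assumes "pointed_cover G h U w"
  shows "open G" "0 \<in> G" "G \<subseteq> ball 0 1" "h holomorphic_on G" "h ` G \<subseteq> U" "h 0 = w"
    "disc_sections G h U"
  using assms by (auto simp: pointed_cover_def)

lemma deriv_section_mult:
  assumes "open G" "h holomorphic_on G" "open B" "s holomorphic_on B" "s ` B \<subseteq> G"
    and "\<And>w. w \<in> B \<Longrightarrow> h (s w) = w" and "w \<in> B"
  shows "deriv h (s w) * deriv s w = 1"
proof -
  have "(h has_field_derivative deriv h (s w)) (at (s w))"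
    using assms by (intro holomorphic_derivI[of _ G]) auto
  moreover have "(s has_field_derivative deriv s w) (at w)"
    using assms by (intro holomorphic_derivI[of _ B]) auto
  ultimately have "((h \<circ> s) has_field_derivative deriv h (s w) * deriv s w) (at w)"
    by (rule DERIV_chain)
  moreover have "((h \<circ> s) has_field_derivative 1) (at w)"
    by (rule has_field_derivative_transform_within_open[of "\<lambda>x. x" _ _ B])
       (use assms in \<open>auto intro!: derivative_eq_intros\<close>)
  ultimately show ?thesis
    by (rule DERIV_unique)
qed

text \<open>The section \<open>s\<close> through 0 maps a disk of radius \<open>\<rho>\<close> into
  the unit disk, so Schwarz gives |s'(w)| at most 1/\<open>\<rho>\<close>, while h'(0) s'(w) = 1.
  This keeps the extremal infimum positive and later keeps the limit map from being
  constant.\<close>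

lemma pointed_cover_deriv_ge:
  assumes pc: "pointed_cover G h U w" and "0 < \<rho>" "cball w \<rho> \<subseteq> U"
  shows "\<rho> \<le> cmod (deriv h 0)"
proof -
  note P = pointed_coverD[OF pc]
  obtain s where s: "s holomorphic_on ball w \<rho>" "s ` ball w \<rho> \<subseteq> G" "s (h 0) = 0"
      "\<And>x. x \<in> ball w \<rho> \<Longrightarrow> h (s x) = x"
    using disc_sectionsE[OF P(7) assms(3) P(2)] P(6) assms(2) by auto
  have s0: "s w = 0"
    using s P by auto
  define f where "f = s \<circ> (\<lambda>z. w + of_real \<rho> * z)"
  have im: "w + of_real \<rho> * z \<in> ball w \<rho>" if "cmod z < 1" for z
    using that assms(2) by (simp add: dist_norm norm_mult)
  have "f holomorphic_on ball 0 1"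
    unfolding f_def
    by (rule holomorphic_on_compose_gen[OF _ s(1)]) (use im in \<open>auto intro!: holomorphic_intros\<close>)
  moreover have "f 0 = 0"
    by (simp add: f_def s0)
  moreover have "cmod (f z) < 1" if "cmod z < 1" for z
  proof -
    have "s (w + of_real \<rho> * z) \<in> ball 0 1"
      using s(2) im[OF that] P(3) by blast
    thus ?thesis by (simp add: f_def)
  qed
  ultimately have le: "cmod (deriv f 0) \<le> 1"
    using Schwarz_Lemma(2)[of f 0] by auto
  have "(s has_field_derivative deriv s w) (at (w + of_real \<rho> * 0))"
    using s(1) assms(2) by (auto intro!: holomorphic_derivI[of _ "ball w \<rho>"])
  moreover have "((\<lambda>z. w + of_real \<rho> * z) has_field_derivative of_real \<rho>) (at 0)"
    by (auto intro!: derivative_eq_intros)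
  ultimately have "(f has_field_derivative deriv s w * of_real \<rho>) (at 0)"
    unfolding f_def by (rule DERIV_chain)
  hence d: "deriv f 0 = deriv s w * of_real \<rho>"
    by (rule DERIV_imp_deriv)
  have "deriv h (s w) * deriv s w = 1"
    using deriv_section_mult[OF P(1,4) _ s(1,2,4)] assms(2) by auto
  hence "cmod (deriv h 0) * cmod (deriv s w) = 1"
    by (metis s0 norm_mult norm_one)
  moreover have "cmod (deriv s w) * \<rho> \<le> 1"
    using le d assms(2) by (simp add: norm_mult)
  ultimately show ?thesis
    by (smt (verit) mult.commute mult_right_le_imp_le norm_ge_zero mult_le_cancel_right_pos mult_less_0_iff zero_less_mult_iff)
qed

section \<open>Moebius maps and the square-root step\<close>

lemma Moebius_deriv_0:
  assumes "cmod b < 1"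
  shows "(Moebius_function 0 (-b) has_field_derivative (1 - b * cnj b)) (at 0)"
  unfolding Moebius_function_simple[abs_def]
  by (auto intro!: derivative_eq_intros simp: power2_eq_square)

lemma Moebius_deriv_self:
  assumes "cmod a < 1"
  shows "(Moebius_function 0 a has_field_derivative inverse (1 - a * cnj a)) (at a)"
proof -
  have "a * cnj a \<noteq> 1"
    using assms by (metis norm_one complex_mod_cnj norm_mult less_irrefl norm_mult_less mult_1)
  define D where "D = 1 - cnj a * a"
  have "D \<noteq> 0"
    using \<open>a * cnj a \<noteq> 1\<close> by (simp add: D_def mult.commute)
  have "((\<lambda>z. (z - a) / (1 - cnj a * z)) has_field_derivative (1 * D - (a - a) * (- cnj a)) / (D * D)) (at a)"
    using \<open>D \<noteq> 0\<close> unfolding D_def by (auto intro!: derivative_eq_intros)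
  moreover have "(1 * D - (a - a) * (- cnj a)) / (D * D) = inverse (1 - a * cnj a)"
    using \<open>D \<noteq> 0\<close> by (simp add: D_def divide_inverse mult.commute[of a])
  ultimately show ?thesis
    unfolding Moebius_function_simple[abs_def] by simp
qed

text \<open>Koebe's square-root step. The factor is the derivative at 0 of the two-to-one Blaschke product
  branched over \<open>a\<close>; it is less than 1.\<close>

lemma pointed_cover_sqrt:
  assumes pc: "pointed_cover G h U w" and a: "cmod a < 1" "a \<notin> G"
  obtains G' h' where "pointed_cover G' h' U w"
    "cmod (deriv h' 0) = 2 * sqrt (cmod a) / (1 + cmod a) * cmod (deriv h 0)"
proof -
  note P = pointed_coverD[OF pc]
  define M where "M = (\<lambda>w. Moebius_function 0 w)"
  \<comment> \<open>With b^2 = -a the composite \<open>Q\<close> below fixes 0: 0 goes to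
    \<open>b\<close>, then to \<open>-a\<close>, then back to 0.\<close>
  define b where "b = csqrt (-a)"
  have b2: "b\<^sup>2 = -a" by (simp add: b_def)
  have a0: "a \<noteq> 0" using a P(2) by auto
  have nb: "cmod b ^ 2 = cmod a"
    by (metis b2 norm_minus_cancel norm_power)
  have b1: "cmod b < 1"
    using a(1) nb power_less_one_iff[of "cmod b" 2] by simp
  have b0: "b \<noteq> 0" using b2 a0 by auto
  have Mball: "M u z \<in> ball 0 1" if "cmod u < 1" "z \<in> ball 0 1" for u z
    using Moebius_function_norm_lt_1 that by (auto simp: M_def)
  have Mhol: "M u holomorphic_on ball 0 1" if "cmod u < 1" for u
    using Moebius_function_holomorphic that by (auto simp: M_def)
  have Minv: "M u (M (-u) z) = z" "M (-u) (M u z) = z" if "cmod u < 1" "z \<in> ball 0 1" for u z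
    using Moebius_function_compose that by (auto simp: M_def)
  \<comment> \<open>The critical value of \<open>Q\<close> is the image of 0 under
    \<open>M (-a)\<close>, which is \<open>a\<close>. It lies outside \<open>G\<close>, so sections
    into \<open>G\<close> can be lifted through \<open>Q\<close>.\<close>
  define Q where "Q = M (-a) \<circ> ((\<lambda>z. z\<^sup>2) \<circ> M (-b))"
  have sqball: "z\<^sup>2 \<in> ball 0 1" if "z \<in> ball 0 1" for z :: complex
    using that by (simp add: norm_power power_less_one_iff)
  have Qhol: "Q holomorphic_on ball 0 1"
    unfolding Q_def using Mball Mhol[of "-a"] Mhol[of "-b"] sqball a b1
    by (intro holomorphic_on_compose_gen[where t = "ball 0 1"] holomorphic_intros) (auto simp del: mem_ball)
  have Qball: "Q z \<in> ball 0 1" if "z \<in> ball 0 1" for z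
    using Mball[of "-a"] Mball[of "-b"] sqball that a b1 by (simp add: Q_def del: mem_ball)
  have M0: "M (-b) 0 = b" "M (-a) (-a) = 0"
    by (simp_all add: M_def Moebius_function_simple)
  have Q0: "Q 0 = 0"
    by (simp add: Q_def M0 b2)
  define G' where "G' = ball 0 1 \<inter> Q -` G"
  have oG': "open G'"
    unfolding G'_def using Qhol P(1)
    by (intro continuous_open_preimage holomorphic_on_imp_continuous_on) auto
  have hol': "h \<circ> Q holomorphic_on G'"
    by (rule holomorphic_on_compose_gen[OF _ P(4)])
       (auto intro: holomorphic_on_subset[OF Qhol] simp: G'_def)
  have sec: "disc_sections G' (h \<circ> Q) U"
    unfolding disc_sections_def
  proof (intro allI impI)
    fix c r z assume cr: "cball c r \<subseteq> U" and z: "z \<in> G'" and hz: "(h \<circ> Q) z \<in> ball c r"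
    have zG: "Q z \<in> G" "z \<in> ball 0 1" using z by (auto simp: G'_def)
    obtain s where s: "s holomorphic_on ball c r" "s ` ball c r \<subseteq> G" "s (h (Q z)) = Q z"
      "\<And>x. x \<in> ball c r \<Longrightarrow> h (s x) = x"
      using disc_sectionsE[OF P(7) cr zG(1)] hz by auto
    have sb: "s x \<in> ball 0 1" if "x \<in> ball c r" for x
      using s(2) P(3) that by blast
    have hol2: "M a \<circ> s holomorphic_on ball c r"
      using sb a by (intro holomorphic_on_compose_gen[OF s(1) Mhol[of a]]) (auto simp del: mem_ball)
    \<comment> \<open>\<open>M a\<close> vanishes only at \<open>a\<close>, and \<open>s\<close>
      avoids \<open>a\<close> because its values lie in \<open>G\<close>. Hence
      \<open>M a \<circ> s\<close> has a holomorphic square root on the disk.\<close>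
    have nz: "(M a \<circ> s) x \<noteq> 0" if "x \<in> ball c r" for x
    proof
      assume "(M a \<circ> s) x = 0"
      hence "M (-a) 0 = s x" using Minv(2)[OF a(1) sb[OF that]] by simp
      hence "s x = a" by (simp add: M_def Moebius_function_simple)
      thus False using s(2) that a by blast
    qed
    obtain v0 where v0: "v0 holomorphic_on ball c r" "\<And>x. x \<in> ball c r \<Longrightarrow> (M a \<circ> s) x = (v0 x)\<^sup>2"
      using contractible_imp_holomorphic_sqrt[OF hol2 convex_imp_contractible[OF convex_ball] nz] by blast
    have Qz: "M a (Q z) = (M (-b) z)\<^sup>2"
      using Minv(1)[OF a(1), of "(M (-b) z)\<^sup>2"] sqball[OF Mball[of "-b" z]] b1 zG(2)
      by (simp add: Q_def del: mem_ball)
    have "(v0 (h (Q z)))\<^sup>2 = (M (-b) z)\<^sup>2"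
      using v0(2)[of "h (Q z)"] hz s(3) Qz by simp
    \<comment> \<open>The sign \<open>e\<close> selects the branch of the root that makes the lifted
      section pass through \<open>z\<close> and not through the other preimage of
      \<open>Q z\<close>.\<close>
    then obtain e where e: "e\<^sup>2 = (1::complex)" "e * v0 (h (Q z)) = M (-b) z"
      by (metis mult_1 mult_minus1 power2_eq_iff power2_minus power_one minus_minus)
    define v where "v = (\<lambda>x. e * v0 x)"
    have v: "v holomorphic_on ball c r" "\<And>x. x \<in> ball c r \<Longrightarrow> (v x)\<^sup>2 = M a (s x)"
      "v (h (Q z)) = M (-b) z"
      using v0 e by (auto simp: v_def power_mult_distrib intro!: holomorphic_intros)
    have vb: "v x \<in> ball 0 1" if "x \<in> ball c r" for x
    proof -
      have "(v x)\<^sup>2 \<in> ball 0 1" using v(2)[OF that] Mball[OF a(1) sb[OF that]] by simp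
      thus ?thesis by (simp add: norm_power power_less_one_iff)
    qed
    define t where "t = M b \<circ> v"
    have tb: "t x \<in> ball 0 1" if "x \<in> ball c r" for x
      using Mball[OF b1 vb[OF that]] by (simp add: t_def)
    have Qt: "Q (t x) = s x" if "x \<in> ball c r" for x
      using Minv(2)[OF b1 vb[OF that]] v(2)[OF that] Minv(2)[OF a(1) sb[OF that]]
      by (simp add: t_def Q_def)
    have "t holomorphic_on ball c r"
      unfolding t_def using vb by (intro holomorphic_on_compose_gen[OF v(1) Mhol[OF b1]]) (auto simp del: mem_ball)
    moreover have "t ` ball c r \<subseteq> G'"
      using tb Qt s(2) by (auto simp: G'_def simp del: mem_ball)
    moreover have "t ((h \<circ> Q) z) = z"
      using v(3) Minv(1)[OF b1 zG(2)] by (simp add: t_def)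
    moreover have "\<forall>x\<in>ball c r. (h \<circ> Q) (t x) = x"
      using Qt s(4) by simp
    ultimately show "\<exists>s. s holomorphic_on ball c r \<and> s ` ball c r \<subseteq> G' \<and> s ((h \<circ> Q) z) = z \<and>
             (\<forall>w\<in>ball c r. (h \<circ> Q) (s w) = w)" by blast
  qed
  have pc': "pointed_cover G' (h \<circ> Q) U w"
    unfolding pointed_cover_def using oG' hol' sec Q0 P by (auto simp: G'_def)
  have aa: "cmod (- a) < 1" using a by simp
  have "(M (-b) has_field_derivative (1 - b * cnj b)) (at 0)"
    using Moebius_deriv_0[OF b1] by (simp add: M_def)
  moreover have "((\<lambda>z. z\<^sup>2) has_field_derivative (2 * b)) (at (M (-b) 0))"
    by (auto intro!: derivative_eq_intros simp: M0)
  ultimately have "(((\<lambda>z. z\<^sup>2) \<circ> M (-b)) has_field_derivative (2 * b * (1 - b * cnj b))) (at 0)"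
    by (rule DERIV_chain[rotated])
  moreover have "(M (-a) has_field_derivative inverse (1 - a * cnj a)) (at (((\<lambda>z. z\<^sup>2) \<circ> M (-b)) 0))"
    using Moebius_deriv_self[OF aa] by (simp add: M_def M0[unfolded M_def] b2)
  ultimately have "(Q has_field_derivative inverse (1 - a * cnj a) * (2 * b * (1 - b * cnj b))) (at 0)"
    unfolding Q_def by (rule DERIV_chain[rotated])
  moreover have "(h has_field_derivative deriv h 0) (at (Q 0))"
    using Q0 P by (auto intro!: holomorphic_derivI[of _ G])
  ultimately have "(h \<circ> Q has_field_derivative deriv h 0 * (inverse (1 - a * cnj a) * (2 * b * (1 - b * cnj b)))) (at 0)"
    by (rule DERIV_chain[rotated])
  hence "deriv (h \<circ> Q) 0 = deriv h 0 * (inverse (1 - a * cnj a) * (2 * b * (1 - b * cnj b)))"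
    by (rule DERIV_imp_deriv)
  \<comment> \<open>Since |b|^2 = |a|, the factor 1 - |b|^2 cancels against one factor of 1 -
    |a|^2.\<close>
  moreover have "cmod (inverse (1 - a * cnj a) * (2 * b * (1 - b * cnj b))) = 2 * sqrt (cmod a) / (1 + cmod a)"
  proof -
    have *: "cmod (1 - u * cnj u) = 1 - (cmod u)\<^sup>2" if "cmod u < 1" for u
    proof -
      have "1 - u * cnj u = of_real (1 - (cmod u)\<^sup>2)"
        by (simp only: of_real_diff of_real_1 complex_norm_square)
      moreover have "(cmod u)\<^sup>2 \<le> 1" using that by (simp add: power_le_one)
      ultimately show ?thesis by (metis abs_of_nonneg diff_ge_0_iff_ge norm_of_real)
    qed
    have "cmod b = sqrt (cmod a)"
      by (metis nb norm_ge_zero real_sqrt_unique)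
    hence "cmod (inverse (1 - a * cnj a) * (2 * b * (1 - b * cnj b)))
        = inverse (1 - (cmod a)\<^sup>2) * (2 * sqrt (cmod a) * (1 - cmod a))"
      unfolding norm_mult norm_inverse *[OF a(1)] *[OF b1] nb by simp
    also have "\<dots> = 2 * sqrt (cmod a) / (1 + cmod a)"
    proof -
      have "1 - (cmod a)\<^sup>2 = (1 - cmod a) * (1 + cmod a)"
        by (simp add: power2_eq_square algebra_simps)
      moreover have "1 - cmod a \<noteq> 0" "1 + cmod a \<noteq> 0"
        using a(1) by (auto simp: add_nonneg_eq_0_iff)
      ultimately show ?thesis
        by (simp only: inverse_mult_distrib) (simp add: divide_inverse)
    qed
    finally show ?thesis .
  qed
  ultimately have "cmod (deriv (h \<circ> Q) 0) = 2 * sqrt (cmod a) / (1 + cmod a) * cmod (deriv h 0)"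
    by (metis mult.commute norm_mult)
  with pc' show ?thesis by (rule that)
qed

text \<open>In terms of the square roots p and q, the cross-multiplied difference is (q - p)(1 -
  pq). Thus one factor below 1 serves all omitted points of modulus less than
  \<open>r\<close>.\<close>

lemma koebe_factor_mono:
  fixes x r :: real
  assumes "0 \<le> x" "x \<le> r" "r \<le> 1"
  shows "2 * sqrt x / (1 + x) \<le> 2 * sqrt r / (1 + r)"
proof -
  define p q where "p = sqrt x" and "q = sqrt r"
  have pq: "0 \<le> p" "p \<le> q" "q \<le> 1" "x = p\<^sup>2" "r = q\<^sup>2"
    using assms by (auto simp: p_def q_def)
  have "0 \<le> (q - p) * (1 - p * q)"
    using pq by (intro mult_nonneg_nonneg) (auto intro: mult_le_one)
  hence "p * (1 + q\<^sup>2) \<le> q * (1 + p\<^sup>2)"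
    by (simp add: algebra_simps power2_eq_square)
  moreover have "1 + p\<^sup>2 > 0" "1 + q\<^sup>2 > 0"
    by (auto intro: add_pos_nonneg)
  ultimately show ?thesis
    unfolding p_def[symmetric] q_def[symmetric] unfolding pq(4,5) by (simp add: field_simps)
qed

text \<open>A covering within a factor 1/q of the infimum \<open>m\<close> leaves no room for a
  square-root step at a point of modulus below \<open>r\<close>: that step multiplies |h'(0)| by at
  most \<open>q\<close> and would lead below \<open>m\<close>.\<close>

lemma pointed_cover_ball:
  assumes pc: "pointed_cover G0 h0 U w" and U: "open U" "w \<in> U" and r: "0 < r" "r < 1"
  obtains G h where "pointed_cover G h U w" "ball 0 r \<subseteq> G"
proof -
  define X where "X = {cmod (deriv h 0) |G h. pointed_cover G h U w}"
  obtain \<rho> where \<rho>: "\<rho> > 0" "cball w \<rho> \<subseteq> U"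
    using U open_contains_cball by blast
  have ge: "\<rho> \<le> x" if "x \<in> X" for x
    using that pointed_cover_deriv_ge \<rho> by (auto simp: X_def)
  have bdd: "bdd_below X" and ne: "X \<noteq> {}"
    using ge pc by (auto simp: X_def intro!: bdd_belowI[of _ \<rho>])
  define m where "m = Inf X"
  have "m \<ge> \<rho>"
    unfolding m_def using ne ge by (rule cInf_greatest)
  define q where "q = 2 * sqrt r / (1 + r)"
  have q: "0 < q" "q < 1"
  proof -
    have "0 < (1 - sqrt r)\<^sup>2" using r by simp
    also have "\<dots> = 1 + r - 2 * sqrt r" using r by (simp add: power2_diff)
    finally show "q < 1" "0 < q" using r by (auto simp: q_def field_simps)
  qed
  have "m < m / q" using q \<open>m \<ge> \<rho>\<close> \<rho>(1) by (simp add: field_simps)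
  then obtain G h where G: "pointed_cover G h U w" "cmod (deriv h 0) < m / q"
    using cInf_lessD[OF ne, of "m / q"] by (auto simp: m_def X_def)
  have "ball 0 r \<subseteq> G"
  proof
    fix a :: complex assume "a \<in> ball 0 r"
    hence ar: "cmod a < r" by simp
    show "a \<in> G"
    proof (rule ccontr)
      assume "a \<notin> G"
      with ar r obtain G' h' where G': "pointed_cover G' h' U w"
        "cmod (deriv h' 0) = 2 * sqrt (cmod a) / (1 + cmod a) * cmod (deriv h 0)"
        using pointed_cover_sqrt[OF G(1), of a] by auto
      have "m \<le> cmod (deriv h' 0)"
        unfolding m_def using bdd G'(1) by (intro cInf_lower) (auto simp: X_def)
      also have "\<dots> \<le> q * cmod (deriv h 0)"
        unfolding G'(2) q_def using ar r by (intro mult_right_mono koebe_factor_mono) auto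
      also have "\<dots> < m"
        using G(2) q by (simp add: field_simps)
      finally show False by simp
    qed
  qed
  with G(1) show ?thesis by (rule that)
qed

section \<open>Limits of coverings\<close>

lemma uniform_limit_imp_tendsto_at:
  fixes f :: "nat \<Rightarrow> 'a::metric_space \<Rightarrow> 'b::metric_space"
  assumes ul: "uniform_limit K f g sequentially" and g: "continuous_on K g"
    and x: "x \<in> K" "X \<longlonglongrightarrow> x" "eventually (\<lambda>n. X n \<in> K) sequentially"
  shows "(\<lambda>n. f n (X n)) \<longlonglongrightarrow> g x"
proof (rule metric_LIMSEQ_I)
  fix e :: real assume "e > 0"
  have "(\<lambda>n. g (X n)) \<longlonglongrightarrow> g x"
    using g x continuous_on_tendsto_compose by blast
  hence "eventually (\<lambda>n. dist (g (X n)) (g x) < e / 2) sequentially"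
    using \<open>e > 0\<close> by (intro tendstoD) auto
  moreover have "eventually (\<lambda>n. \<forall>y\<in>K. dist (f n y) (g y) < e / 2) sequentially"
    using ul \<open>e > 0\<close> by (intro uniform_limitD) auto
  ultimately have "eventually (\<lambda>n. dist (f n (X n)) (g x) < e) sequentially"
    using x(3)
  proof eventually_elim
    case (elim n)
    hence "dist (f n (X n)) (g (X n)) < e / 2" by blast
    thus ?case using elim(1) dist_triangle[of "f n (X n)" "g x" "g (X n)"] by linarith
  qed
  thus "\<exists>N. \<forall>n\<ge>N. dist (f n (X n)) (g x) < e"
    by (simp add: eventually_sequentially)
qed

lemma compact_subset_unit_ball:
  fixes K :: "complex set"
  assumes "compact K" "K \<subseteq> ball 0 1"
  obtains t where "0 < t" "t < 1" "K \<subseteq> cball 0 t"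
proof (cases "K = {}")
  case True
  thus ?thesis by (intro that[of "1/2"]) auto
next
  case False
  obtain x where x: "x \<in> K" "\<And>y. y \<in> K \<Longrightarrow> cmod y \<le> cmod x"
    using continuous_attains_sup[OF assms(1) False, of cmod] continuous_on_norm_id by blast
  have "cmod x < 1" using x(1) assms(2) by auto
  thus ?thesis
    using x by (intro that[of "max (1/2) (cmod x)"]) (auto simp: le_max_iff_disj)
qed

text \<open>Sections of the maps \<open>h n\<close> subconverge to sections of the limit, because they take values
  in the unit disk and one of their values stays inside it.\<close>

lemma disc_sections_limit:
  fixes h k :: "nat \<Rightarrow> complex \<Rightarrow> complex" and T :: "nat \<Rightarrow> real"
  assumes sec: "\<And>n. disc_sections (G n) (h n) (U n)" and G: "\<And>n. G n \<subseteq> ball 0 1"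
    and T: "T \<longlonglongrightarrow> 1" "\<And>n. T n > 0"
    and TG: "\<And>n z. z \<in> ball 0 1 \<Longrightarrow> of_real (T n) * z \<in> G n"
    and k: "\<And>n z. z \<in> ball 0 1 \<Longrightarrow> k n z = h n (of_real (T n) * z)"
    and ul: "\<And>K. compact K \<Longrightarrow> K \<subseteq> ball 0 1 \<Longrightarrow> uniform_limit K k \<kappa> sequentially"
    and hol: "\<kappa> holomorphic_on ball 0 1"
    and U: "\<And>c r. cball c r \<subseteq> V \<Longrightarrow> eventually (\<lambda>n. cball c r \<subseteq> U n) sequentially"
  shows "disc_sections (ball 0 1) \<kappa> V"
  unfolding disc_sections_def
proof (intro allI impI)
  fix c :: complex and r :: real and z0 :: complex
  assume cr: "cball c r \<subseteq> V" and z0: "z0 \<in> ball 0 1" and kz0: "\<kappa> z0 \<in> ball c r"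
  have kc: "continuous_on (ball 0 1) \<kappa>"
    using hol by (rule holomorphic_on_imp_continuous_on)
  \<comment> \<open>Continuous convergence: the evaluation points move along with the index. Both
    the base points \<open>k n z0\<close> and the lifted points below do so.\<close>
  have lim_at: "(\<lambda>i. k (q i) (X i)) \<longlonglongrightarrow> \<kappa> x"
    if lim: "X \<longlonglongrightarrow> x" and xb: "x \<in> ball 0 1" and q: "filterlim q at_top sequentially" for X x q
  proof -
    obtain e where e: "e > 0" "cball x e \<subseteq> ball 0 1"
      using open_contains_cball[THEN iffD1, OF open_ball] xb by blast
    have "uniform_limit (cball x e) (\<lambda>i. k (q i)) \<kappa> sequentially"
      using filterlim_compose[OF ul[OF compact_cball e(2)] q] by simp
    moreover have "eventually (\<lambda>i. X i \<in> cball x e) sequentially"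
      using tendstoD[OF lim e(1)] by eventually_elim (simp add: dist_commute)
    ultimately show ?thesis
      using lim e continuous_on_subset[OF kc e(2)]
      by (intro uniform_limit_imp_tendsto_at[where K = "cball x e" and f = "\<lambda>i. k (q i)"]) simp_all
  qed
  have idl: "filterlim (\<lambda>i::nat. i) at_top sequentially"
    by (rule filterlim_ident)
  have "(\<lambda>n. k n z0) \<longlonglongrightarrow> \<kappa> z0"
    using lim_at[OF tendsto_const z0 idl] .
  hence "eventually (\<lambda>n. k n z0 \<in> ball c r) sequentially"
    using kz0 by (rule topological_tendstoD[OF _ open_ball])
  hence "eventually (\<lambda>n. k n z0 \<in> ball c r \<and> cball c r \<subseteq> U n) sequentially"
    using U[OF cr] by eventually_elim auto
  \<comment> \<open>From index \<open>N\<close> on, the disk lies in \<open>U n\<close> and contains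
    \<open>k n z0\<close>, so a section through the point of the fibre exists. The sections
    \<open>F\<close> are therefore indexed from \<open>N\<close>.\<close>
  then obtain N where N: "\<And>n. n \<ge> N \<Longrightarrow> k n z0 \<in> ball c r \<and> cball c r \<subseteq> U n"
    by (auto simp: eventually_sequentially)
  have "\<exists>s. s holomorphic_on ball c r \<and> s ` ball c r \<subseteq> G (n + N) \<and>
          s (k (n + N) z0) = of_real (T (n + N)) * z0 \<and> (\<forall>w\<in>ball c r. h (n + N) (s w) = w)" for n
  proof -
    have "k (n + N) z0 = h (n + N) (of_real (T (n + N)) * z0)"
      by (rule k[OF z0])
    moreover have "k (n + N) z0 \<in> ball c r" "cball c r \<subseteq> U (n + N)"
      using N[of "n + N"] by simp_all
    ultimately show ?thesis
      using disc_sectionsE[OF sec[of "n + N"] _ TG[OF z0, of "n + N"]] by metis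
  qed
  hence "\<exists>F. \<forall>n. F n holomorphic_on ball c r \<and> F n ` ball c r \<subseteq> G (n + N) \<and>
          F n (k (n + N) z0) = of_real (T (n + N)) * z0 \<and> (\<forall>w\<in>ball c r. h (n + N) (F n w) = w)"
    by (intro choice allI)
  then obtain F where F: "\<And>n. F n holomorphic_on ball c r" "\<And>n. F n ` ball c r \<subseteq> G (n + N)"
     "\<And>n. F n (k (n + N) z0) = of_real (T (n + N)) * z0"
     "\<And>n w. w \<in> ball c r \<Longrightarrow> h (n + N) (F n w) = w"
    by blast
  have Fb: "cmod (F n w) < 1" if "w \<in> ball c r" for n w
    using F(2)[of n] G[of "n + N"] that by (auto simp del: mem_ball simp: image_subset_iff subset_iff) 
  define H where "H = {f. f holomorphic_on ball c r \<and> (\<forall>z\<in>ball c r. cmod (f z) \<le> 1)}"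
  obtain s q where s: "s holomorphic_on ball c r" "strict_mono (q :: nat \<Rightarrow> nat)"
      "\<And>x. x \<in> ball c r \<Longrightarrow> (\<lambda>n. F (q n) x) \<longlonglongrightarrow> s x"
      "\<And>K. compact K \<Longrightarrow> K \<subseteq> ball c r \<Longrightarrow> uniform_limit K (F \<circ> q) s sequentially"
  proof (rule Montel[of "ball c r" H F])
    show "range F \<subseteq> H"
      using F(1) Fb by (auto simp: H_def intro: less_imp_le)
    show "\<exists>B. \<forall>h\<in>H. \<forall>z\<in>K. cmod (h z) \<le> B" if "K \<subseteq> ball c r" for K
      using that by (intro exI[of _ 1]) (auto simp: H_def)
  qed (auto simp: H_def)
  have qN: "filterlim (\<lambda>i. q i + N) at_top sequentially"
    using filterlim_subseq[OF s(2)] by (rule filterlim_at_top_mono) auto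
  have Tq: "(\<lambda>i. T (q i + N)) \<longlonglongrightarrow> 1"
    by (rule filterlim_compose[OF T(1) qN])
  \<comment> \<open>Evaluate \<open>F\<close> at the moving points \<open>k n z0\<close>: the values
    are \<open>T n\<close> times \<open>z0\<close>, and both sides converge.\<close>
  have sk: "s (\<kappa> z0) = z0"
  proof -
    obtain e where e: "e > 0" "cball (\<kappa> z0) e \<subseteq> ball c r"
      using open_contains_cball[THEN iffD1, OF open_ball] kz0 by blast
    have X: "(\<lambda>i. k (q i + N) z0) \<longlonglongrightarrow> \<kappa> z0"
      by (rule lim_at[OF tendsto_const z0 qN])
    have "(\<lambda>i. (F \<circ> q) i (k (q i + N) z0)) \<longlonglongrightarrow> s (\<kappa> z0)"
    proof (rule uniform_limit_imp_tendsto_at[OF s(4)])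
      show "cball (\<kappa> z0) e \<subseteq> ball c r" by fact
      show "continuous_on (cball (\<kappa> z0) e) s"
        using holomorphic_on_imp_continuous_on[OF s(1)] e(2) by (rule continuous_on_subset)
      show "\<forall>\<^sub>F n in sequentially. k (q n + N) z0 \<in> cball (\<kappa> z0) e"
        using tendstoD[OF X e(1)] by eventually_elim (simp add: dist_commute)
    qed (use e X in auto)
    moreover have "(\<lambda>i. (F \<circ> q) i (k (q i + N) z0)) \<longlonglongrightarrow> of_real 1 * z0"
      unfolding o_def F(3) by (intro tendsto_intros Tq)
    ultimately show ?thesis
      using LIMSEQ_unique by fastforce
  qed
  have sle: "cmod (s w) \<le> 1" if "w \<in> ball c r" for w
    using tendsto_norm[OF s(3)[OF that]] by (rule LIMSEQ_le_const2) (use Fb[OF that] less_imp_le in blast)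
  \<comment> \<open>A boundary value would make \<open>s\<close> constant of modulus 1 by the
    maximum principle, against \<open>s (\<kappa> z0) = z0\<close>.\<close>
  have sb: "s w \<in> ball 0 1" if w: "w \<in> ball c r" for w
  proof (rule ccontr)
    assume "s w \<notin> ball 0 1"
    hence "cmod (s w) = 1" using sle[OF w] by simp
    hence "s constant_on ball c r"
      using sle w by (intro maximum_modulus_principle[OF s(1), of "ball c r" w]) auto
    hence "s w = s (\<kappa> z0)"
      using w kz0 unfolding constant_on_def by metis
    thus False
      using \<open>cmod (s w) = 1\<close> z0 sk by simp
  qed
  have "\<kappa> (s w) = w" if w: "w \<in> ball c r" for w
  proof -
    \<comment> \<open>\<open>k\<close> is \<open>h\<close> after scaling by \<open>T\<close>, so the
      point that \<open>k\<close> sends to \<open>w\<close> is the value of the section divided by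
      \<open>T\<close>. It is known to lie in the unit disk only eventually.\<close>
    define X where "X = (\<lambda>i. F (q i) w / of_real (T (q i + N)))"
    have "X \<longlonglongrightarrow> s w / of_real 1"
      unfolding X_def by (intro tendsto_intros s(3)[OF w] Tq) auto
    hence X: "X \<longlonglongrightarrow> s w" by simp
    have "(\<lambda>i. k (q i + N) (X i)) \<longlonglongrightarrow> \<kappa> (s w)"
      by (rule lim_at[OF X sb[OF w] qN])
    moreover have "eventually (\<lambda>i. k (q i + N) (X i) = w) sequentially"
      using topological_tendstoD[OF X open_ball sb[OF w]]
    proof eventually_elim
      case (elim i)
      show ?case
        using k[OF elim, of "q i + N"] F(4)[OF w, of "q i"] T(2)[of "q i + N"] by (simp add: X_def)
    qed
    hence "(\<lambda>i. k (q i + N) (X i)) \<longlonglongrightarrow> w"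
      by (rule tendsto_eventually)
    ultimately show ?thesis
      by (rule LIMSEQ_unique)
  qed
  thus "\<exists>s. s holomorphic_on ball c r \<and> s ` ball c r \<subseteq> ball 0 1 \<and> s (\<kappa> z0) = z0 \<and> (\<forall>w\<in>ball c r. \<kappa> (s w) = w)"
    using s(1) sb sk by blast
qed

text \<open>The sheets over a small disk are the images of all sections over it. If two sheets meet,
  their sections agree at a point; there \<open>h\<close> is locally injective, so they agree nearby
  and then everywhere by analytic continuation.\<close>

lemma disc_sections_covering_space:
  assumes sec: "disc_sections G h U" and G: "open G" "h holomorphic_on G" "h ` G = U" and U: "open U"
  shows "covering_space G h U"
proof
  show "continuous_on G h" using G(2) by (rule holomorphic_on_imp_continuous_on)
  show "h ` G = U" by fact
  fix x assume "x \<in> U"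
  then obtain r where r: "r > 0" "cball x r \<subseteq> U"
    using U open_contains_cball by blast
  define T where "T = ball x r"
  have oT: "open T" "connected T" "T \<subseteq> U" using r by (auto simp: T_def)
  define S where "S = {s. s holomorphic_on T \<and> s ` T \<subseteq> G \<and> (\<forall>w\<in>T. h (s w) = w)}"
  have un: "\<Union>((\<lambda>s. s ` T) ` S) = G \<inter> h -` T"
  proof (intro set_eqI iffI)
    fix z assume "z \<in> G \<inter> h -` T"
    hence z: "z \<in> G" "h z \<in> ball x r" by (auto simp: T_def)
    obtain s where s: "s holomorphic_on T" "s ` T \<subseteq> G" "s (h z) = z" "\<And>w. w \<in> T \<Longrightarrow> h (s w) = w"
      using disc_sectionsE[OF sec r(2) z] unfolding T_def by metis
    hence "s \<in> S" by (simp add: S_def)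
    moreover have "z \<in> s ` T" using s(3) z(2) unfolding T_def by (metis imageI)
    ultimately show "z \<in> \<Union>((\<lambda>s. s ` T) ` S)" by blast
  qed (auto simp: S_def)
  have opn: "open (s ` T)" if "s \<in> S" for s
    using that oT by (intro open_mapping_thm3 inj_on_inverseI[of T h]) (auto simp: S_def)
  have eq: "s1 ` T = s2 ` T" if s: "s1 \<in> S" "s2 \<in> S" and ne: "s1 ` T \<inter> s2 ` T \<noteq> {}" for s1 s2
  proof -
    obtain w where w: "w \<in> T" "s1 w = s2 w"
      using s ne unfolding S_def by force
    have s1w: "s1 w \<in> G" using s w by (auto simp: S_def)
    have nz: "deriv h (s1 w) \<noteq> 0"
      using deriv_section_mult[of G h T s1 w] s w G oT by (auto simp: S_def)
    obtain e where e: "e > 0" "inj_on h (ball (s1 w) e)"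
      using has_complex_derivative_locally_injective[OF G(2) _ G(1) nz] s1w by metis
    have cont: "continuous_on T s1" "continuous_on T s2"
      using s by (auto simp: S_def intro: holomorphic_on_imp_continuous_on)
    define V where "V = (T \<inter> s1 -` ball (s1 w) e) \<inter> (T \<inter> s2 -` ball (s1 w) e)"
    have V: "open V" "w \<in> V" "V \<subseteq> T"
      using cont oT e w by (auto simp: V_def intro!: continuous_open_preimage)
    have "s1 z = s2 z" if "z \<in> V" for z
    proof (rule inj_onD[OF e(2)])
      show "h (s1 z) = h (s2 z)" using that s by (simp add: V_def S_def)
    qed (use that in \<open>auto simp: V_def\<close>)
    hence "s1 z = s2 z" if "z \<in> T" for z
      using analytic_continuation_open[OF V(1) oT(1) _ oT(2) V(3), of s1 s2 z] V(2) that s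
      by (auto simp: S_def)
    thus ?thesis by auto
  qed
  have homeo: "homeomorphism (s ` T) T h s" if "s \<in> S" for s
  proof -
    have s: "s holomorphic_on T" "s ` T \<subseteq> G" "\<And>w. w \<in> T \<Longrightarrow> h (s w) = w"
      using that by (auto simp: S_def)
    have "continuous_on (s ` T) h"
      using holomorphic_on_imp_continuous_on[OF G(2)] s(2) by (rule continuous_on_subset)
    thus ?thesis
      using s holomorphic_on_imp_continuous_on[OF s(1)] unfolding homeomorphism_def
      by (simp add: image_image)
  qed
  have "openin (top_of_set U) T" "x \<in> T"
    using oT r by (auto simp: T_def open_subset)
  moreover have "\<forall>u\<in>(\<lambda>s. s ` T) ` S. openin (top_of_set G) u"
    using opn by (auto simp: S_def intro!: open_subset)
  moreover have "pairwise disjnt ((\<lambda>s. s ` T) ` S)"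
    using eq by (auto simp: pairwise_def disjnt_def)
  moreover have "\<forall>u\<in>(\<lambda>s. s ` T) ` S. \<exists>q. homeomorphism u T h q"
    using homeo by blast
  ultimately show "\<exists>T. x \<in> T \<and> openin (top_of_set U) T \<and>
           (\<exists>v. \<Union>v = G \<inter> h -` T \<and> (\<forall>u\<in>v. openin (top_of_set G) u) \<and> pairwise disjnt v \<and>
           (\<forall>u\<in>v. \<exists>q. homeomorphism u T h q))"
    using un by blast
qed

text \<open>A disk whose closure lies in \<open>U\<close> is contained in the image as soon as it
  meets it. So the image is open and closed in the connected set \<open>U\<close>.\<close>

lemma disc_sections_surj:
  assumes sec: "disc_sections G h U" and G: "open G" "h holomorphic_on G" "h ` G \<subseteq> U" "G \<noteq> {}"
    and U: "open U" "connected U"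
  shows "h ` G = U"
proof -
  have key: "ball x r \<subseteq> h ` G" if xr: "cball x r \<subseteq> U" "ball x r \<inter> h ` G \<noteq> {}" for x r
  proof -
    obtain z where z: "z \<in> G" "h z \<in> ball x r" using xr by blast
    obtain s where "s ` ball x r \<subseteq> G" "\<And>w. w \<in> ball x r \<Longrightarrow> h (s w) = w"
      using disc_sectionsE[OF sec xr(1) z] by metis
    thus ?thesis by (metis image_iff image_subset_iff subsetI)
  qed
  have nbd: "\<exists>r>0. cball x r \<subseteq> U" if "x \<in> U" for x
    using that U(1) open_contains_cball by blast
  have "open (h ` G)"
    unfolding open_contains_ball
  proof
    fix x assume x: "x \<in> h ` G"
    obtain r where "r > 0" "cball x r \<subseteq> U" using nbd x G(3) by blast
    thus "\<exists>e>0. ball x e \<subseteq> h ` G" using key[of x r] x centre_in_ball[of x r] by blast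
  qed
  moreover have "open (U - h ` G)"
    unfolding open_contains_ball
  proof
    fix x assume x: "x \<in> U - h ` G"
    obtain r where r: "r > 0" "cball x r \<subseteq> U" using nbd x by blast
    hence "ball x r \<inter> h ` G = {}" using key[of x r] x centre_in_ball[of x r] by blast
    thus "\<exists>e>0. ball x e \<subseteq> U - h ` G" using r ball_subset_cball[of x r] by blast
  qed
  ultimately show ?thesis
    using connectedD[OF U(2), of "h ` G" "U - h ` G"] G(3,4) by blast
qed

text \<open>An injective map serves as the first covering: 1/(x - a) is bounded on \<open>U\<close>,
  and after normalization its inverse is \<open>h\<close>, whose sections are all restrictions of
  \<open>j\<close>.\<close>

lemma pointed_cover_exists:
  assumes U: "open U" "w \<in> U" and d: "d > 0" "\<And>x. x \<in> U \<Longrightarrow> d < cmod (x - a)"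
  obtains G h where "pointed_cover G h U w"
proof -
  \<comment> \<open>Twice 1/d, because \<open>j\<close> subtracts two values of 1/(x - a), each of
    modulus less than 1/d.\<close>
  define R :: complex where "R = of_real (2 / d)"
  have R: "R \<noteq> 0" "cmod R = 2 / d" using d by (auto simp: R_def norm_divide)
  define j where "j = (\<lambda>x. (1 / (x - a) - 1 / (w - a)) / R)"
  define h where "h = (\<lambda>z. a + 1 / (R * z + 1 / (w - a)))"
  have nz: "x - a \<noteq> 0" if "x \<in> U" for x using d(2)[OF that] d(1) by auto
  have den: "R * j x + 1 / (w - a) = 1 / (x - a)" for x
    using R by (simp add: j_def)
  have hj: "h (j x) = x" for x
    unfolding h_def den by simp
  have holj: "j holomorphic_on U"
    unfolding j_def using nz R by (auto intro!: holomorphic_intros)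
  have oG: "open (j ` U)"
    using holj U hj by (intro open_mapping_thm3 inj_on_inverseI[of U h]) auto
  have holh: "h holomorphic_on j ` U"
    unfolding h_def using den nz by (auto intro!: holomorphic_intros)
  have j1: "cmod (j x) < 1" if x: "x \<in> U" for x
  proof -
    have *: "cmod (1 / (y - a)) < 1 / d" if "y \<in> U" for y
      using d(2)[OF that] d(1) by (simp add: norm_divide norm_inverse inverse_eq_divide[symmetric] less_imp_inverse_less)
    have "cmod (1 / (x - a) - 1 / (w - a)) \<le> cmod (1 / (x - a)) + cmod (1 / (w - a))"
      by (rule norm_triangle_ineq4)
    also have "\<dots> < 2 / d" using *[OF x] *[OF U(2)] by simp
    also have "2 / d = cmod R" using R by simp
    finally show ?thesis
      unfolding j_def norm_divide using R(1) by simp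
  qed
  have "disc_sections (j ` U) h U"
    unfolding disc_sections_def
  proof (intro allI impI)
    fix c r z assume cr: "cball c r \<subseteq> U" and z: "z \<in> j ` U" "h z \<in> ball c r"
    have sub: "ball c r \<subseteq> U" using cr ball_subset_cball[of c r] by blast
    have "j holomorphic_on ball c r" using holj sub by (rule holomorphic_on_subset)
    moreover have "j ` ball c r \<subseteq> j ` U" using sub by blast
    moreover have "j (h z) = z" using z hj by auto
    ultimately show "\<exists>s. s holomorphic_on ball c r \<and> s ` ball c r \<subseteq> j ` U \<and> s (h z) = z \<and>
             (\<forall>w\<in>ball c r. h (s w) = w)"
      using hj by blast
  qed
  moreover have "j w = 0" by (simp add: j_def)
  ultimately have "pointed_cover (j ` U) h U w"
    unfolding pointed_cover_def using oG holh hj j1 imageI[OF U(2), of j] hj[of w]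
    by (simp add: image_subset_iff)
  thus ?thesis by (rule that)
qed

text \<open>Schottky's bound on the disk of radius \<open>t\<close> for functions on the closed unit
  disk that omit 0 and 1 and have modulus at most \<open>R\<close> at 0.\<close>

definition schottky_bound :: "real \<Rightarrow> real \<Rightarrow> real" where
  "schottky_bound R t = exp (pi * exp (pi * (2 + 2 * R + 12 * t / (1 - t))))"

lemma norm_le_omit_two:
  assumes "f holomorphic_on cball 0 1" "\<And>z. z \<in> cball 0 1 \<Longrightarrow> f z \<noteq> a \<and> f z \<noteq> b" "a \<noteq> b"
    and "0 < t" "t < 1" "cmod z \<le> t"
  shows "cmod (f z) \<le> cmod a + cmod (b - a) * schottky_bound (cmod ((f 0 - a) / (b - a))) t"
proof -
  define g where "g = (\<lambda>z. (f z - a) / (b - a))"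
  have "g holomorphic_on cball 0 1"
    unfolding g_def using assms by (intro holomorphic_intros) auto
  moreover have "\<not> (g z = 0 \<or> g z = 1)" if "z \<in> cball 0 1" for z
    using assms(2)[OF that] assms(3) by (auto simp: g_def)
  ultimately have "cmod (g z) \<le> schottky_bound (cmod (g 0)) t"
    unfolding schottky_bound_def using assms(4-) by (intro Schottky) auto
  hence "cmod (b - a) * cmod (g z) \<le> cmod (b - a) * schottky_bound (cmod (g 0)) t"
    by (rule mult_left_mono) simp
  moreover have "f z = a + (b - a) * g z"
    using assms(3) by (simp add: g_def)
  hence "cmod (f z) \<le> cmod a + cmod (b - a) * cmod (g z)"
    by (metis norm_mult norm_triangle_ineq)
  ultimately show ?thesis by (simp add: g_def)
qed

lemma eventually_cball_subset_Diff:
  fixes a :: complex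
  assumes "cball c r \<subseteq> U" "a \<notin> U" "D \<longlonglongrightarrow> 0"
  shows "eventually (\<lambda>n. cball c r \<subseteq> U - cball a (D n)) sequentially"
\<comment> \<open>The empty disk is split off because \<open>setdist\<close> to the empty set is
  0.\<close>
proof (cases "cball c r = {}")
  case False
  have "a \<notin> cball c r" using assms by auto
  hence "setdist {a} (cball c r) > 0"
    using False setdist_eq_0_closed[of "cball c r" a] by (simp add: less_le setdist_pos_le)
  hence "eventually (\<lambda>n. D n < setdist {a} (cball c r)) sequentially"
    using assms(3) by (rule order_tendstoD(2)[rotated])
  thus ?thesis
  proof eventually_elim
    case (elim n)
    have "dist a x > D n" if "x \<in> cball c r" for x
      using setdist_le_dist[of a "{a}" x "cball c r"] that elim by simp
    thus ?case using assms(1) by fastforce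
  qed
qed auto

theorem plane_uniformization:
  assumes U: "open U" "connected U" "w \<in> U" and ab: "a \<notin> U" "b \<notin> U" "a \<noteq> b"
  obtains h where "h holomorphic_on ball 0 1" "h ` ball 0 1 = U" "h 0 = w"
    "disc_sections (ball 0 1) h U"
proof -
  define d where "d = cmod (w - a)"
  have d: "d > 0" using U(3) ab(1) by (auto simp: d_def)
  \<comment> \<open>The removed disks have radius at most d/2, so they never contain
    \<open>w\<close>.\<close>
  define D where "D = (\<lambda>n::nat. d / (real n + 2))"
  have D: "D n > 0" "D n \<le> d / 2" for n using d by (auto simp: D_def field_simps)
  have D0: "D \<longlonglongrightarrow> 0" unfolding D_def by real_asymp
  define V where "V = (\<lambda>n. U - cball a (D n))"
  have oV: "open (V n)" for n unfolding V_def using U(1) by (intro open_Diff) auto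
  obtain e where e: "e > 0" "cball w e \<subseteq> U"
    using U(1,3) open_contains_cball by blast
  \<comment> \<open>A disk about \<open>w\<close> common to all \<open>V n\<close>: its points are
    at distance at least 2d/3 from \<open>a\<close>, beyond every \<open>D n\<close>. It makes the
    lower bound on the derivatives uniform in n.\<close>
  define \<rho> where "\<rho> = min e (d / 3)"
  have \<rho>: "\<rho> > 0" using e d by (simp add: \<rho>_def)
  have \<rho>V: "cball w \<rho> \<subseteq> V n" for n
  proof
    fix x assume x: "x \<in> cball w \<rho>"
    hence "d \<le> cmod (x - a) + d / 3"
      using norm_triangle_ineq[of "w - x" "x - a"] by (simp add: d_def \<rho>_def dist_norm)
    hence "dist a x > D n" using D(2)[of n] d by (simp add: dist_norm norm_minus_commute)
    thus "x \<in> V n" using x e by (auto simp: V_def \<rho>_def)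
  qed
  hence wV: "w \<in> V n" for n using \<rho> by (metis centre_in_cball less_imp_le subsetD)
  define T where "T = (\<lambda>n::nat. 1 - 1 / (real n + 2))"
  have T: "0 < T n" "T n < 1" "1 / 2 \<le> T n" for n by (auto simp: T_def field_simps)
  have T1: "T \<longlonglongrightarrow> 1" unfolding T_def by real_asymp
  have "\<exists>G h. pointed_cover G h (V n) w \<and> cball 0 (T n) \<subseteq> G" for n
  proof -
    have "D n < cmod (x - a)" if "x \<in> V n" for x
      using that by (simp add: V_def dist_norm norm_minus_commute)
    then obtain G0 h0 where "pointed_cover G0 h0 (V n) w"
      using pointed_cover_exists[OF oV wV D(1)] by metis
    \<comment> \<open>The index is shifted by one so that the closed disk of radius
      \<open>T n\<close> lies in \<open>G n\<close>; the rescaled maps are then holomorphic on the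
      closed unit disk, as the Schottky bound requires.\<close>
    then obtain G h where G: "pointed_cover G h (V n) w" "ball 0 (T (Suc n)) \<subseteq> G"
      using pointed_cover_ball[OF _ oV wV T(1,2)] by metis
    have "T n < T (Suc n)" by (auto simp: T_def field_simps)
    hence "cball 0 (T n) \<subseteq> G" using G(2) by (auto simp: subset_iff)
    with G(1) show ?thesis by blast
  qed
  then obtain G h where G: "\<And>n. pointed_cover (G n) (h n) (V n) w" "\<And>n. cball 0 (T n) \<subseteq> G n"
    by metis
  define k where "k = (\<lambda>n z. h n (of_real (T n) * z))"
  have TG: "of_real (T n) * z \<in> G n" if "z \<in> cball 0 1" for n z
  proof -
    have "of_real (T n) * z \<in> cball 0 (T n)"
      using that T(1)[of n] by (simp add: norm_mult mult_left_le)
    thus ?thesis using G(2) by blast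
  qed
  have kV: "k n z \<in> V n" if "z \<in> cball 0 1" for n z
    using pointed_coverD(5)[OF G(1)[of n]] TG[OF that] by (auto simp: k_def)
  have kab: "k n z \<noteq> a \<and> k n z \<noteq> b" if "z \<in> cball 0 1" for n z
    using kV[OF that, of n] ab by (auto simp: V_def)
  have kh: "k n holomorphic_on cball 0 1" for n
    unfolding k_def using TG
    by (intro holomorphic_on_compose_gen[OF _ pointed_coverD(4)[OF G(1)], unfolded o_def] holomorphic_intros) auto
  have k0: "k n 0 = w" for n
    using pointed_coverD(6)[OF G(1)[of n]] by (simp add: k_def)
  have dk: "\<rho> / 2 \<le> cmod (deriv (k n) 0)" for n
  proof -
    note P = pointed_coverD[OF G(1)[of n]]
    have "(h n has_field_derivative deriv (h n) 0) (at (of_real (T n) * 0))"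
      using P by (auto intro!: holomorphic_derivI[of _ "G n"])
    moreover have "((\<lambda>z. of_real (T n) * z) has_field_derivative of_real (T n)) (at 0)"
      by (auto intro!: derivative_eq_intros)
    ultimately have "(h n \<circ> (\<lambda>z. of_real (T n) * z) has_field_derivative deriv (h n) 0 * of_real (T n)) (at 0)"
      by (rule DERIV_chain)
    hence "deriv (k n) 0 = deriv (h n) 0 * of_real (T n)"
      unfolding k_def o_def by (rule DERIV_imp_deriv)
    moreover have "\<rho> \<le> cmod (deriv (h n) 0)"
      using pointed_cover_deriv_ge[OF G(1) \<rho> \<rho>V] .
    ultimately show ?thesis
      using T(3)[of n] T(1)[of n] \<rho> mult_mono[of \<rho> "cmod (deriv (h n) 0)" "1/2" "T n"]
      by (simp add: norm_mult)
  qed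
  define H where "H = {f. f holomorphic_on cball 0 1 \<and> f 0 = w \<and> (\<forall>z\<in>cball 0 1. f z \<noteq> a \<and> f z \<noteq> b)}"
  obtain \<kappa> q where \<kappa>: "\<kappa> holomorphic_on ball 0 1" "strict_mono (q :: nat \<Rightarrow> nat)"
      "\<And>x. x \<in> ball 0 1 \<Longrightarrow> (\<lambda>n. k (q n) x) \<longlonglongrightarrow> \<kappa> x"
      "\<And>K. compact K \<Longrightarrow> K \<subseteq> ball 0 1 \<Longrightarrow> uniform_limit K (k \<circ> q) \<kappa> sequentially"
  proof (rule Montel[of "ball 0 1" H k])
    show "range k \<subseteq> H"
    proof
      fix f assume "f \<in> range k"
      then obtain n where "f = k n" by blast
      thus "f \<in> H" using kh[of n] k0[of n] kab[of _ n] by (simp add: H_def)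
    qed
    show "\<exists>B. \<forall>h\<in>H. \<forall>z\<in>K. cmod (h z) \<le> B" if K: "compact K" "K \<subseteq> ball 0 1" for K
    proof -
      obtain t where t: "0 < t" "t < 1" "K \<subseteq> cball 0 t"
        using compact_subset_unit_ball[OF K] by blast
      have "cmod (f z) \<le> cmod a + cmod (b - a) * schottky_bound (cmod ((w - a) / (b - a))) t"
        if "f \<in> H" "z \<in> K" for f z
        using norm_le_omit_two[of f a b t z] that t ab by (auto simp: H_def)
      thus ?thesis by blast
    qed
  qed (auto simp: H_def intro: holomorphic_on_subset)
  have q: "filterlim q at_top sequentially"
    using \<kappa>(2) by (rule filterlim_subseq)
  have k0': "\<kappa> 0 = w"
    using \<kappa>(3)[of 0] k0 by (simp add: LIMSEQ_const_iff)
  have khb: "k n holomorphic_on ball 0 1" for n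
    using kh ball_subset_cball by (rule holomorphic_on_subset)
  have "(\<lambda>n. deriv (k (q n)) 0) \<longlonglongrightarrow> deriv \<kappa> 0"
  proof (rule deriv_complex_uniform_limit)
    show "uniform_limit (ball 0 (1/2)) (\<lambda>n. k (q n)) \<kappa> sequentially"
      using uniform_limit_on_subset[OF \<kappa>(4)[of "cball 0 (1/2)"], of "ball 0 (1/2)"]
      by (simp add: o_def cball_subset_ball_iff)
    show "\<forall>\<^sub>F n in sequentially. k (q n) holomorphic_on ball 0 (1/2)"
      using khb by (auto intro!: always_eventually holomorphic_on_subset[OF khb])
  qed auto
  \<comment> \<open>The uniform lower bound passes to the limit, which is therefore nonconstant, as
    Hurwitz's theorem demands.\<close>
  hence "\<rho> / 2 \<le> cmod (deriv \<kappa> 0)"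
    using dk by (intro LIMSEQ_le_const[OF tendsto_norm]) auto
  hence d0: "deriv \<kappa> 0 \<noteq> 0" using \<rho> by auto
  have nc: "\<not> \<kappa> constant_on ball 0 1"
  proof
    assume "\<kappa> constant_on ball 0 1"
    then obtain c where "\<And>z. z \<in> ball 0 1 \<Longrightarrow> \<kappa> z = c" by (auto simp: constant_on_def)
    hence "(\<kappa> has_field_derivative 0) (at 0)"
      by (intro has_field_derivative_transform_within_open[OF DERIV_const open_ball, of 0 0 1 c]) auto
    with d0 DERIV_imp_deriv show False by blast
  qed
  have \<kappa>U: "\<kappa> z \<in> U" if z: "z \<in> ball 0 1" for z
  proof (rule ccontr)
    assume n: "\<kappa> z \<notin> U"
    \<comment> \<open>No approximant takes the value \<open>\<kappa> z\<close> if that value lies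
      outside \<open>U\<close>. By Hurwitz \<open>\<kappa>\<close> would not take it either, which
      is absurd at \<open>z\<close>.\<close>
    have "\<kappa> z - \<kappa> z \<noteq> 0"
    proof (rule Hurwitz_no_zeros[of "ball 0 1" "\<lambda>n x. k (q n) x - \<kappa> z" "\<lambda>x. \<kappa> x - \<kappa> z"])
      show "uniform_limit K (\<lambda>n x. k (q n) x - \<kappa> z) (\<lambda>x. \<kappa> x - \<kappa> z) sequentially"
        if "compact K" "K \<subseteq> ball 0 1" for K
        using \<kappa>(4)[OF that] by (intro uniform_limit_intros) (auto simp: o_def)
      show "\<not> (\<lambda>x. \<kappa> x - \<kappa> z) constant_on ball 0 1"
        using nc unfolding constant_on_def by (metis diff_add_cancel)
      show "k (q n) x - \<kappa> z \<noteq> 0" if "x \<in> ball 0 1" for n x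
        using kV[of x "q n"] n that by (auto simp: V_def)
    qed (use z in \<open>auto intro!: holomorphic_intros khb \<kappa>(1)\<close>)
    thus False by simp
  qed
  have ds: "disc_sections (ball 0 1) \<kappa> U"
  proof (rule disc_sections_limit[where G = "\<lambda>n. G (q n)" and h = "\<lambda>n. h (q n)" and U = "\<lambda>n. V (q n)"
        and T = "\<lambda>n. T (q n)" and k = "\<lambda>n. k (q n)"])
    show "disc_sections (G (q n)) (h (q n)) (V (q n))" "G (q n) \<subseteq> ball 0 1" for n
      using pointed_coverD[OF G(1)[of "q n"]] by auto
    show "(\<lambda>n. T (q n)) \<longlonglongrightarrow> 1" by (rule filterlim_compose[OF T1 q])
    show "T (q n) > 0" for n by (rule T)
    show "of_real (T (q n)) * z \<in> G (q n)" if "z \<in> ball 0 1" for n z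
      using TG[of z "q n"] that by auto
    show "k (q n) z = h (q n) (of_real (T (q n)) * z)" for n z by (simp add: k_def)
    show "uniform_limit K (\<lambda>n. k (q n)) \<kappa> sequentially" if "compact K" "K \<subseteq> ball 0 1" for K
      using \<kappa>(4)[OF that] by (simp add: o_def)
    show "\<kappa> holomorphic_on ball 0 1" by fact
    show "\<forall>\<^sub>F n in sequentially. cball c r \<subseteq> V (q n)" if "cball c r \<subseteq> U" for c r
      unfolding V_def using eventually_cball_subset_Diff[OF that ab(1) filterlim_compose[OF D0 q]] .
  qed
  have "\<kappa> ` ball 0 1 = U"
    using \<kappa>U by (intro disc_sections_surj[OF ds _ \<kappa>(1) _ _ U(1,2)] image_subsetI) auto
  thus ?thesis using that \<kappa>(1) k0' ds by blast
qed

section \<open>Topology and analytic charts of the sphere\<close>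

lemma sqrt_one_plus_norm_sq_ge: "1 \<le> sqrt (1 + (cmod z)\<^sup>2)" "cmod z \<le> sqrt (1 + (cmod z)\<^sup>2)"
  by (auto intro: real_le_rsqrt)

lemma dist_Fin_Fin: "dist (Fin z) (Fin w) = cmod (z - w) / (sqrt (1 + (cmod z)\<^sup>2) * sqrt (1 + (cmod w)\<^sup>2))"
  by (simp add: dist_csphere_def real_sqrt_mult)

lemma dist_Fin_Infty: "dist (Fin z) Infty = 1 / sqrt (1 + (cmod z)\<^sup>2)"
  by (simp add: dist_csphere_def)

lemma dist_Fin_le: "dist (Fin z) (Fin w) \<le> cmod (z - w)"
proof -
  have "1 * 1 \<le> sqrt (1 + (cmod z)\<^sup>2) * sqrt (1 + (cmod w)\<^sup>2)"
    by (intro mult_mono sqrt_one_plus_norm_sq_ge) auto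
  hence "cmod (z - w) / (sqrt (1 + (cmod z)\<^sup>2) * sqrt (1 + (cmod w)\<^sup>2)) \<le> cmod (z - w) / 1"
    by (intro divide_left_mono) auto
  thus ?thesis by (simp add: dist_Fin_Fin)
qed

text \<open>For finite points this is Cauchy-Schwarz for the vectors (|z|, 1) and (1, |w|).\<close>

lemma dist_csphere_le_1: "dist x y \<le> (1::real)" for x y :: csphere
proof -
  have 1: "dist (Fin z) Infty \<le> 1" for z
    unfolding dist_Fin_Infty using sqrt_one_plus_norm_sq_ge(1)[of z]
    by (subst divide_le_eq_1_pos) linarith+
  have 2: "dist (Fin z) (Fin w) \<le> 1" for z w
  proof -
    have "cmod (z - w) \<le> cmod z * 1 + 1 * cmod w"
      using norm_triangle_ineq4[of z w] by simp
    also have "\<dots> \<le> sqrt ((cmod z)\<^sup>2 + 1\<^sup>2) * sqrt (1\<^sup>2 + (cmod w)\<^sup>2)"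
    proof -
      have "(cmod z * 1 + 1 * cmod w)\<^sup>2 \<le> ((cmod z)\<^sup>2 + 1\<^sup>2) * (1\<^sup>2 + (cmod w)\<^sup>2)"
        using zero_le_power2[of "cmod z * cmod w - 1"]
        by (simp add: power2_eq_square algebra_simps)
      thus ?thesis unfolding real_sqrt_mult[symmetric] by (rule real_le_rsqrt)
    qed
    finally have "cmod (z - w) \<le> sqrt (1 + (cmod z)\<^sup>2) * sqrt (1 + (cmod w)\<^sup>2)"
      by (simp add: add.commute)
    moreover have "0 < sqrt (1 + (cmod z)\<^sup>2) * sqrt (1 + (cmod w)\<^sup>2)"
      using one_plus_norm_sq_pos by simp
    ultimately show ?thesis by (simp add: dist_Fin_Fin)
  qed
  show ?thesis
    using 1 2 by (cases x; cases y) (auto simp: dist_commute[of Infty])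
qed

text \<open>Inversion is a chordal isometry exchanging the two charts, so facts on
  \<open>fin_chart\<close> carry over to \<open>inf_chart\<close>.\<close>

fun sinv :: "csphere \<Rightarrow> csphere" where
  "sinv (Fin z) = (if z = 0 then Infty else Fin (inverse z))"
| "sinv Infty = Fin 0"

lemma sinv_sinv [simp]: "sinv (sinv x) = x"
  by (cases x) auto

lemma inf_chart_eq: "inf_chart x = fin_chart (sinv x)"
  by (cases x) auto

lemma dist_sinv [simp]: "dist (sinv x) (sinv y) = dist x y"
proof -
  have s: "sqrt (1 + (cmod (inverse z))\<^sup>2) = sqrt (1 + (cmod z)\<^sup>2) / cmod z" if "z \<noteq> 0" for z
  proof -
    have "1 + (cmod (inverse z))\<^sup>2 = (1 + (cmod z)\<^sup>2) / (cmod z)\<^sup>2"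
      using that by (simp add: norm_inverse norm_divide power_divide field_simps)
    thus ?thesis by (simp add: real_sqrt_divide)
  qed
  have FI: "dist (sinv (Fin z)) (sinv Infty) = dist (Fin z) Infty" for z
    by (simp add: dist_commute[of Infty] dist_Fin_Infty dist_Fin_Fin s[unfolded norm_inverse] norm_inverse)
  have F0: "dist (sinv (Fin z)) (sinv (Fin 0)) = dist (Fin z) (Fin 0)" for z
    by (simp add: dist_commute[of Infty] dist_Fin_Infty dist_Fin_Fin s[unfolded norm_inverse] norm_inverse)
  have FF: "dist (sinv (Fin z)) (sinv (Fin w)) = dist (Fin z) (Fin w)" if "z \<noteq> 0" "w \<noteq> 0" for z w
  proof -
    have "inverse z - inverse w = - (z - w) / (z * w)" using that by (simp add: field_simps)
    hence "cmod (inverse z - inverse w) = cmod (z - w) / (cmod z * cmod w)"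
      by (metis norm_divide norm_minus_cancel norm_mult)
    thus ?thesis using that by (simp add: dist_Fin_Fin s[unfolded norm_inverse] norm_inverse)
  qed
  have FF': "dist (sinv (Fin z)) (sinv (Fin w)) = dist (Fin z) (Fin w)" for z w
    using FF[of z w] F0[of z] F0[of w] by (metis dist_commute)
  show ?thesis
    using FI FF' by (cases x; cases y) (metis dist_commute dist_self)+
qed

lemma continuous_on_Fin: "continuous_on S Fin"
  unfolding continuous_on_iff
  by (metis dist_Fin_le dist_norm le_less_trans)

lemma continuous_on_sinv: "continuous_on S sinv"
  unfolding continuous_on_iff by auto

text \<open>Comparing the distances of both points to \<open>Infty\<close> by the triangle
  inequality gives B < 2A, so the factor by which the two metrics differ is controlled by
  \<open>z\<close> alone.\<close>

lemma dist_Fin_local: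
  assumes "dist (Fin w) (Fin z) < 1 / (2 * sqrt (1 + (cmod z)\<^sup>2))"
  shows "cmod (w - z) \<le> 2 * (1 + (cmod z)\<^sup>2) * dist (Fin w) (Fin z)"
proof -
  define A B where "A = sqrt (1 + (cmod z)\<^sup>2)" and "B = sqrt (1 + (cmod w)\<^sup>2)"
  have AB: "A > 0" "B > 0" "A\<^sup>2 = 1 + (cmod z)\<^sup>2" using one_plus_norm_sq_pos by (auto simp: A_def B_def)
  have "1 / A \<le> 1 / B + dist (Fin w) (Fin z)"
    using dist_triangle[of "Fin z" Infty "Fin w"] 
    by (simp add: dist_Fin_Infty A_def B_def dist_commute[of "Fin w" "Fin z"])
  hence "1 / (2 * A) < 1 / B"
    using assms by (simp add: A_def[symmetric])
  hence "B < 2 * A" using AB by (simp add: field_simps)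
  have "dist (Fin w) (Fin z) = cmod (w - z) / (B * A)"
    by (simp add: dist_Fin_Fin A_def B_def)
  hence "cmod (w - z) = dist (Fin w) (Fin z) * (B * A)"
    using AB by simp
  also have "\<dots> \<le> dist (Fin w) (Fin z) * ((2 * A) * A)"
    using \<open>B < 2 * A\<close> AB by (intro mult_left_mono mult_right_mono) auto
  finally show ?thesis unfolding AB(3)[symmetric] by (simp add: power2_eq_square mult_ac)
qed

lemma continuous_on_fin_chart: "continuous_on (- {Infty}) fin_chart"
  unfolding continuous_on_iff
proof (intro ballI allI impI)
  fix x :: csphere and e :: real
  assume "x \<in> - {Infty}" "e > 0"
  then obtain z where x: "x = Fin z" by (cases x) auto
  define A where "A = 1 + (cmod z)\<^sup>2"
  have A: "A > 0" using one_plus_norm_sq_pos by (simp add: A_def)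
  define d where "d = min (1 / (2 * sqrt A)) (e / (2 * A))"
  have "dist (fin_chart y) (fin_chart x) < e" if y: "y \<in> - {Infty}" "dist y x < d" for y
  proof -
    obtain w where w: "y = Fin w" using y by (cases y) auto
    have "cmod (w - z) \<le> 2 * A * dist (Fin w) (Fin z)"
      using dist_Fin_local[of w z] y by (simp add: d_def w x A_def)
    also have "\<dots> < 2 * A * (e / (2 * A))"
      using y A by (intro mult_strict_left_mono) (auto simp: d_def w x)
    finally show ?thesis using A by (simp add: w x dist_norm)
  qed
  moreover have "d > 0" using A \<open>e > 0\<close> by (simp add: d_def)
  ultimately show "\<exists>d>0. \<forall>x'\<in>- {Infty}. dist x' x < d \<longrightarrow> dist (fin_chart x') (fin_chart x) < e"
    by blast
qed

lemma continuous_on_inf_chart: "continuous_on (- {Fin 0}) inf_chart"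
proof -
  have "continuous_on (- {Fin 0}) (fin_chart \<circ> sinv)"
  proof (rule continuous_on_compose[OF continuous_on_sinv continuous_on_subset[OF continuous_on_fin_chart]])
    show "sinv ` (- {Fin 0}) \<subseteq> - {Infty}"
      by (metis ComplD ComplI image_subsetI singleton_iff sinv.simps(2) sinv_sinv)
  qed
  thus ?thesis by (simp add: inf_chart_eq[abs_def] o_def)
qed

text \<open>The sphere is covered by the closed unit disk and its image under inversion.\<close>

lemma compact_csphere: "compact (S :: csphere set)" if "closed S"
proof -
  have "x \<in> Fin ` cball 0 1 \<union> sinv ` Fin ` cball 0 1" for x
  proof (cases x)
    case (Fin z)
    show ?thesis
    proof (cases "cmod z \<le> 1")
      case False
      hence "cmod (inverse z) \<le> 1" by (simp add: norm_inverse inverse_le_1_iff)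
      moreover have "x = sinv (Fin (inverse z))" using Fin False by auto
      ultimately show ?thesis by (metis UnI2 imageI mem_cball_0)
    qed (simp add: Fin)
  next
    case Infty
    hence "x = sinv (Fin 0)" by simp
    moreover have "Fin 0 \<in> Fin ` cball 0 1" by simp
    ultimately show ?thesis by blast
  qed
  hence "(UNIV :: csphere set) = Fin ` cball 0 1 \<union> sinv ` Fin ` cball 0 1" by blast
  moreover have "compact (Fin ` cball 0 1 \<union> sinv ` Fin ` cball 0 1)"
    by (intro compact_Un compact_continuous_image continuous_on_Fin continuous_on_sinv compact_cball)
  ultimately have "compact (UNIV :: csphere set)" by simp
  thus ?thesis using that by (metis compact_Int_closed inf_top_left)
qed

lemma open_image_Fin:
  assumes "open S"
  shows "open (Fin ` S)"
proof -
  have "Fin ` S = (- {Infty}) \<inter> fin_chart -` S"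
  proof (intro set_eqI iffI)
    fix x assume "x \<in> (- {Infty}) \<inter> fin_chart -` S"
    thus "x \<in> Fin ` S" by (cases x) auto
  qed auto
  thus ?thesis
    using continuous_open_preimage[OF continuous_on_fin_chart _ assms] by auto
qed

lemma open_vimage_Fin:
  assumes "open S"
  shows "open (Fin -` S)"
  using assms by (rule open_vimage) (rule continuous_on_Fin)

lemma sphere_holomorphic_on_Fin:
  assumes "g holomorphic_on S"
  shows "sphere_holomorphic_on (Fin \<circ> g) S"
proof -
  have "continuous_on S (Fin \<circ> g)"
    by (intro continuous_on_compose continuous_on_Fin holomorphic_on_imp_continuous_on assms)
  moreover have "fin_chart \<circ> (Fin \<circ> g) holomorphic_on {z \<in> S. (Fin \<circ> g) z \<noteq> Infty}"
    using assms by (simp add: o_def)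
  moreover have "inf_chart \<circ> (Fin \<circ> g) holomorphic_on {z \<in> S. (Fin \<circ> g) z \<noteq> Fin 0}"
    using holomorphic_on_subset[OF assms, of "{z \<in> S. g z \<noteq> 0}"]
    by (auto simp: o_def subset_iff intro!: holomorphic_intros)
  ultimately show ?thesis by (simp add: sphere_holomorphic_on_def)
qed

section \<open>Existence of the universal covering\<close>

lemma covering_space_comp_homeomorphism:
  assumes cov: "covering_space c p S" and hom: "homeomorphism S T h k"
  shows "covering_space c (h \<circ> p) T"
proof
  note H = hom[unfolded homeomorphism_def]
  have pc: "p ` c = S" using cov by (rule covering_space_imp_surjective)
  show "continuous_on c (h \<circ> p)"
    using covering_space_imp_continuous[OF cov] H pc by (intro continuous_on_compose) auto
  show "(h \<circ> p) ` c = T" unfolding image_comp[symmetric] pc using H by simp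
  fix y assume y: "y \<in> T"
  hence "k y \<in> S" using H by auto
  then obtain V v where V: "k y \<in> V" "openin (top_of_set S) V" and
    v: "\<Union>v = c \<inter> p -` V" "\<forall>u\<in>v. openin (top_of_set c) u" "pairwise disjnt v"
       "\<forall>u\<in>v. \<exists>q. homeomorphism u V p q"
    using cov unfolding covering_space_def by meson
  have VS: "V \<subseteq> S" using V(2) openin_subset by fastforce
  have hV: "homeomorphism V (h ` V) h k"
    using homeomorphism_of_subsets[OF hom VS _ refl, of T] VS H by blast
  have "y \<in> h ` V" using V(1) H y by (metis image_eqI)
  moreover have "openin (top_of_set T) (h ` V)"
    using homeomorphism_imp_open_map[OF hom V(2)] .
  moreover have "\<Union>v = c \<inter> (h \<circ> p) -` (h ` V)"
  proof -
    have "p x \<in> V \<longleftrightarrow> h (p x) \<in> h ` V" if "x \<in> c" for x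
    proof -
      have "inj_on h S" using H by (intro inj_on_inverseI[of S k]) auto
      moreover have "p x \<in> S" using that pc by blast
      ultimately show ?thesis using inj_on_image_mem_iff VS by metis
    qed
    thus ?thesis using v(1) by auto
  qed
  moreover have "\<forall>u\<in>v. \<exists>q. homeomorphism u (h ` V) (h \<circ> p) q"
    using v(4) homeomorphism_compose[OF _ hV] by blast
  ultimately show "\<exists>W. y \<in> W \<and> openin (top_of_set T) W \<and>
      (\<exists>v. \<Union>v = c \<inter> (h \<circ> p) -` W \<and> (\<forall>u\<in>v. openin (top_of_set c) u) \<and> pairwise disjnt v \<and>
        (\<forall>u\<in>v. \<exists>q. homeomorphism u W (h \<circ> p) q))"
    using v(2,3) by blast
qed

text \<open>The inverse of u = 1/(x - a). It moves a domain containing \<open>Infty\<close> into the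
  plane by sending a boundary point \<open>a\<close> to infinity.\<close>

definition chart_at :: "complex \<Rightarrow> complex \<Rightarrow> csphere" where
  "chart_at a u = (if u = 0 then Infty else Fin (a + inverse u))"

fun chart_at_inv :: "complex \<Rightarrow> csphere \<Rightarrow> complex" where
  "chart_at_inv a (Fin z) = inverse (z - a)"
| "chart_at_inv a Infty = 0"

lemma chart_at_inverses:
  "chart_at_inv a (chart_at a u) = u" "x \<noteq> Fin a \<Longrightarrow> chart_at a (chart_at_inv a x) = x"
proof -
  show "chart_at_inv a (chart_at a u) = u" by (simp add: chart_at_def)
  show "x \<noteq> Fin a \<Longrightarrow> chart_at a (chart_at_inv a x) = x"
    by (cases x) (auto simp: chart_at_def)
qed

lemma continuous_on_chart_at: "continuous_on S (chart_at a)"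
proof -
  have 1: "continuous_on (- {0}) (chart_at a)"
  proof -
    have "continuous_on (- {0}) (Fin \<circ> (\<lambda>u. a + inverse u))"
      by (intro continuous_on_compose continuous_on_Fin continuous_intros) auto
    thus ?thesis
      by (rule continuous_on_eq) (auto simp: chart_at_def)
  qed
  \<comment> \<open>Near u = 0 continuity is seen on the reciprocal, 1/(a + 1/u) = u/(1 + a u), to
    which the isometry \<open>sinv\<close> is applied.\<close>
  have 2: "continuous_on {u. 1 + a * u \<noteq> 0} (chart_at a)"
  proof -
    have "continuous_on {u. 1 + a * u \<noteq> 0} (sinv \<circ> (Fin \<circ> (\<lambda>u. u / (1 + a * u))))"
      by (intro continuous_on_compose continuous_on_Fin continuous_on_sinv continuous_intros) auto
    thus ?thesis
      by (rule continuous_on_eq) (auto simp: chart_at_def field_simps)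
  qed
  have "continuous_on (- {0} \<union> {u. 1 + a * u \<noteq> 0}) (chart_at a)"
    by (rule continuous_on_open_Un[OF _ _ 1 2]) (auto intro!: open_Collect_neq continuous_intros)
  moreover have "S \<subseteq> - {0} \<union> {u. 1 + a * u \<noteq> 0}" by auto
  ultimately show ?thesis by (rule continuous_on_subset)
qed

lemma continuous_on_chart_at_inv: "continuous_on (- {Fin a}) (chart_at_inv a)"
proof -
  have 1: "continuous_on (- {Fin a, Infty}) (chart_at_inv a)"
  proof -
    have "fin_chart x - a \<noteq> 0" if "x \<in> - {Fin a, Infty}" for x using that by (cases x) auto
    hence "continuous_on (- {Fin a, Infty}) (\<lambda>x. inverse (fin_chart x - a))"
      by (intro continuous_intros continuous_on_subset[OF continuous_on_fin_chart]) auto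
    thus ?thesis
    proof (rule continuous_on_eq)
      fix x assume "x \<in> - {Fin a, Infty}"
      thus "inverse (fin_chart x - a) = chart_at_inv a x" by (cases x) auto
    qed
  qed
  \<comment> \<open>Here 1/(x - a) is rewritten in terms of 1/x, which makes sense at
    \<open>Infty\<close>.\<close>
  have 2: "continuous_on (- {Fin a, Fin 0}) (chart_at_inv a)"
  proof -
    have nz: "1 - a * inf_chart x \<noteq> 0" if "x \<in> - {Fin a, Fin 0}" for x
      using that by (cases x) (auto simp: field_simps)
    hence "continuous_on (- {Fin a, Fin 0}) (\<lambda>x. inf_chart x / (1 - a * inf_chart x))"
      by (intro continuous_intros continuous_on_subset[OF continuous_on_inf_chart]) auto
    thus ?thesis
    proof (rule continuous_on_eq)
      fix x assume "x \<in> - {Fin a, Fin 0}"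
      thus "inf_chart x / (1 - a * inf_chart x) = chart_at_inv a x" by (cases x) (auto simp: field_simps)
    qed
  qed
  have "continuous_on (- {Fin a, Infty} \<union> - {Fin a, Fin 0}) (chart_at_inv a)"
    by (rule continuous_on_open_Un[OF _ _ 1 2]) (auto intro!: open_Compl finite_imp_closed)
  moreover have "- {Fin a} \<subseteq> - {Fin a, Infty} \<union> - {Fin a, Fin 0}" by auto
  ultimately show ?thesis by (rule continuous_on_subset)
qed

text \<open>At most one of three distinct points is \<open>Infty\<close>; it is given the role of
  \<open>c\<close>. The cross ratios below take \<open>a\<close> and \<open>b\<close> in the
  plane.\<close>

lemma hyperbolic_domainE:
  assumes "hyperbolic_domain \<Omega>"
  obtains a b c where "Fin a \<in> frontier \<Omega>" "Fin b \<in> frontier \<Omega>" "c \<in> frontier \<Omega>"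
    "a \<noteq> b" "c \<noteq> Fin a" "c \<noteq> Fin b"
proof -
  obtain A where A: "A \<subseteq> frontier \<Omega>" "card A = 3"
    using assms by (auto simp: hyperbolic_domain_def)
  then obtain x y z where xyz: "A = {x, y, z}" "x \<noteq> y" "x \<noteq> z" "y \<noteq> z"
    by (auto simp: card_3_iff)
  consider "x = Infty" | "y = Infty" | "z = Infty" | "x \<noteq> Infty" "y \<noteq> Infty" "z \<noteq> Infty" by blast
  thus ?thesis
  proof cases
    case 1
    then obtain u v where "y = Fin u" "z = Fin v" using xyz by (metis csphere.exhaust)
    thus ?thesis using that[of u v x] A xyz by auto
  next
    case 2
    then obtain u v where "x = Fin u" "z = Fin v" using xyz by (metis csphere.exhaust)
    thus ?thesis using that[of u v y] A xyz by auto
  next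
    case 3
    then obtain u v where "x = Fin u" "y = Fin v" using xyz by (metis csphere.exhaust)
    thus ?thesis using that[of u v z] A xyz by auto
  next
    case 4
    then obtain u v where "x = Fin u" "y = Fin v" using xyz by (metis csphere.exhaust)
    thus ?thesis using that[of u v z] A xyz by auto
  qed
qed

lemma frontier_disjoint_open: "open \<Omega> \<Longrightarrow> x \<in> frontier \<Omega> \<Longrightarrow> x \<notin> \<Omega>"
  by (simp add: frontier_def interior_open)

lemma exists_universal_covering:
  assumes hyp: "hyperbolic_domain \<Omega>" and w: "Fin w \<in> \<Omega>"
  obtains p where "analytic_universal_covering p \<Omega>" "p 0 = Fin w"
proof -
  have \<Omega>: "open \<Omega>" "connected \<Omega>" using hyp by (auto simp: hyperbolic_domain_def)
  obtain a b c where abc: "Fin a \<in> frontier \<Omega>" "Fin b \<in> frontier \<Omega>" "c \<in> frontier \<Omega>"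
    "a \<noteq> b" "c \<noteq> Fin a" "c \<noteq> Fin b"
    using hyperbolic_domainE[OF hyp] by blast
  have abc': "Fin a \<notin> \<Omega>" "Fin b \<notin> \<Omega>" "c \<notin> \<Omega>"
    using abc frontier_disjoint_open[OF \<Omega>(1)] by auto
  show ?thesis
  proof (cases "Infty \<in> \<Omega>")
    case False
    define U where "U = Fin -` \<Omega>"
    have FU: "Fin ` U = \<Omega>"
      using False by (auto simp: U_def image_iff) (metis csphere.exhaust)
    have Uf: "U = fin_chart ` \<Omega>"
      using FU by (metis (no_types, lifting) fin_chart.simps(1) image_cong image_ident image_image)
    have contf: "continuous_on \<Omega> fin_chart"
      using False by (intro continuous_on_subset[OF continuous_on_fin_chart]) auto
    have U: "open U" "connected U" "w \<in> U" "a \<notin> U" "b \<notin> U"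
      using open_vimage_Fin[OF \<Omega>(1)] connected_continuous_image[OF contf \<Omega>(2)] w abc'
      by (auto simp: U_def Uf[symmetric, unfolded U_def])
    obtain h where h: "h holomorphic_on ball 0 1" "h ` ball 0 1 = U" "h 0 = w"
      "disc_sections (ball 0 1) h U"
      using plane_uniformization[OF U abc(4)] by metis
    have hom: "homeomorphism U \<Omega> Fin fin_chart"
    proof -
      have "Fin (fin_chart x) = x" if "x \<in> \<Omega>" for x using that False by (cases x) auto
      thus ?thesis using FU Uf contf continuous_on_Fin by (auto simp: homeomorphism_def)
    qed
    have "covering_space (ball 0 1) (Fin \<circ> h) \<Omega>"
      by (rule covering_space_comp_homeomorphism[OF disc_sections_covering_space[OF h(4) _ h(1,2) U(1)] hom]) auto
    moreover have "sphere_holomorphic_on (Fin \<circ> h) (ball 0 1)"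
      by (rule sphere_holomorphic_on_Fin[OF h(1)])
    ultimately show ?thesis
      using h(3) by (intro that[of "Fin \<circ> h"]) (auto simp: analytic_universal_covering_def)
  next
    case True
    \<comment> \<open>As \<open>Infty\<close> belongs to the domain, all three boundary points are
      finite. Sending \<open>a\<close> to infinity leaves the images of \<open>b\<close> and
      \<open>c\<close> as the two omitted values.\<close>
    obtain c' where c': "c = Fin c'" using True abc'(3) by (cases c) auto
    define N where "N = chart_at_inv a"
    define U where "U = N ` \<Omega>"
    have MN: "chart_at a (N x) = x" if "x \<in> \<Omega>" for x
      unfolding N_def by (rule chart_at_inverses) (use that abc' in blast)
    have NM: "N (chart_at a u) = u" for u
      by (simp add: N_def chart_at_inverses)
    have contN: "continuous_on \<Omega> N"
      unfolding N_def using abc' by (intro continuous_on_subset[OF continuous_on_chart_at_inv]) auto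
    have Uv: "U = chart_at a -` \<Omega>"
      using MN NM by (auto simp: U_def image_iff) metis
    have MU: "chart_at a ` U = \<Omega>" using MN by (auto simp: U_def image_iff)
    have NU: "N x \<notin> U" if "x \<notin> \<Omega>" "x \<noteq> Fin a" for x
      using that by (simp add: Uv N_def chart_at_inverses)
    have U: "open U" "connected U"
      using connected_continuous_image[OF contN \<Omega>(2)] open_vimage[OF \<Omega>(1) continuous_on_chart_at]
      by (auto simp: U_def Uv[unfolded U_def])
    have U': "N (Fin w) \<in> U" "N (Fin b) \<notin> U" "N c \<notin> U" "N (Fin b) \<noteq> N c"
    proof -
      show "N (Fin w) \<in> U" unfolding U_def using w by (rule imageI)
      show "N (Fin b) \<notin> U" "N c \<notin> U" using NU abc' abc by auto
      show "N (Fin b) \<noteq> N c" using abc c' by (auto simp: N_def)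
    qed
    obtain h where h: "h holomorphic_on ball 0 1" "h ` ball 0 1 = U" "h 0 = N (Fin w)"
      "disc_sections (ball 0 1) h U"
      using plane_uniformization[OF U U'] by metis
    have hom: "homeomorphism U \<Omega> (chart_at a) N"
      using MU MN NM contN continuous_on_chart_at by (auto simp: homeomorphism_def U_def)
    have "covering_space (ball 0 1) (chart_at a \<circ> h) \<Omega>"
      by (rule covering_space_comp_homeomorphism[OF disc_sections_covering_space[OF h(4) _ h(1,2) U(1)] hom]) auto
    moreover have "sphere_holomorphic_on (chart_at a \<circ> h) (ball 0 1)"
    proof -
      have "continuous_on (ball 0 1) (chart_at a \<circ> h)"
        by (intro continuous_on_compose continuous_on_chart_at holomorphic_on_imp_continuous_on h)
      moreover have "fin_chart \<circ> (chart_at a \<circ> h) holomorphic_on {z \<in> ball 0 1. (chart_at a \<circ> h) z \<noteq> Infty}"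
      proof (rule holomorphic_transform)
        show "(\<lambda>z. a + inverse (h z)) holomorphic_on {z \<in> ball 0 1. (chart_at a \<circ> h) z \<noteq> Infty}"
          by (intro holomorphic_intros holomorphic_on_subset[OF h(1)]) (auto simp: chart_at_def)
      qed (auto simp: chart_at_def)
      moreover have "inf_chart \<circ> (chart_at a \<circ> h) holomorphic_on {z \<in> ball 0 1. (chart_at a \<circ> h) z \<noteq> Fin 0}"
      proof (rule holomorphic_transform)
        \<comment> \<open>The reciprocal of a + 1/h in a form that remains holomorphic at the zeros
          of \<open>h\<close>, where the covering takes the value \<open>Infty\<close>.\<close>
        show "(\<lambda>z. h z / (1 + a * h z)) holomorphic_on {z \<in> ball 0 1. (chart_at a \<circ> h) z \<noteq> Fin 0}"
          by (intro holomorphic_intros holomorphic_on_subset[OF h(1)])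
             (auto simp: chart_at_def field_simps split: if_splits)
      qed (auto simp: chart_at_def field_simps split: if_splits)
      ultimately show ?thesis by (simp add: sphere_holomorphic_on_def)
    qed
    ultimately show ?thesis
      using h(3) MN[OF w] by (intro that[of "chart_at a \<circ> h"]) (auto simp: analytic_universal_covering_def)
  qed
qed

section \<open>Lifting and the hyperbolic density\<close>

text \<open>Replaces the sphere by a subset of the normed space
  \<open>complex \<times> real\<close>, in which the lifting theorem for coverings is
  applied.\<close>

lemma stereo_homeomorphism: "homeomorphism S (stereo ` S) stereo (inv stereo)"
proof -
  have inj: "inj stereo"
    by (intro injI) (metis dist_csphere_def dist_eq_0_iff dist_stereo)
  have iso: "dist (stereo x) (stereo y) = dist x y" for x y
    by (simp add: dist_stereo dist_csphere_def)
  have "continuous_on S stereo"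
    unfolding continuous_on_iff iso by blast
  moreover have "continuous_on (stereo ` S) (inv stereo)"
    unfolding continuous_on_iff using inj by (auto simp: iso)
  ultimately show ?thesis
    using inj by (auto simp: homeomorphism_def image_image)
qed

lemma inj_on_charts: "inj_on fin_chart (- {Infty})" "inj_on inf_chart (- {Fin 0})"
proof -
  show "inj_on fin_chart (- {Infty})"
    by (intro inj_onI) (metis ComplD csphere.exhaust fin_chart.simps(1) singletonI)
  show "inj_on inf_chart (- {Fin 0})"
  proof (intro inj_onI)
    fix x y assume "x \<in> - {Fin 0}" "y \<in> - {Fin 0}" "inf_chart x = inf_chart y"
    thus "x = y" by (cases x; cases y) auto
  qed
qed

lemma inj_on_comp_restrict:
  assumes "inj_on c (- {y})" "inj_on p V"
  shows "inj_on (c \<circ> p) (V \<inter> {x\<in>S. p x \<noteq> y})"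
  by (rule comp_inj_on[OF inj_on_subset[OF assms(2)] inj_on_subset[OF assms(1)]]) blast+

lemma sphere_holomorphic_onD:
  assumes "sphere_holomorphic_on f S"
  shows "continuous_on S f" "fin_chart \<circ> f holomorphic_on {z\<in>S. f z \<noteq> Infty}"
    "inf_chart \<circ> f holomorphic_on {z\<in>S. f z \<noteq> Fin 0}"
  using assms by (auto simp: sphere_holomorphic_on_def)

lemma open_preimage_neq:
  fixes f :: "'a::topological_space \<Rightarrow> 'b::t1_space"
  assumes "continuous_on S f" "open S"
  shows "open {z\<in>S. f z \<noteq> y}"
proof -
  have "{z\<in>S. f z \<noteq> y} = S \<inter> f -` (- {y})" by auto
  thus ?thesis using continuous_open_preimage[OF assms, of "- {y}"] by auto
qed

lemma analytic_universal_coveringD: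
  assumes "analytic_universal_covering p \<Omega>"
  shows "sphere_holomorphic_on p (ball 0 1)" "covering_space (ball 0 1) p \<Omega>"
    "p ` ball 0 1 = \<Omega>"
  using assms covering_space_imp_surjective by (auto simp: analytic_universal_covering_def)

lemma analytic_universal_covering_locally_inj:
  assumes "analytic_universal_covering p \<Omega>" "z \<in> ball 0 1"
  obtains V where "open V" "z \<in> V" "V \<subseteq> ball 0 1" "inj_on p V"
proof -
  obtain T u q where T: "z \<in> T" "openin (top_of_set (ball 0 1)) T" "homeomorphism T u p q"
    using covering_space_local_homeomorphism[OF analytic_universal_coveringD(2)[OF assms(1)] assms(2)] by metis
  have "open T" "T \<subseteq> ball 0 1" using T(2) openin_open_eq[of "ball 0 1" T] by auto
  moreover have "inj_on p T" using T(3) by (auto simp: homeomorphism_def intro: inj_on_inverseI)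
  ultimately show ?thesis using that T(1) by blast
qed

text \<open>Composing with the holomorphic inverse of \<open>\<phi>\<close> recovers
  \<open>f\<close>. This turns holomorphy of a projected map into holomorphy of its lift.\<close>

lemma holomorphic_on_cancel_injective:
  assumes \<phi>: "\<phi> holomorphic_on V" "open V" "inj_on \<phi> V"
    and f: "f ` W \<subseteq> V" "(\<lambda>x. \<phi> (f x)) holomorphic_on W"
  shows "f holomorphic_on W"
proof -
  obtain g where g: "g holomorphic_on \<phi> ` V" "\<And>z. z \<in> V \<Longrightarrow> g (\<phi> z) = z"
    using holomorphic_has_inverse[OF \<phi>] by metis
  have "g \<circ> (\<lambda>x. \<phi> (f x)) holomorphic_on W"
    using f by (intro holomorphic_on_compose_gen[OF f(2) g(1)]) auto
  thus ?thesis
    by (rule holomorphic_transform) (use g(2) f(1) in auto)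
qed

text \<open>The continuous lift exists because the disk is simply connected. It is holomorphic
  because locally \<open>p\<close> is injective and can be cancelled in a chart.\<close>

lemma universal_covering_lift:
  assumes p: "analytic_universal_covering p \<Omega>"
    and g: "sphere_holomorphic_on g (ball 0 1)" "g ` ball 0 1 \<subseteq> \<Omega>"
    and z: "z \<in> ball 0 1" "\<zeta> \<in> ball 0 1" "g \<zeta> = p z"
  obtains f where "f holomorphic_on ball 0 1" "f ` ball 0 1 \<subseteq> ball 0 1" "f \<zeta> = z"
    "\<And>x. x \<in> ball 0 1 \<Longrightarrow> p (f x) = g x"
proof -
  note P = analytic_universal_coveringD[OF p]
  note pD = sphere_holomorphic_onD[OF P(1)] and gD = sphere_holomorphic_onD[OF g(1)]
  have cov: "covering_space (ball 0 1) (stereo \<circ> p) (stereo ` \<Omega>)"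
    by (rule covering_space_comp_homeomorphism[OF P(2) stereo_homeomorphism])
  have sinj: "stereo x = stereo y \<longleftrightarrow> x = y" for x y
    by (metis dist_csphere_def dist_eq_0_iff dist_stereo)
  have "continuous_on (ball 0 1) (stereo \<circ> g)"
    using stereo_homeomorphism[of UNIV] gD(1)
    by (intro continuous_on_compose) (auto simp: homeomorphism_def intro: continuous_on_subset)
  moreover have "stereo \<circ> g \<in> ball 0 1 \<rightarrow> stereo ` \<Omega>" using g(2) by auto
  moreover have "(stereo \<circ> g) \<zeta> = (stereo \<circ> p) z" using z by simp
  moreover have "simply_connected (ball (0::complex) 1)"
    by (intro convex_imp_simply_connected) auto
  moreover have "locally path_connected (ball (0::complex) 1)"
    by (intro open_imp_locally_path_connected) auto
  ultimately obtain f where f: "continuous_on (ball 0 1) f" "f \<in> ball 0 1 \<rightarrow> ball 0 1" "f \<zeta> = z"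
      "\<And>y. y \<in> ball 0 1 \<Longrightarrow> (stereo \<circ> p) (f y) = (stereo \<circ> g) y"
    using covering_space_lift_strong[OF cov z(1,2)] by blast
  have pf: "p (f x) = g x" if "x \<in> ball 0 1" for x
    using f(4)[OF that] sinj by simp
  have "f field_differentiable at x" if x: "x \<in> ball 0 1" for x
  proof -
    have fx: "f x \<in> ball 0 1" using f(2) x by blast
    obtain V0 where V0: "open V0" "f x \<in> V0" "V0 \<subseteq> ball 0 1" "inj_on p V0"
      using analytic_universal_covering_locally_inj[OF p fx] .
    \<comment> \<open>Stated for an abstract chart \<open>c\<close> whose excluded point is
      \<open>y\<close>, to be used with \<open>fin_chart\<close> and \<open>Infty\<close> as well as
      with \<open>inf_chart\<close> and \<open>Fin 0\<close>.\<close>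
    have main: "f field_differentiable at x"
      if x': "p (f x) \<noteq> y" and ch: "inj_on c (- {y})"
        and cp: "(c \<circ> p) holomorphic_on {z\<in>ball 0 1. p z \<noteq> y}"
        and cg: "(c \<circ> g) holomorphic_on {z\<in>ball 0 1. g z \<noteq> y}"
      for c :: "csphere \<Rightarrow> complex" and y
    proof -
      define V where "V = V0 \<inter> {z\<in>ball 0 1. p z \<noteq> y}"
      define W where "W = ball 0 1 \<inter> f -` V"
      have oV: "open V" unfolding V_def using V0(1) open_preimage_neq[OF pD(1) open_ball] by blast
      have oW: "open W" unfolding W_def by (rule continuous_open_preimage[OF f(1) open_ball oV])
      have xW: "x \<in> W" using x fx V0(2) x' by (simp add: W_def V_def)
      have "f holomorphic_on W"
      proof (rule holomorphic_on_cancel_injective[of "c \<circ> p" V])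
        show "c \<circ> p holomorphic_on V" using cp by (rule holomorphic_on_subset) (auto simp: V_def)
        show "inj_on (c \<circ> p) V"
          unfolding V_def by (rule inj_on_comp_restrict[OF ch V0(4)])
        have "c \<circ> g holomorphic_on W"
          using cg by (rule holomorphic_on_subset) (use pf in \<open>auto simp: V_def W_def\<close>)
        thus "(\<lambda>x. (c \<circ> p) (f x)) holomorphic_on W"
          by (rule holomorphic_transform) (use pf in \<open>auto simp: W_def\<close>)
      qed (auto simp: W_def oV)
      thus ?thesis using oW xW by (rule holomorphic_on_imp_differentiable_at)
    qed
    show ?thesis
    proof (cases "p (f x) = Infty")
      case True
      thus ?thesis using main[OF _ inj_on_charts(2) pD(3) gD(3)] by simp
    next
      case False
      thus ?thesis using main[OF _ inj_on_charts(1) pD(2) gD(2)] by simp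
    qed
  qed
  hence "f holomorphic_on ball 0 1"
    by (auto simp: holomorphic_on_def field_differentiable_at_within)
  thus ?thesis using that f(2,3) pf by blast
qed

text \<open>Schwarz's lemma for \<open>f\<close> conjugated by disk automorphisms so that both
  \<open>z\<close> and \<open>f z\<close> move to 0.\<close>

lemma Schwarz_Pick:
  assumes f: "f holomorphic_on ball 0 1" "f ` ball 0 1 \<subseteq> ball 0 1" and z: "z \<in> ball 0 1"
  shows "(1 - (cmod z)\<^sup>2) * cmod (deriv f z) \<le> 1 - (cmod (f z))\<^sup>2"
proof -
  define M where "M = (\<lambda>w. Moebius_function 0 w)"
  have fz: "cmod (f z) < 1" "cmod (-z) < 1" "cmod z < 1" using subsetD[OF f(2) imageI[OF z]] z by auto
  have Mball: "M u x \<in> ball 0 1" if "cmod u < 1" "x \<in> ball 0 1" for u x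
    using Moebius_function_norm_lt_1 that by (auto simp: M_def)
  have Mhol: "M u holomorphic_on ball 0 1" if "cmod u < 1" for u
    using Moebius_function_holomorphic that by (auto simp: M_def)
  define F where "F = M (f z) \<circ> (f \<circ> M (-z))"
  have M0: "M (-z) 0 = z" "M (f z) (f z) = 0"
    by (simp_all add: M_def Moebius_function_simple)
  have "F holomorphic_on ball 0 1"
    unfolding F_def using Mball fz f
    by (intro holomorphic_on_compose_gen[of _ _ _ "ball 0 1"] Mhol f) (auto simp del: mem_ball)
  moreover have "F 0 = 0" by (simp add: F_def M0)
  moreover have "cmod (F x) < 1" if "cmod x < 1" for x
  proof -
    have "M (-z) x \<in> ball 0 1" using Mball fz that by simp
    hence "f (M (-z) x) \<in> ball 0 1" using f by blast
    thus ?thesis using Mball[of "f z"] fz by (simp add: F_def)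
  qed
  ultimately have le: "cmod (deriv F 0) \<le> 1"
    using Schwarz_Lemma(2)[of F 0] by auto
  have "(M (-z) has_field_derivative (1 - z * cnj z)) (at 0)"
    using Moebius_deriv_0[OF fz(3)] by (simp add: M_def)
  moreover have "(f has_field_derivative deriv f z) (at (M (-z) 0))"
    using f z by (auto simp: M0 intro!: holomorphic_derivI[of _ "ball 0 1"])
  ultimately have "(f \<circ> M (-z) has_field_derivative deriv f z * (1 - z * cnj z)) (at 0)"
    by (rule DERIV_chain[rotated])
  moreover have "(M (f z) has_field_derivative inverse (1 - f z * cnj (f z))) (at ((f \<circ> M (-z)) 0))"
    using Moebius_deriv_self[OF fz(1)] by (simp add: M_def M0[unfolded M_def])
  ultimately have "(F has_field_derivative inverse (1 - f z * cnj (f z)) * (deriv f z * (1 - z * cnj z))) (at 0)"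
    unfolding F_def by (rule DERIV_chain[rotated])
  hence "deriv F 0 = inverse (1 - f z * cnj (f z)) * (deriv f z * (1 - z * cnj z))"
    by (rule DERIV_imp_deriv)
  moreover have *: "cmod (1 - u * cnj u) = 1 - (cmod u)\<^sup>2 \<and> 0 < 1 - (cmod u)\<^sup>2" if "cmod u < 1" for u
  proof -
    have "1 - u * cnj u = of_real (1 - (cmod u)\<^sup>2)"
      by (simp only: of_real_diff of_real_1 complex_norm_square)
    moreover have "(cmod u)\<^sup>2 < 1" using that by (simp add: power_less_one_iff)
    ultimately show ?thesis by (metis abs_of_pos diff_gt_0_iff_gt norm_of_real)
  qed
  ultimately have "inverse (1 - (cmod (f z))\<^sup>2) * (cmod (deriv f z) * (1 - (cmod z)\<^sup>2)) \<le> 1"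
    using le *[OF fz(1)] *[OF fz(3)] by (simp add: norm_mult norm_inverse)
  thus ?thesis using *[OF fz(1)] by (simp add: field_simps)
qed

text \<open>Lift \<open>g\<close> through \<open>p\<close> and apply Schwarz-Pick to the lift. With
  \<open>g\<close> a second covering this yields uniqueness of the density; with \<open>g\<close> a
  map into the plane it yields upper bounds for it.\<close>

lemma covering_Schwarz_Pick:
  assumes p: "analytic_universal_covering p \<Omega>"
    and g: "sphere_holomorphic_on g (ball 0 1)" "g ` ball 0 1 \<subseteq> \<Omega>"
    and z: "z \<in> ball 0 1" "\<zeta> \<in> ball 0 1" "p z = Fin w" "g \<zeta> = Fin w"
  shows "(1 - (cmod \<zeta>)\<^sup>2) * cmod (deriv (fin_chart \<circ> g) \<zeta>) \<le> (1 - (cmod z)\<^sup>2) * cmod (deriv (fin_chart \<circ> p) z)"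
proof -
  note pD = sphere_holomorphic_onD[OF analytic_universal_coveringD(1)[OF p]]
  obtain f where f: "f holomorphic_on ball 0 1" "f ` ball 0 1 \<subseteq> ball 0 1" "f \<zeta> = z"
    "\<And>x. x \<in> ball 0 1 \<Longrightarrow> p (f x) = g x"
    using universal_covering_lift[OF p g z(1,2)] z(3,4) by metis
  have "(fin_chart \<circ> p has_field_derivative deriv (fin_chart \<circ> p) z) (at (f \<zeta>))"
    using z f(3) by (auto intro!: holomorphic_derivI[OF pD(2)] open_preimage_neq pD(1))
  moreover have "(f has_field_derivative deriv f \<zeta>) (at \<zeta>)"
    using f z by (auto intro!: holomorphic_derivI[OF f(1)])
  ultimately have "((fin_chart \<circ> p) \<circ> f has_field_derivative deriv (fin_chart \<circ> p) z * deriv f \<zeta>) (at \<zeta>)"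
    by (rule DERIV_chain)
  hence "(fin_chart \<circ> g has_field_derivative deriv (fin_chart \<circ> p) z * deriv f \<zeta>) (at \<zeta>)"
    by (rule has_field_derivative_transform_within_open[OF _ open_ball z(2)]) (use f(4) in auto)
  hence "deriv (fin_chart \<circ> g) \<zeta> = deriv (fin_chart \<circ> p) z * deriv f \<zeta>"
    by (rule DERIV_imp_deriv)
  moreover have "(1 - (cmod \<zeta>)\<^sup>2) * cmod (deriv f \<zeta>) \<le> 1 - (cmod z)\<^sup>2"
    using Schwarz_Pick[OF f(1,2) z(2)] f(3) by simp
  hence "cmod (deriv (fin_chart \<circ> p) z) * ((1 - (cmod \<zeta>)\<^sup>2) * cmod (deriv f \<zeta>))
      \<le> cmod (deriv (fin_chart \<circ> p) z) * (1 - (cmod z)\<^sup>2)"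
    by (rule mult_left_mono) simp
  ultimately show ?thesis by (simp add: norm_mult mult_ac)
qed

lemma universal_covering_deriv_nz:
  assumes p: "analytic_universal_covering p \<Omega>" and z: "z \<in> ball 0 1" "p z \<noteq> Infty"
  shows "deriv (fin_chart \<circ> p) z \<noteq> 0"
proof -
  note pD = sphere_holomorphic_onD[OF analytic_universal_coveringD(1)[OF p]]
  obtain V where V: "open V" "z \<in> V" "V \<subseteq> ball 0 1" "inj_on p V"
    using analytic_universal_covering_locally_inj[OF p z(1)] .
  define W where "W = V \<inter> {x\<in>ball 0 1. p x \<noteq> Infty}"
  have "open W" unfolding W_def using V(1) open_preimage_neq[OF pD(1) open_ball] by blast
  moreover have "fin_chart \<circ> p holomorphic_on W"
    using pD(2) by (rule holomorphic_on_subset) (auto simp: W_def)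
  moreover have "inj_on (fin_chart \<circ> p) W"
    unfolding W_def by (rule inj_on_comp_restrict[OF inj_on_charts(1) V(4)])
  ultimately show ?thesis
    using z V(2) by (intro holomorphic_injective_imp_regular[of _ W]) (auto simp: W_def)
qed

section \<open>Evaluating the hyperbolic density\<close>

lemma one_minus_norm_sq_pos: "z \<in> ball 0 1 \<Longrightarrow> 0 < 1 - (cmod z)\<^sup>2"
  by (simp add: power_less_one_iff)

text \<open>The \<open>THE\<close> is resolved by lifting two coverings through each other: the two
  Schwarz-Pick inequalities make (1 - |z|^2)|p'(z)| independent of the covering and of the point of
  the fibre.\<close>

lemma hyp_density_eq:
  assumes p: "analytic_universal_covering p \<Omega>" and z: "z \<in> ball 0 1" "p z = Fin w"
  shows "hyp_density \<Omega> (Fin w) = 1 / ((1 - (cmod z)\<^sup>2) * cmod (deriv (fin_chart \<circ> p) z))"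
  unfolding hyp_density_def
proof (rule the_equality)
  have nz: "deriv (fin_chart \<circ> p) z \<noteq> 0"
    using universal_covering_deriv_nz[OF p z(1)] z(2) by simp
  hence "1 / (1 - (cmod z)\<^sup>2) = 1 / ((1 - (cmod z)\<^sup>2) * cmod (deriv (fin_chart \<circ> p) z)) * cmod (sphere_deriv p z)"
    using z by (simp add: sphere_deriv_def)
  thus "\<exists>q x. analytic_universal_covering q \<Omega> \<and> x \<in> ball 0 1 \<and> q x = Fin w \<and>
          1 / (1 - (cmod x)\<^sup>2) = 1 / ((1 - (cmod z)\<^sup>2) * cmod (deriv (fin_chart \<circ> p) z)) * cmod (sphere_deriv q x)"
    using p z by blast
  fix l
  assume "\<exists>q x. analytic_universal_covering q \<Omega> \<and> x \<in> ball 0 1 \<and> q x = Fin w \<and>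
          1 / (1 - (cmod x)\<^sup>2) = l * cmod (sphere_deriv q x)"
  then obtain q x where q: "analytic_universal_covering q \<Omega>" "x \<in> ball 0 1" "q x = Fin w"
      "1 / (1 - (cmod x)\<^sup>2) = l * cmod (deriv (fin_chart \<circ> q) x)"
    by (auto simp: sphere_deriv_def)
  note P = analytic_universal_coveringD[OF p] and Q = analytic_universal_coveringD[OF q(1)]
  have "(1 - (cmod x)\<^sup>2) * cmod (deriv (fin_chart \<circ> q) x) = (1 - (cmod z)\<^sup>2) * cmod (deriv (fin_chart \<circ> p) z)"
    by (intro antisym covering_Schwarz_Pick[OF p Q(1) _ z(1) q(2) z(2) q(3)]
        covering_Schwarz_Pick[OF q(1) P(1) _ q(2) z(1) q(3) z(2)]) (simp_all only: P(3) Q(3) order_refl)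
  moreover have "l = 1 / ((1 - (cmod x)\<^sup>2) * cmod (deriv (fin_chart \<circ> q) x))"
    using q(4) one_minus_norm_sq_pos[OF q(2)] universal_covering_deriv_nz[OF q(1,2)] q(3)
    by (simp add: field_simps)
  ultimately show "l = 1 / ((1 - (cmod z)\<^sup>2) * cmod (deriv (fin_chart \<circ> p) z))" by simp
qed

lemma hyp_density_at_base:
  assumes "hyperbolic_domain \<Omega>" "Fin w \<in> \<Omega>"
  obtains p where "analytic_universal_covering p \<Omega>" "p 0 = Fin w" "deriv (fin_chart \<circ> p) 0 \<noteq> 0"
    "hyp_density \<Omega> (Fin w) = 1 / cmod (deriv (fin_chart \<circ> p) 0)"
proof -
  obtain p where p: "analytic_universal_covering p \<Omega>" "p 0 = Fin w"
    using exists_universal_covering[OF assms] .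
  show ?thesis
    using that[OF p] hyp_density_eq[OF p(1) _ p(2)] universal_covering_deriv_nz[OF p(1), of 0] p(2) by simp
qed

lemma sph_hyp_density_pos:
  assumes "hyperbolic_domain \<Omega>" "Fin w \<in> \<Omega>"
  shows "0 < sph_hyp_density \<Omega> (Fin w)"
  using hyp_density_at_base[OF assms] one_plus_norm_sq_pos[of w]
  by (metis divide_pos_pos mult_pos_pos sph_hyp_density.simps(1) zero_less_norm_iff zero_less_one)

lemma hyp_density_upper:
  assumes \<Omega>: "hyperbolic_domain \<Omega>"
    and g: "g holomorphic_on ball 0 1" "Fin ` g ` ball 0 1 \<subseteq> \<Omega>"
  shows "cmod (deriv g 0) * hyp_density \<Omega> (Fin (g 0)) \<le> 1"
proof -
  have "Fin (g 0) \<in> \<Omega>" using g(2) by auto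
  then obtain p where p: "analytic_universal_covering p \<Omega>" "p 0 = Fin (g 0)" "deriv (fin_chart \<circ> p) 0 \<noteq> 0"
    "hyp_density \<Omega> (Fin (g 0)) = 1 / cmod (deriv (fin_chart \<circ> p) 0)"
    using hyp_density_at_base[OF \<Omega>] by metis
  have "sphere_holomorphic_on (Fin \<circ> g) (ball 0 1)"
    by (rule sphere_holomorphic_on_Fin[OF g(1)])
  hence "(1 - (cmod 0)\<^sup>2) * cmod (deriv (fin_chart \<circ> (Fin \<circ> g)) 0) \<le> (1 - (cmod 0)\<^sup>2) * cmod (deriv (fin_chart \<circ> p) 0)"
    using g(2) p(2) by (intro covering_Schwarz_Pick[OF p(1)]) auto
  thus ?thesis using p(3,4) by (simp add: o_def)
qed

lemma Fin_tendsto_Infty: "(Fin \<longlongrightarrow> Infty) at_infinity"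
proof -
  have "((\<lambda>z. chart_at 0 (inverse z)) \<longlongrightarrow> chart_at 0 0) at_infinity"
    using continuous_on_tendsto_compose[OF continuous_on_chart_at[of UNIV 0] tendsto_inverse_0] by simp
  moreover have "eventually (\<lambda>z::complex. z \<noteq> 0) at_infinity"
    by (auto simp: eventually_at_infinity intro!: exI[of _ 1])
  hence "eventually (\<lambda>z. chart_at 0 (inverse z) = Fin z) at_infinity"
    by eventually_elim (simp add: chart_at_def)
  ultimately show ?thesis
    by (simp add: chart_at_def tendsto_cong)
qed

lemma eventually_Fin_in:
  assumes "open \<Omega>" "Infty \<in> \<Omega>"
  shows "eventually (\<lambda>z. Fin z \<in> \<Omega>) at_infinity"
  using topological_tendstoD[OF Fin_tendsto_Infty assms] .

text \<open>Shows that the \<open>Lim\<close> defining the value at \<open>Infty\<close> is a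
  genuine limit. Near a preimage of \<open>Infty\<close> the function 1/p is injective with inverse
  \<open>s\<close>, and the density is read off in the coordinate v = 1/w.\<close>

lemma sph_hyp_density_tendsto_Infty:
  assumes \<Omega>: "hyperbolic_domain \<Omega>" "Infty \<in> \<Omega>"
  shows "((\<lambda>z. sph_hyp_density \<Omega> (Fin z)) \<longlongrightarrow> sph_hyp_density \<Omega> Infty) at_infinity"
proof -
  have "open \<Omega>" using \<Omega>(1) by (simp add: hyperbolic_domain_def)
  have "\<exists>w. Fin w \<in> \<Omega>"
    using eventually_happens[OF eventually_Fin_in[OF \<open>open \<Omega>\<close> \<Omega>(2)]] trivial_limit_at_infinity by blast
  then obtain p where p: "analytic_universal_covering p \<Omega>"
    using exists_universal_covering[OF \<Omega>(1)] by metis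
  note pD = sphere_holomorphic_onD[OF analytic_universal_coveringD(1)[OF p]]
  obtain \<zeta> where \<zeta>: "\<zeta> \<in> ball 0 1" "p \<zeta> = Infty"
    using analytic_universal_coveringD(3)[OF p] \<Omega>(2) by (metis imageE)
  obtain V0 where V0: "open V0" "\<zeta> \<in> V0" "V0 \<subseteq> ball 0 1" "inj_on p V0"
    using analytic_universal_covering_locally_inj[OF p \<zeta>(1)] .
  define V where "V = V0 \<inter> {x\<in>ball 0 1. p x \<noteq> Fin 0}"
  define \<phi> where "\<phi> = inf_chart \<circ> p"
  have V: "open V" "\<zeta> \<in> V" "V \<subseteq> ball 0 1"
    using V0 \<zeta> open_preimage_neq[OF pD(1) open_ball] by (auto simp: V_def)
  have hol: "\<phi> holomorphic_on V"
    unfolding \<phi>_def using pD(3) by (rule holomorphic_on_subset) (auto simp: V_def)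
  have inj: "inj_on \<phi> V"
    unfolding \<phi>_def V_def by (rule inj_on_comp_restrict[OF inj_on_charts(2) V0(4)])
  obtain s where s: "s holomorphic_on \<phi> ` V" "\<And>x. x \<in> V \<Longrightarrow> s (\<phi> x) = x"
    using holomorphic_has_inverse[OF hol V(1) inj] by metis
  have oI: "open (\<phi> ` V)" by (rule open_mapping_thm3[OF hol V(1) inj])
  have \<phi>0: "\<phi> \<zeta> = 0" using \<zeta> by (simp add: \<phi>_def)
  have I0: "0 \<in> \<phi> ` V" using \<phi>0 V(2) by (metis imageI)
  have s0: "s 0 = \<zeta>" using s(2)[OF V(2)] \<phi>0 by simp
  \<comment> \<open>The density at w = 1/v. The factor 1 + 1/|v|^2 and the derivative of
    1/\<open>\<phi>\<close>, of modulus |\<open>\<phi>\<close>'|/|v|^2, combine so that the powers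
    of v cancel and \<open>L\<close> is continuous at 0.\<close>
  define L where "L = (\<lambda>v. (1 + (cmod v)\<^sup>2) / ((1 - (cmod (s v))\<^sup>2) * cmod (deriv \<phi> (s v))))"
  have eq: "sph_hyp_density \<Omega> (Fin (inverse v)) = L v" if v: "v \<in> \<phi> ` V" "v \<noteq> 0" for v
  proof -
    obtain x where x: "x \<in> V" "v = \<phi> x" using v by auto
    have sv: "s v = x" using x s by simp
    have px: "p x = Fin (inverse v)"
      using x v(2) by (cases "p x") (auto simp: \<phi>_def)
    define W where "W = V \<inter> {y\<in>ball 0 1. p y \<noteq> Infty}"
    have W: "open W" "x \<in> W"
      using V(1,3) x px open_preimage_neq[OF pD(1) open_ball] by (auto simp: W_def)
    have "(\<phi> has_field_derivative deriv \<phi> x) (at x)"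
      using hol V(1) x(1) by (rule holomorphic_derivI)
    hence "((\<lambda>y. inverse (\<phi> y)) has_field_derivative - (inverse (\<phi> x) * deriv \<phi> x * inverse (\<phi> x))) (at x)"
      using v(2) x(2) by (intro DERIV_inverse') auto
    hence "(fin_chart \<circ> p has_field_derivative - (inverse (\<phi> x) * deriv \<phi> x * inverse (\<phi> x))) (at x)"
    proof (rule has_field_derivative_transform_within_open[OF _ W])
      fix y assume "y \<in> W"
      thus "inverse (\<phi> y) = (fin_chart \<circ> p) y" by (cases "p y") (auto simp: W_def V_def \<phi>_def)
    qed
    hence d: "cmod (deriv (fin_chart \<circ> p) x) = cmod (deriv \<phi> x) / (cmod v)\<^sup>2"
      using x(2) by (simp add: DERIV_imp_deriv norm_mult norm_inverse norm_divide power2_eq_square field_simps)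
    have "hyp_density \<Omega> (Fin (inverse v)) = 1 / ((1 - (cmod x)\<^sup>2) * cmod (deriv (fin_chart \<circ> p) x))"
      using hyp_density_eq[OF p _ px] x V(3) by auto
    hence "sph_hyp_density \<Omega> (Fin (inverse v)) =
        (1 + (inverse (cmod v))\<^sup>2) * (cmod v)\<^sup>2 / ((1 - (cmod x)\<^sup>2) * cmod (deriv \<phi> x))"
      by (simp add: d norm_inverse)
    also have "(1 + (inverse (cmod v))\<^sup>2) * (cmod v)\<^sup>2 = 1 + (cmod v)\<^sup>2"
      using v(2) by (simp add: field_simps)
    finally show ?thesis by (simp add: L_def sv)
  qed
  have nz: "(1 - (cmod (s 0))\<^sup>2) * cmod (deriv \<phi> (s 0)) \<noteq> 0"
    using one_minus_norm_sq_pos[OF \<zeta>(1)] holomorphic_injective_imp_regular[OF hol V(1) inj V(2)] s0 by simp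
  have cs: "isCont s 0"
    by (rule continuous_on_interior[OF holomorphic_on_imp_continuous_on[OF s(1)]]) (use oI I0 in \<open>simp add: interior_open\<close>)
  have cd: "isCont (deriv \<phi>) (s 0)"
    using holomorphic_on_imp_continuous_on[OF holomorphic_deriv[OF hol V(1)]] V s0
    by (simp add: continuous_on_eq_continuous_at)
  have "isCont (\<lambda>v. deriv \<phi> (s v)) 0"
    by (rule isCont_o2[OF cs cd])
  hence "isCont L 0"
    unfolding L_def using nz cs by (intro continuous_intros) auto
  hence L: "(L \<longlongrightarrow> L 0) (at 0)" by (simp add: isCont_def)
  have ev: "eventually (\<lambda>v. L v = sph_hyp_density \<Omega> (Fin (inverse v))) (at 0)"
    using eventually_at_in_open[OF oI I0] by eventually_elim (use eq in auto)
  have lim: "((\<lambda>z. sph_hyp_density \<Omega> (Fin z)) \<longlongrightarrow> L 0) at_infinity"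
    using Lim_transform_eventually[OF L ev] by (simp add: at_to_infinity filterlim_filtermap)
  have "sph_hyp_density \<Omega> Infty = Lim at_infinity (\<lambda>z. sph_hyp_density \<Omega> (Fin z))" by simp
  also have "\<dots> = L 0" using lim by (intro tendsto_Lim trivial_limit_at_infinity)
  finally show ?thesis using lim by simp
qed

section \<open>Lower bounds for the hyperbolic density\<close>

text \<open>A Landau bound for |g'(0)|. The 4 comes from Cauchy's estimate on the circle of radius
  1/4, where g is bounded by applying Schottky with t = 1/2 to g(z/2), a function holomorphic on the
  closed disk.\<close>

definition landau_bound :: "real \<Rightarrow> real" where
  "landau_bound R = 4 * schottky_bound R (1/2)"

lemma landau_bound_pos: "0 < landau_bound R"
  by (simp add: landau_bound_def schottky_bound_def)

lemma deriv_le_omit_01: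
  assumes g: "g holomorphic_on ball 0 1" "\<And>z. z \<in> ball 0 1 \<Longrightarrow> g z \<noteq> 0 \<and> g z \<noteq> 1"
    and R: "cmod (g 0) \<le> R"
  shows "cmod (deriv g 0) \<le> landau_bound R"
proof -
  have le: "cmod (g y) \<le> schottky_bound R (1/2)" if "cmod y \<le> 1/4" for y
  proof -
    have "(\<lambda>z. g (z / 2)) holomorphic_on cball 0 1"
      by (intro holomorphic_on_compose_gen[OF _ g(1), unfolded o_def] holomorphic_intros) (auto simp: norm_divide)
    moreover have "\<not> (g (z / 2) = 0 \<or> g (z / 2) = 1)" if "z \<in> cball 0 1" for z
      using g(2)[of "z / 2"] that by (simp add: norm_divide)
    ultimately have "cmod (g ((2 * y) / 2)) \<le> schottky_bound R (1/2)"
      unfolding schottky_bound_def using R that by (intro Schottky) (auto simp: norm_mult)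
    thus ?thesis by simp
  qed
  have "cmod ((deriv ^^ 1) g 0) \<le> fact 1 * schottky_bound R (1/2) / (1/4) ^ 1"
  proof (rule Cauchy_inequality)
    show "g holomorphic_on ball 0 (1/4)" "continuous_on (cball 0 (1/4)) g"
      using g(1) by (auto intro!: holomorphic_on_imp_continuous_on elim!: holomorphic_on_subset)
    show "cmod (g x) \<le> schottky_bound R (1/2)" if "cmod (0 - x) = 1/4" for x
      using le[of x] that by simp
  qed auto
  thus ?thesis by (simp add: landau_bound_def)
qed

text \<open>1/g omits 0 and 1 as well and has modulus at most 1 at 0. For large |g(0)| the bound
  then grows only quadratically, as suits a spherical derivative.\<close>

lemma deriv_le_omit_01_inverse:
  assumes g: "g holomorphic_on ball 0 1" "\<And>z. z \<in> ball 0 1 \<Longrightarrow> g z \<noteq> 0 \<and> g z \<noteq> 1"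
    and R: "1 \<le> cmod (g 0)"
  shows "cmod (deriv g 0) \<le> (cmod (g 0))\<^sup>2 * landau_bound 1"
proof -
  have "(g has_field_derivative deriv g 0) (at 0)"
    by (intro holomorphic_derivI[OF g(1)]) auto
  hence "((\<lambda>z. inverse (g z)) has_field_derivative - (inverse (g 0) * deriv g 0 * inverse (g 0))) (at 0)"
    using g(2)[of 0] by (intro DERIV_inverse') auto
  hence d: "deriv (\<lambda>z. inverse (g z)) 0 = - (inverse (g 0) * deriv g 0 * inverse (g 0))"
    by (rule DERIV_imp_deriv)
  have "cmod (deriv (\<lambda>z. inverse (g z)) 0) \<le> landau_bound 1"
    using g R by (intro deriv_le_omit_01 holomorphic_intros) (auto simp: norm_inverse inverse_le_1_iff)
  hence "inverse ((cmod (g 0))\<^sup>2) * cmod (deriv g 0) \<le> landau_bound 1"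
    by (simp add: d norm_mult norm_inverse power2_eq_square mult_ac)
  moreover have "0 < cmod (g 0)" using R by linarith
  hence "0 < (cmod (g 0))\<^sup>2" by (rule zero_less_power)
  ultimately show ?thesis by (simp add: field_simps)
qed

section \<open>Chordal cross ratios\<close>

text \<open>The last equation is a junk value: the point \<open>c\<close> is never a value of the covering.\<close>

fun cratio :: "complex \<Rightarrow> complex \<Rightarrow> csphere \<Rightarrow> csphere \<Rightarrow> complex" where
  "cratio a b (Fin c) (Fin z) = (z - a) * (b - c) / ((z - c) * (b - a))"
| "cratio a b (Fin c) Infty = (b - c) / (b - a)"
| "cratio a b Infty (Fin z) = (z - a) / (b - a)"
| "cratio a b Infty Infty = 0"

lemma cratio_neq:
  assumes "a \<noteq> b" "c \<noteq> Fin a" "c \<noteq> Fin b" "x \<noteq> Fin a" "x \<noteq> Fin b" "x \<noteq> c"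
  shows "cratio a b c x \<noteq> 0" "cratio a b c x \<noteq> 1"
proof -
  show "cratio a b c x \<noteq> 0"
    using assms by (cases c; cases x) auto
  show "cratio a b c x \<noteq> 1"
  proof (cases c; cases x)
    fix c' z assume cz: "c = Fin c'" "x = Fin z"
    have "(z - a) * (b - c') - (z - c') * (b - a) = (z - b) * (a - c')"
      by algebra
    moreover have "(z - b) * (a - c') \<noteq> 0" using assms cz by auto
    ultimately have "(z - a) * (b - c') \<noteq> (z - c') * (b - a)" by auto
    thus ?thesis using assms cz by auto
  qed (use assms in auto)
qed

text \<open>Each point occurs once above and once below the fraction bar, so the factors that
  distinguish Euclidean from chordal distances cancel.\<close>

lemma norm_cratio:
  assumes "a \<noteq> b" "Fin w \<noteq> c"
  shows "cmod (cratio a b c (Fin w)) = dist (Fin w) (Fin a) * dist (Fin b) c / (dist (Fin w) c * dist (Fin a) (Fin b))"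
proof -
  define S where "S = (\<lambda>z. sqrt (1 + (cmod z)\<^sup>2))"
  have pos: "0 < S z" for z using one_plus_norm_sq_pos by (simp add: S_def)
  have nz: "S z \<noteq> 0" for z using pos[of z] by simp
  have "dist (Fin u) (Fin v) = cmod (u - v) / (S u * S v)" "dist (Fin u) Infty = 1 / S u" for u v
    by (simp_all only: dist_Fin_Fin dist_Fin_Infty S_def)
  note D = this
  show ?thesis
    using assms nz
    by (cases c) (simp_all add: D norm_mult norm_divide norm_minus_commute[of a b] divide_simps)
qed

text \<open>The conversion factors cancel as in \<open>norm_cratio\<close>, except for
  \<open>W\<close> squared, which is the weight 1 + |w|^2 on the left.\<close>

lemma cratio_deriv:
  assumes "a \<noteq> b" "Fin w \<noteq> c"
  obtains d where "((\<lambda>z. cratio a b c (Fin z)) has_field_derivative d) (at w)"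
    "(1 + (cmod w)\<^sup>2) * cmod d = dist (Fin b) c * dist (Fin a) c / ((dist (Fin w) c)\<^sup>2 * dist (Fin a) (Fin b))"
proof -
  define A B W where "A = sqrt (1 + (cmod a)\<^sup>2)" and "B = sqrt (1 + (cmod b)\<^sup>2)" and "W = sqrt (1 + (cmod w)\<^sup>2)"
  have pos: "A > 0" "B > 0" "W > 0" "1 + (cmod w)\<^sup>2 = W\<^sup>2"
    using one_plus_norm_sq_pos by (auto simp: A_def B_def W_def)
  have ab: "cmod (a - b) > 0" "cmod (b - a) = cmod (a - b)" using assms by (auto simp: norm_minus_commute)
  show ?thesis
  proof (cases c)
    case Infty
    show ?thesis
    proof
      show "((\<lambda>z. cratio a b c (Fin z)) has_field_derivative 1 / (b - a)) (at w)"
        unfolding Infty cratio.simps using assms(1) by (auto intro!: derivative_eq_intros)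
      show "(1 + (cmod w)\<^sup>2) * cmod (1 / (b - a)) = dist (Fin b) c * dist (Fin a) c / ((dist (Fin w) c)\<^sup>2 * dist (Fin a) (Fin b))"
        unfolding pos(4) Infty dist_Fin_Infty dist_Fin_Fin A_def[symmetric] B_def[symmetric] W_def[symmetric]
        using pos(1-3) ab by (simp add: norm_divide power_divide)
    qed
  next
    case (Fin c')
    define C where "C = sqrt (1 + (cmod c')\<^sup>2)"
    have C: "C > 0" using one_plus_norm_sq_pos by (auto simp: C_def)
    have nz: "w - c' \<noteq> 0" "b - a \<noteq> 0" using assms Fin by auto
    define d where "d = (b - c') * (a - c') / ((w - c')\<^sup>2 * (b - a))"
    show ?thesis
    proof
      have "((\<lambda>z. (z - a) * (b - c') / ((z - c') * (b - a))) has_field_derivative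
         ((b - c') * ((w - c') * (b - a)) - ((w - a) * (b - c')) * (b - a)) / (((w - c') * (b - a)) * ((w - c') * (b - a)))) (at w)"
        using nz by (auto intro!: derivative_eq_intros)
      moreover have "(b - c') * ((w - c') * (b - a)) - ((w - a) * (b - c')) * (b - a) = (b - c') * (b - a) * (a - c')"
        by algebra
      moreover have "(b - c') * (b - a) * (a - c') / (((w - c') * (b - a)) * ((w - c') * (b - a))) = d"
        unfolding d_def using nz by (subst frac_eq_eq) (simp_all add: power2_eq_square mult_ac)
      ultimately show "((\<lambda>z. cratio a b c (Fin z)) has_field_derivative d) (at w)"
        unfolding Fin cratio.simps by simp
      have "cmod d = cmod (b - c') * cmod (a - c') / ((cmod (w - c'))\<^sup>2 * cmod (a - b))"
        by (simp add: d_def norm_mult norm_divide norm_power ab)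
      moreover have "cmod (w - c') > 0" using nz by simp
      ultimately show "(1 + (cmod w)\<^sup>2) * cmod d = dist (Fin b) c * dist (Fin a) c / ((dist (Fin w) c)\<^sup>2 * dist (Fin a) (Fin b))"
        unfolding pos(4) Fin dist_Fin_Fin A_def[symmetric] B_def[symmetric] W_def[symmetric] C_def[symmetric]
        using pos(1-3) ab C by (simp add: divide_simps power2_eq_square)
    qed
  qed
qed

lemma cratio_holomorphic:
  assumes p: "sphere_holomorphic_on p S" "open S" and c: "c \<notin> p ` S"
  shows "cratio a b c \<circ> p holomorphic_on S"
proof -
  note pD = sphere_holomorphic_onD[OF p(1)]
  define S1 S2 where "S1 = {z\<in>S. p z \<noteq> Infty}" and "S2 = {z\<in>S. p z \<noteq> Fin 0}"
  have S: "open S1" "open S2" "S = S1 \<union> S2"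
    using open_preimage_neq[OF pD(1) p(2)] by (auto simp: S1_def S2_def)
  show ?thesis
  proof (cases c)
    case (Fin c')
    have "cratio a b c \<circ> p holomorphic_on S1"
    proof (rule holomorphic_transform)
      have "fin_chart (p z) - c' \<noteq> 0" if "z \<in> S1" for z
        using that c Fin by (cases "p z") (force simp: S1_def)+
      thus "(\<lambda>z. (fin_chart (p z) - a) * (b - c') / (fin_chart (p z) - c') / (b - a)) holomorphic_on S1"
        using pD(2) unfolding divide_inverse[of _ "b - a"]
        by (intro holomorphic_intros) (auto simp: S1_def o_def)
      show "(fin_chart (p z) - a) * (b - c') / (fin_chart (p z) - c') / (b - a) = (cratio a b c \<circ> p) z"
        if "z \<in> S1" for z
        using that Fin by (cases "p z") (auto simp: S1_def)
    qed
    moreover have "cratio a b c \<circ> p holomorphic_on S2"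
    proof (rule holomorphic_transform)
      have nz: "1 - c' * inf_chart (p z) \<noteq> 0" if "z \<in> S2" for z
        using that c Fin by (cases "p z") (force simp: S2_def field_simps)+
      \<comment> \<open>Numerator and denominator are divided by the value of \<open>p\<close>,
        which makes the formula regular where that value is \<open>Infty\<close>.\<close>
      thus "(\<lambda>z. (1 - a * inf_chart (p z)) * (b - c') / (1 - c' * inf_chart (p z)) / (b - a)) holomorphic_on S2"
        using pD(3) unfolding divide_inverse[of _ "b - a"]
        by (intro holomorphic_intros) (auto simp: S2_def o_def)
      show "(1 - a * inf_chart (p z)) * (b - c') / (1 - c' * inf_chart (p z)) / (b - a) = (cratio a b c \<circ> p) z"
        if z: "z \<in> S2" for z
      proof (cases "p z")
        case (Fin u)
        hence u: "u \<noteq> 0" using z by (auto simp: S2_def)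
        have "1 - a * inverse u = (u - a) / u" "1 - c' * inverse u = (u - c') / u"
          using u by (auto simp: field_simps)
        thus ?thesis using \<open>c = Fin c'\<close> Fin u by simp
      qed (use Fin in auto)
    qed
    ultimately show ?thesis using S by (simp add: holomorphic_on_Un)
  next
    case Infty
    hence "S1 = S" using c by (force simp: S1_def)
    show ?thesis
    proof (rule holomorphic_transform)
      show "(\<lambda>z. (fin_chart (p z) - a) / (b - a)) holomorphic_on S"
        using pD(2) \<open>S1 = S\<close> unfolding divide_inverse
        by (intro holomorphic_intros) (auto simp: S1_def o_def)
      show "(fin_chart (p z) - a) / (b - a) = (cratio a b c \<circ> p) z" if "z \<in> S" for z
        using that Infty c by (cases "p z") force+
    qed
  qed
qed

text \<open>The cross ratio pulls back under the universal covering to a function omitting 0 and 1, to which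
  Schottky's theorem applies; its spherical derivative is the quotient \<open>E\<close> of chordal distances.
  For \<open>Q \<ge> 1\<close> one uses the reciprocal function.\<close>

lemma sph_hyp_density_lower:
  assumes \<Omega>: "hyperbolic_domain \<Omega>" "Fin w \<in> \<Omega>"
    and abc: "Fin a \<notin> \<Omega>" "Fin b \<notin> \<Omega>" "c \<notin> \<Omega>" "a \<noteq> b" "c \<noteq> Fin a" "c \<noteq> Fin b"
  defines "Q \<equiv> dist (Fin w) (Fin a) * dist (Fin b) c / (dist (Fin w) c * dist (Fin a) (Fin b))"
    and "E \<equiv> dist (Fin b) c * dist (Fin a) c / ((dist (Fin w) c)\<^sup>2 * dist (Fin a) (Fin b))"
  shows "Q \<le> R \<Longrightarrow> E \<le> landau_bound R * sph_hyp_density \<Omega> (Fin w)"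
    and "1 \<le> Q \<Longrightarrow> E \<le> Q\<^sup>2 * landau_bound 1 * sph_hyp_density \<Omega> (Fin w)"
proof -
  obtain p where p: "analytic_universal_covering p \<Omega>" "p 0 = Fin w" "deriv (fin_chart \<circ> p) 0 \<noteq> 0"
    "hyp_density \<Omega> (Fin w) = 1 / cmod (deriv (fin_chart \<circ> p) 0)"
    using hyp_density_at_base[OF \<Omega>] .
  note P = analytic_universal_coveringD[OF p(1)]
  note pD = sphere_holomorphic_onD[OF P(1)]
  have wc: "Fin w \<noteq> c" using \<Omega>(2) abc(3) by auto
  define g where "g = cratio a b c \<circ> p"
  have g: "g holomorphic_on ball 0 1"
    unfolding g_def using P(1,3) abc(3) by (intro cratio_holomorphic) auto
  have g01: "g z \<noteq> 0 \<and> g z \<noteq> 1" if "z \<in> ball 0 1" for z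
  proof -
    have "p z \<in> \<Omega>" using P(3) that by blast
    hence "p z \<noteq> Fin a" "p z \<noteq> Fin b" "p z \<noteq> c" using abc by auto
    thus ?thesis unfolding g_def using cratio_neq[OF abc(4-6)] by simp
  qed
  have g0: "cmod (g 0) = Q"
    unfolding g_def Q_def using norm_cratio[OF abc(4) wc] p(2) by simp
  obtain d where d: "((\<lambda>z. cratio a b c (Fin z)) has_field_derivative d) (at w)" "(1 + (cmod w)\<^sup>2) * cmod d = E"
    using cratio_deriv[OF abc(4) wc] unfolding E_def by metis
  have "(fin_chart \<circ> p has_field_derivative deriv (fin_chart \<circ> p) 0) (at 0)"
    using p(2) by (intro holomorphic_derivI[OF pD(2)] open_preimage_neq pD(1)) auto
  hence "((\<lambda>z. cratio a b c (Fin z)) \<circ> (fin_chart \<circ> p) has_field_derivative d * deriv (fin_chart \<circ> p) 0) (at 0)"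
    using d(1) p(2) by (intro DERIV_chain) auto
  moreover have "open {z\<in>ball 0 1. p z \<noteq> Infty}"
    by (rule open_preimage_neq[OF pD(1) open_ball])
  moreover have "0 \<in> {z\<in>ball 0 1. p z \<noteq> Infty}"
    using p(2) by simp
  moreover have "((\<lambda>z. cratio a b c (Fin z)) \<circ> (fin_chart \<circ> p)) z = g z" if "z \<in> {z\<in>ball 0 1. p z \<noteq> Infty}" for z
    using that by (cases "p z") (auto simp: g_def)
  ultimately have "(g has_field_derivative d * deriv (fin_chart \<circ> p) 0) (at 0)"
    by (rule has_field_derivative_transform_within_open)
  hence dg: "deriv g 0 = d * deriv (fin_chart \<circ> p) 0" by (rule DERIV_imp_deriv)
  have main: "E \<le> L * sph_hyp_density \<Omega> (Fin w)" if "cmod (deriv g 0) \<le> L" for L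
  proof -
    have "cmod d \<le> L / cmod (deriv (fin_chart \<circ> p) 0)"
      using that p(3) unfolding dg by (simp add: norm_mult field_simps)
    hence "(1 + (cmod w)\<^sup>2) * cmod d \<le> (1 + (cmod w)\<^sup>2) * (L / cmod (deriv (fin_chart \<circ> p) 0))"
      by (intro mult_left_mono) auto
    thus ?thesis using d(2) p(4) by (simp add: mult_ac)
  qed
  show "E \<le> landau_bound R * sph_hyp_density \<Omega> (Fin w)" if "Q \<le> R"
    using main[OF deriv_le_omit_01[OF g g01]] g0 that by simp
  show "E \<le> Q\<^sup>2 * landau_bound 1 * sph_hyp_density \<Omega> (Fin w)" if "1 \<le> Q"
    using main[OF deriv_le_omit_01_inverse[OF g g01]] g0 that by simp
qed

text \<open>Both factors are continuous at \<open>Infty\<close>, so a lower bound at finite points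
  persists in the limit. The cross-ratio estimates thus need no second version in the coordinate
  1/z.\<close>

lemma le_sph_hyp_density_Infty:
  assumes \<Omega>: "hyperbolic_domain \<Omega>" "x \<in> \<Omega>"
    and F: "continuous_on UNIV F" "\<And>w. Fin w \<in> \<Omega> \<Longrightarrow> c \<le> F (Fin w) * sph_hyp_density \<Omega> (Fin w)"
  shows "c \<le> F x * sph_hyp_density \<Omega> x"
proof (cases x)
  case Infty
  have "open \<Omega>" using \<Omega>(1) by (simp add: hyperbolic_domain_def)
  have "((\<lambda>z. F (Fin z)) \<longlongrightarrow> F Infty) at_infinity"
    using continuous_on_tendsto_compose[OF F(1) Fin_tendsto_Infty] by simp
  hence "((\<lambda>z. F (Fin z) * sph_hyp_density \<Omega> (Fin z)) \<longlongrightarrow> F Infty * sph_hyp_density \<Omega> Infty) at_infinity"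
    using \<Omega> Infty by (intro tendsto_mult sph_hyp_density_tendsto_Infty) auto
  moreover have "eventually (\<lambda>z. c \<le> F (Fin z) * sph_hyp_density \<Omega> (Fin z)) at_infinity"
    using eventually_Fin_in[OF \<open>open \<Omega>\<close>] \<Omega>(2) Infty F(2) by (auto elim: eventually_mono)
  ultimately show ?thesis
    unfolding Infty by (rule tendsto_lowerbound) (rule trivial_limit_at_infinity)
qed (use F(2) \<Omega>(2) in auto)

text \<open>The cases complement each other. For cross ratios of modulus at most 1 the bound is
  \<open>E\<close>, which only grows as \<open>w\<close> approaches \<open>c\<close>; otherwise it
  is \<open>E\<close> over \<open>Q\<close> squared, in which the distance to \<open>a\<close>
  replaces that to \<open>c\<close>.\<close>

lemma sph_hyp_density_bounded_below:
  assumes \<Omega>: "hyperbolic_domain \<Omega>"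
  obtains m where "0 < m" "\<And>x. x \<in> \<Omega> \<Longrightarrow> m \<le> sph_hyp_density \<Omega> x"
proof -
  have "open \<Omega>" using \<Omega> by (simp add: hyperbolic_domain_def)
  obtain a b c where abc: "Fin a \<in> frontier \<Omega>" "Fin b \<in> frontier \<Omega>" "c \<in> frontier \<Omega>"
    "a \<noteq> b" "c \<noteq> Fin a" "c \<noteq> Fin b"
    using hyperbolic_domainE[OF \<Omega>] by blast
  have abc': "Fin a \<notin> \<Omega>" "Fin b \<notin> \<Omega>" "c \<notin> \<Omega>"
    using abc frontier_disjoint_open[OF \<open>open \<Omega>\<close>] by auto
  define \<alpha> \<beta> \<gamma> where "\<alpha> = dist (Fin b) c" and "\<beta> = dist (Fin a) c" and "\<gamma> = dist (Fin a) (Fin b)"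
  have pos: "0 < \<alpha>" "0 < \<beta>" "0 < \<gamma>" using abc by (auto simp: \<alpha>_def \<beta>_def \<gamma>_def)
  have le1: "\<alpha> \<le> 1" "\<beta> \<le> 1" "\<gamma> \<le> 1" using dist_csphere_le_1 by (auto simp: \<alpha>_def \<beta>_def \<gamma>_def)
  \<comment> \<open>The product of the three distances lies below both quantities that arise,
    \<open>\<alpha> * \<beta> / (y\<^sup>2 * \<gamma>)\<close> and
    \<open>\<beta> * \<gamma> / (x\<^sup>2 * \<alpha>)\<close>, since all chordal distances are at
    most 1.\<close>
  define m where "m = \<alpha> * \<beta> * \<gamma> / landau_bound 1"
  have m: "m \<le> 1 * sph_hyp_density \<Omega> (Fin w)" if w: "Fin w \<in> \<Omega>" for w
  proof -
    define x y where "x = dist (Fin w) (Fin a)" and "y = dist (Fin w) c"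
    have xy: "0 < x" "0 < y" "x \<le> 1" "y \<le> 1"
      using w abc' dist_csphere_le_1 by (auto simp: x_def y_def)
    have xy2: "x\<^sup>2 \<le> 1" "y\<^sup>2 \<le> 1" using xy by (auto simp: power_le_one)
    note L = sph_hyp_density_lower[OF \<Omega> w abc' abc(4-6), folded \<alpha>_def \<beta>_def \<gamma>_def x_def y_def]
    define \<mu> where "\<mu> = sph_hyp_density \<Omega> (Fin w)"
    have "\<alpha> * \<beta> * \<gamma> \<le> landau_bound 1 * \<mu>"
    proof (cases "x * \<alpha> / (y * \<gamma>) \<le> 1")
      case True
      have "y\<^sup>2 * \<gamma> \<le> 1" using xy2 le1 pos by (intro mult_le_one) auto
      hence "\<alpha> * \<beta> * \<gamma> * (y\<^sup>2 * \<gamma>) \<le> \<alpha> * \<beta> * 1"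
        using mult_mono[of \<gamma> 1 "y\<^sup>2 * \<gamma>" 1] le1 pos by (simp add: mult.assoc mult_left_mono)
      hence "\<alpha> * \<beta> * \<gamma> \<le> \<alpha> * \<beta> / (y\<^sup>2 * \<gamma>)"
        using pos xy by (simp add: field_simps)
      also have "\<dots> \<le> landau_bound 1 * \<mu>" unfolding \<mu>_def by (rule L(1)[OF True])
      finally show ?thesis .
    next
      case False
      have "\<alpha> * \<beta> / (y\<^sup>2 * \<gamma>) \<le> (x * \<alpha> / (y * \<gamma>))\<^sup>2 * landau_bound 1 * \<mu>"
        unfolding \<mu>_def by (rule L(2)) (use False in simp)
      hence "\<beta> * \<gamma> \<le> x\<^sup>2 * \<alpha> * (landau_bound 1 * \<mu>)"
        using pos xy by (simp add: power_divide power_mult_distrib field_simps power2_eq_square)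
      moreover have "0 < landau_bound 1 * \<mu>"
        unfolding \<mu>_def using landau_bound_pos sph_hyp_density_pos[OF \<Omega> w] by (intro mult_pos_pos)
      moreover have "x\<^sup>2 * \<alpha> \<le> 1" using xy2 le1 pos by (intro mult_le_one) auto
      ultimately have "\<beta> * \<gamma> \<le> 1 * (landau_bound 1 * \<mu>)"
        using mult_right_mono[of "x\<^sup>2 * \<alpha>" 1 "landau_bound 1 * \<mu>"] by linarith
      moreover have "\<alpha> * (\<beta> * \<gamma>) \<le> 1 * (\<beta> * \<gamma>)"
        using le1 pos by (intro mult_right_mono) auto
      ultimately show ?thesis by (simp add: mult.assoc)
    qed
    thus ?thesis using landau_bound_pos[of 1] by (simp add: m_def \<mu>_def field_simps)
  qed
  have "0 < m" using pos landau_bound_pos by (simp add: m_def)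
  moreover have "m \<le> 1 * sph_hyp_density \<Omega> x" if "x \<in> \<Omega>" for x
    using le_sph_hyp_density_Infty[OF \<Omega> that, of "\<lambda>_. 1" m] m by simp
  ultimately show ?thesis using that by simp
qed

section \<open>Uniformly perfect boundaries\<close>

lemma sqrt_one_plus_norm_sq_lipschitz:
  "sqrt (1 + (cmod z)\<^sup>2) \<le> sqrt (1 + (cmod w)\<^sup>2) + cmod (z - w)"
proof -
  have "norm (1::real, z) \<le> norm (1::real, w) + norm (0::real, z - w)"
    using norm_triangle_ineq[of "(1::real, w)" "(0::real, z - w)"] by simp
  thus ?thesis by (simp add: norm_Pair)
qed

lemma uniformly_perfectE:
  assumes "uniformly_perfect E"
  obtains k where "0 < k" "k < 1"
    "\<And>a r. Fin a \<in> E \<Longrightarrow> 0 < r \<Longrightarrow> ereal r < euclid_diameter E \<Longrightarrow>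
       \<exists>z. Fin z \<in> E \<and> k * r < cmod (z - a) \<and> cmod (z - a) < r"
  using assms unfolding uniformly_perfect_def by metis

text \<open>Uniform perfectness speaks of annuli about finite points only. Large annuli about one
  fixed point \<open>e\<close> supply boundary points at every small scale around
  \<open>Infty\<close>.\<close>

lemma uniformly_perfect_near_Infty:
  assumes E: "uniformly_perfect E" "Infty \<in> E"
  obtains \<eta> \<rho>0 where "0 < \<eta>" "\<eta> \<le> 1" "0 < \<rho>0"
    "\<And>\<rho>. 0 < \<rho> \<Longrightarrow> \<rho> < \<rho>0 \<Longrightarrow>
       \<exists>b. Fin b \<in> E \<and> \<eta> * \<rho> \<le> dist (Fin b) Infty \<and> dist (Fin b) Infty \<le> \<rho>"
proof -
  obtain k where k: "0 < k" "k < 1"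
    "\<And>a r. Fin a \<in> E \<Longrightarrow> 0 < r \<Longrightarrow> ereal r < euclid_diameter E \<Longrightarrow>
       \<exists>z. Fin z \<in> E \<and> k * r < cmod (z - a) \<and> cmod (z - a) < r"
    using uniformly_perfectE[OF E(1)] by metis
  obtain e where e: "Fin e \<in> E"
    using E(1) unfolding uniformly_perfect_def by (metis csphere.exhaust)
  define \<rho>0 where "\<rho>0 = 2 / (k + 2 * cmod e)"
  have "\<exists>b. Fin b \<in> E \<and> k / 6 * \<rho> \<le> dist (Fin b) Infty \<and> dist (Fin b) Infty \<le> \<rho>"
    if \<rho>: "0 < \<rho>" "\<rho> < \<rho>0" for \<rho>
  proof -
    \<comment> \<open>The inner radius k R is 2/\<open>\<rho>\<close>. For \<open>\<rho>\<close>
      below \<open>\<rho>0\<close> it exceeds k + 2|e|, so R > 1 and the centre costs at most half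
      of k R; this leaves \<open>B\<close> between k R/2 and 3 R.\<close>
    define R where "R = 2 / (k * \<rho>)"
    have R: "R > 0" using \<rho> k by (simp add: R_def)
    have "\<rho> * (k + 2 * cmod e) < 2"
      using \<rho> k unfolding \<rho>0_def by (simp add: pos_less_divide_eq add_pos_nonneg)
    hence "k + 2 * cmod e < 2 / \<rho>"
      using \<rho> by (simp add: field_simps)
    also have "2 / \<rho> = k * R" using k \<rho> by (simp add: R_def)
    finally have kR: "k + 2 * cmod e < k * R" .
    have "k * R \<le> 1 * R" using k R by (intro mult_right_mono) auto
    have "k * 1 < k * R" using kR norm_ge_zero[of e] by linarith
    hence R1: "1 < R" using k by (simp only: mult_less_cancel_left_pos)
    obtain b where b: "Fin b \<in> E" "k * R < cmod (b - e)" "cmod (b - e) < R"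
      using k(3)[OF e R] E(2) by (auto simp: euclid_diameter_def)
    define B where "B = sqrt (1 + (cmod b)\<^sup>2)"
    have B: "0 < B" "cmod b \<le> B" "B \<le> 1 + cmod b"
      using one_plus_norm_sq_pos[of b] sqrt_one_plus_norm_sq_ge(2)[of b]
        sqrt_one_plus_norm_sq_lipschitz[of b 0] by (auto simp: B_def)
    have "cmod (b - e) \<le> cmod b + cmod e" "cmod b \<le> cmod (b - e) + cmod e"
      using norm_triangle_ineq4[of b e] norm_triangle_sub[of b e] by auto
    hence "k * R / 2 \<le> B" "B \<le> 3 * R"
      using B b kR R1 \<open>k * R \<le> 1 * R\<close> k(1) by linarith+
    hence "1 / B \<le> 1 / (k * R / 2)" "1 / (3 * R) \<le> 1 / B"
      using B(1) R k by (intro divide_left_mono; simp)+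
    moreover have "1 / (k * R / 2) = \<rho>" "1 / (3 * R) = k / 6 * \<rho>"
      using k \<rho> by (simp_all add: R_def)
    moreover have "dist (Fin b) Infty = 1 / B" by (simp add: dist_Fin_Infty B_def)
    ultimately show ?thesis using b(1) by auto
  qed
  moreover have "0 < \<rho>0" using k by (simp add: \<rho>0_def add_pos_nonneg)
  ultimately show ?thesis using k by (intro that[of "k / 6" \<rho>0]) auto
qed

text \<open>The witnesses are kept finite because \<open>cratio\<close> takes finite arguments \<open>a\<close> and \<open>b\<close>.\<close>

lemma uniformly_perfect_chordal:
  assumes E: "uniformly_perfect E"
  obtains \<kappa> r0 where "0 < \<kappa>" "0 < r0"
    "\<And>a r. Fin a \<in> E \<Longrightarrow> 0 < r \<Longrightarrow> r < r0 \<Longrightarrow>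
       \<exists>b. Fin b \<in> E \<and> \<kappa> * r \<le> dist (Fin a) (Fin b) \<and> dist (Fin a) (Fin b) \<le> 2 * r"
proof -
  obtain k where k: "0 < k" "k < 1"
    "\<And>a r. Fin a \<in> E \<Longrightarrow> 0 < r \<Longrightarrow> ereal r < euclid_diameter E \<Longrightarrow>
       \<exists>z. Fin z \<in> E \<and> k * r < cmod (z - a) \<and> cmod (z - a) < r"
    using uniformly_perfectE[OF E] by metis
  have near: "\<exists>b. Fin b \<in> E \<and> k / 3 * r \<le> dist (Fin a) (Fin b) \<and> dist (Fin a) (Fin b) \<le> r"
    if a: "Fin a \<in> E" and r: "0 < r" "r * sqrt (1 + (cmod a)\<^sup>2) \<le> 1"
      "ereal (r * (sqrt (1 + (cmod a)\<^sup>2))\<^sup>2 / 2) < euclid_diameter E" for a r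
  proof -
    define A where "A = sqrt (1 + (cmod a)\<^sup>2)"
    have A: "0 < A" using one_plus_norm_sq_pos[of a] by (simp add: A_def)
    \<comment> \<open>\<open>A\<close> squared converts the chordal scale \<open>r\<close> at
      \<open>a\<close> into a Euclidean one. The condition r A at most 1 makes this radius at most
      A/2, so \<open>B\<close> stays between A/2 and 3A/2.\<close>
    define \<rho> where "\<rho> = r * A\<^sup>2 / 2"
    have \<rho>: "0 < \<rho>" using r A by (simp add: \<rho>_def)
    have "r * A * A \<le> 1 * A" using r A by (intro mult_right_mono) (auto simp: A_def)
    hence \<rho>A: "\<rho> \<le> A / 2" by (simp add: \<rho>_def power2_eq_square)
    obtain b where b: "Fin b \<in> E" "k * \<rho> < cmod (b - a)" "cmod (b - a) < \<rho>"
      using k(3)[OF a \<rho>] r(3) by (auto simp: \<rho>_def A_def)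
    define B where "B = sqrt (1 + (cmod b)\<^sup>2)"
    have "B \<le> A + cmod (b - a)" "A \<le> B + cmod (b - a)"
      using sqrt_one_plus_norm_sq_lipschitz[of b a] sqrt_one_plus_norm_sq_lipschitz[of a b]
      by (auto simp: A_def B_def norm_minus_commute)
    hence B: "B \<le> 3 / 2 * A" "A / 2 \<le> B" using b \<rho>A by linarith+
    have B0: "0 < B" using B(2) A by linarith
    have d: "dist (Fin a) (Fin b) = cmod (b - a) / (A * B)"
      by (simp add: dist_Fin_Fin A_def B_def norm_minus_commute)
    have "cmod (b - a) / (A * B) \<le> \<rho> / (A * (A / 2))"
      using b A B B0 \<rho> by (intro frac_le mult_left_mono) auto
    also have "\<dots> = r" using A by (simp add: \<rho>_def power2_eq_square)
    finally have 1: "dist (Fin a) (Fin b) \<le> r" by (simp add: d)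
    have "k / 3 * r = k * \<rho> / (A * (3 / 2 * A))"
      using A by (simp add: \<rho>_def power2_eq_square)
    also have "\<dots> \<le> cmod (b - a) / (A * B)"
      using b A B B0 \<rho> by (intro frac_le mult_left_mono) auto
    finally show ?thesis using b(1) 1 by (auto simp: d)
  qed
  show ?thesis
  proof (cases "Infty \<in> E")
    case True
    obtain \<eta> \<rho>0 where \<eta>: "0 < \<eta>" "\<eta> \<le> 1" "0 < \<rho>0"
      "\<And>\<rho>. 0 < \<rho> \<Longrightarrow> \<rho> < \<rho>0 \<Longrightarrow>
       \<exists>b. Fin b \<in> E \<and> \<eta> * \<rho> \<le> dist (Fin b) Infty \<and> dist (Fin b) Infty \<le> \<rho>"
      using uniformly_perfect_near_Infty[OF E True] by metis
    \<comment> \<open>k/3 is the ratio from \<open>near\<close>; the other term covers centres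
      closer than \<open>r\<close> to \<open>Infty\<close>.\<close>
    define \<kappa> where "\<kappa> = min (k / 3) (\<eta> / 16)"
    have \<kappa>: "0 < \<kappa>" "\<kappa> \<le> k / 3" "\<kappa> \<le> \<eta> / 16" using k \<eta> by (auto simp: \<kappa>_def)
    have "\<exists>b. Fin b \<in> E \<and> \<kappa> * r \<le> dist (Fin a) (Fin b) \<and> dist (Fin a) (Fin b) \<le> 2 * r"
      if a: "Fin a \<in> E" and r: "0 < r" "r < \<rho>0" for a r
    proof (cases "r * sqrt (1 + (cmod a)\<^sup>2) \<le> 1")
      case le: True
      have "\<kappa> * r \<le> k / 3 * r" using \<kappa> r by (intro mult_right_mono) auto
      moreover obtain b where "Fin b \<in> E" "k / 3 * r \<le> dist (Fin a) (Fin b)" "dist (Fin a) (Fin b) \<le> r"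
        using near[OF a r(1) le] True by (auto simp: euclid_diameter_def)
      ultimately have "\<kappa> * r \<le> dist (Fin a) (Fin b)" "dist (Fin a) (Fin b) \<le> 2 * r" "Fin b \<in> E"
        using r by linarith+
      thus ?thesis by blast
    next
      case False
      define s where "s = dist (Fin a) Infty"
      have "0 < sqrt (1 + (cmod a)\<^sup>2)" using one_plus_norm_sq_pos[of a] by simp
      hence s: "0 < s" "s < r" using False by (auto simp: s_def dist_Fin_Infty field_simps)
      have \<kappa>r: "\<kappa> * r \<le> \<eta> / 16 * r" "\<eta> * r \<le> 1 * r" "0 < \<eta> * r"
        using \<kappa> \<eta> r by (auto intro!: mult_right_mono)
      show ?thesis
      \<comment> \<open>If \<open>a\<close> is very close to \<open>Infty\<close>, a point
        \<open>b\<close> at distance about r/2 from \<open>Infty\<close> is far from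
        \<open>a\<close>. Otherwise \<open>b\<close> is taken at distance at most s/2 from
        \<open>Infty\<close>, hence at least s/2, and so \<open>\<eta> * r / 16\<close>, from
        \<open>a\<close>.\<close>
      proof (cases "s < \<eta> / 8 * r")
        case True
        obtain b where b: "Fin b \<in> E" "\<eta> * (r / 2) \<le> dist (Fin b) Infty" "dist (Fin b) Infty \<le> r / 2"
          using \<eta>(4)[of "r / 2"] r by auto
        have "dist (Fin b) Infty \<le> dist (Fin a) (Fin b) + s" "dist (Fin a) (Fin b) \<le> s + dist (Fin b) Infty"
          using dist_triangle[of "Fin b" Infty "Fin a"] dist_triangle2[of "Fin a" "Fin b" Infty]
          by (auto simp: s_def dist_commute)
        hence "\<kappa> * r \<le> dist (Fin a) (Fin b)" "dist (Fin a) (Fin b) \<le> 2 * r"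
          using b(2,3) \<kappa>r True s r(1) by linarith+
        thus ?thesis using b(1) by blast
      next
        case False
        obtain b where b: "Fin b \<in> E" "dist (Fin b) Infty \<le> s / 2"
          using \<eta>(4)[of "s / 2"] r s by auto
        have "s \<le> dist (Fin a) (Fin b) + dist (Fin b) Infty" "dist (Fin a) (Fin b) \<le> s + dist (Fin b) Infty"
          using dist_triangle[of "Fin a" Infty "Fin b"] dist_triangle2[of "Fin a" "Fin b" Infty]
          by (auto simp: s_def dist_commute)
        hence "\<kappa> * r \<le> dist (Fin a) (Fin b)" "dist (Fin a) (Fin b) \<le> 2 * r"
          using b(2) \<kappa>r False s r(1) by linarith+
        thus ?thesis using b(1) by blast
      qed
    qed
    thus ?thesis using that \<kappa>(1) \<eta>(3) by blast
  next
    case False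
    have "compact E" using E by (simp add: uniformly_perfect_def)
    hence "compact (fin_chart ` E)"
      using False by (intro compact_continuous_image continuous_on_subset[OF continuous_on_fin_chart]) auto
    hence bd: "bounded (fin_chart ` E)" by (rule compact_imp_bounded)
    have sub: "Fin -` E \<subseteq> fin_chart ` E" by (metis fin_chart.simps(1) image_iff subsetI vimageE)
    obtain M where M: "\<And>z. z \<in> fin_chart ` E \<Longrightarrow> cmod z \<le> M" using bd by (auto simp: bounded_iff)
    define N where "N = 1 + \<bar>M\<bar>"
    have N: "sqrt (1 + (cmod a)\<^sup>2) \<le> N" "0 < N" if "Fin a \<in> E" for a
      using sqrt_one_plus_norm_sq_lipschitz[of a 0] M[of a] sub that by (auto simp: N_def)
    obtain x y where xy: "Fin x \<in> E" "Fin y \<in> E" "x \<noteq> y"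
      using E False unfolding uniformly_perfect_def by (metis csphere.exhaust)
    define d where "d = diameter (Fin -` E)"
    have "dist x y \<le> d"
      unfolding d_def using bounded_subset[OF bd sub] xy by (intro diameter_bounded_bound) auto
    hence d: "0 < d" using xy(3) by (metis dist_pos_lt less_le_trans)
    have N0: "0 < N" using N xy by blast
    \<comment> \<open>\<open>N\<close> bounds all factors \<open>A\<close> on the bounded set. The
      first term secures r A at most 1, the second keeps the Euclidean radius below the
      diameter.\<close>
    define r0 where "r0 = min (1 / N) (d / N\<^sup>2)"
    have r0: "0 < r0" using N0 d by (simp add: r0_def)
    have "\<exists>b. Fin b \<in> E \<and> k / 3 * r \<le> dist (Fin a) (Fin b) \<and> dist (Fin a) (Fin b) \<le> 2 * r"
      if a: "Fin a \<in> E" and r: "0 < r" "r < r0" for a r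
    proof -
      define A where "A = sqrt (1 + (cmod a)\<^sup>2)"
      have A: "0 \<le> A" "A \<le> N" using N[OF a] by (auto simp: A_def)
      have "r * A \<le> r * N" using A r by (intro mult_left_mono) auto
      also have "\<dots> \<le> 1" using r N0 by (simp add: r0_def field_simps)
      finally have 1: "r * A \<le> 1" .
      have "r * A\<^sup>2 \<le> r * N\<^sup>2" using A r by (intro mult_left_mono power_mono) auto
      also have "\<dots> < d" using r N0 by (simp add: r0_def field_simps)
      finally have "r * A\<^sup>2 / 2 < d" using d by linarith
      hence 2: "ereal (r * A\<^sup>2 / 2) < euclid_diameter E"
        using False by (simp add: euclid_diameter_def d_def)
      show ?thesis
        using near[OF a r(1) 1[unfolded A_def] 2[unfolded A_def]] r(1) by force
    qed
    thus ?thesis using that[of "k / 3" r0] k r0 by auto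
  qed
qed

section \<open>Uniform perfectness implies the lower bound\<close>

lemma infdist_less_obtain:
  assumes "A \<noteq> {}" "infdist x A < e"
  obtains a where "a \<in> A" "dist x a < e"
proof -
  have "(INF a\<in>A. dist x a) < e" using assms by (simp add: infdist_notempty)
  hence "\<exists>a\<in>A. dist x a < e"
    using assms(1) by (subst (asm) cINF_less_iff) auto
  thus ?thesis using that by blast
qed

lemma delta_pos:
  assumes "hyperbolic_domain \<Omega>" "x \<in> \<Omega>"
  shows "0 < delta \<Omega> x"
proof -
  obtain a b c where "Fin a \<in> frontier \<Omega>" using hyperbolic_domainE[OF assms(1)] .
  moreover have "x \<notin> frontier \<Omega>"
    using assms frontier_disjoint_open by (auto simp: hyperbolic_domain_def)
  ultimately show ?thesis
    unfolding delta_def by (intro infdist_pos_not_in_closed) auto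
qed

text \<open>If delta is at least \<open>\<eta>\<close>, the global bound \<open>m\<close> suffices.
  Otherwise the third point \<open>e\<close> of the cross ratio is chosen far away: then
  \<open>Q\<close> stays bounded while \<open>E\<close> is at least a constant over delta.\<close>

lemma delta_mult_density_lower:
  assumes \<Omega>: "hyperbolic_domain \<Omega>" and up: "uniformly_perfect (frontier \<Omega>)"
  obtains c where "0 < c" "\<And>x. x \<in> \<Omega> \<Longrightarrow> c \<le> delta \<Omega> x * sph_hyp_density \<Omega> x"
proof -
  define E where "E = frontier \<Omega>"
  have "open \<Omega>" using \<Omega> by (simp add: hyperbolic_domain_def)
  hence Eout: "x \<notin> \<Omega>" if "x \<in> E" for x using that frontier_disjoint_open by (auto simp: E_def)
  have up': "uniformly_perfect E" using up by (simp add: E_def)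
  obtain m where m: "0 < m" "\<And>x. x \<in> \<Omega> \<Longrightarrow> m \<le> sph_hyp_density \<Omega> x"
    using sph_hyp_density_bounded_below[OF \<Omega>] by metis
  obtain \<kappa> r0 where \<kappa>: "0 < \<kappa>" "0 < r0"
    "\<And>a r. Fin a \<in> E \<Longrightarrow> 0 < r \<Longrightarrow> r < r0 \<Longrightarrow>
       \<exists>b. Fin b \<in> E \<and> \<kappa> * r \<le> dist (Fin a) (Fin b) \<and> dist (Fin a) (Fin b) \<le> 2 * r"
    using uniformly_perfect_chordal[OF up'] by metis
  obtain x y where xy: "x \<in> E" "y \<in> E" "x \<noteq> y"
    using up' unfolding uniformly_perfect_def by blast
  define d0 where "d0 = dist x y"
  have d0: "0 < d0" "d0 \<le> 1" using xy dist_csphere_le_1 by (auto simp: d0_def)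
  \<comment> \<open>With delta below d0/16 the points \<open>b\<close> and \<open>w\<close> are
    closer than d0/8 to \<open>a\<close>, hence at least d0/4 from a point that is d0/2 away from
    \<open>a\<close>.\<close>
  define \<eta> where "\<eta> = min r0 (d0 / 16)"
  \<comment> \<open>The bound for \<open>Q\<close> from numerator at most 2 delta, distance from
    \<open>w\<close> to \<open>e\<close> at least d0/4, and distance from \<open>a\<close> to
    \<open>b\<close> at least \<open>\<kappa>\<close> delta.\<close>
  define R where "R = 8 / (d0 * \<kappa>)"
  define c where "c = min (\<eta> * m) (d0\<^sup>2 / (16 * landau_bound R))"
  have c: "0 < c"
    using d0 m \<kappa> landau_bound_pos[of R] by (simp add: c_def \<eta>_def)
  have fin: "c \<le> delta \<Omega> (Fin w) * sph_hyp_density \<Omega> (Fin w)" if w: "Fin w \<in> \<Omega>" for w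
  proof -
    define \<delta> \<mu> where "\<delta> = delta \<Omega> (Fin w)" and "\<mu> = sph_hyp_density \<Omega> (Fin w)"
    have \<delta>: "0 < \<delta>" using delta_pos[OF \<Omega> w] by (simp add: \<delta>_def)
    have \<mu>: "m \<le> \<mu>" using m(2)[OF w] by (simp add: \<mu>_def)
    show ?thesis
    proof (cases "\<eta> \<le> \<delta>")
      case True
      have "\<eta> * m \<le> \<delta> * \<mu>" using True \<mu> m(1) \<delta> by (intro mult_mono) auto
      thus ?thesis by (simp add: c_def \<delta>_def \<mu>_def)
    next
      case False
      hence \<delta>s: "\<delta> < r0" "\<delta> < d0 / 16" by (auto simp: \<eta>_def)
      \<comment> \<open>A nearby boundary point could be \<open>Infty\<close>, which the cross ratio
        does not admit as \<open>a\<close>. The factor 2 leaves room to replace it by a finite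
        boundary point.\<close>
      obtain a where a: "Fin a \<in> E" "dist (Fin w) (Fin a) < 2 * \<delta>"
      proof -
        obtain a0 where a0: "a0 \<in> E" "dist (Fin w) a0 < 2 * \<delta>"
          using infdist_less_obtain[of E "Fin w" "2 * \<delta>"] \<delta> xy(1) by (auto simp: \<delta>_def delta_def E_def)
        show ?thesis
        proof (cases a0)
          case Infty
          obtain \<eta>' \<rho>0 where \<eta>': "0 < \<rho>0"
            "\<And>\<rho>. 0 < \<rho> \<Longrightarrow> \<rho> < \<rho>0 \<Longrightarrow>
               \<exists>b. Fin b \<in> E \<and> \<eta>' * \<rho> \<le> dist (Fin b) Infty \<and> dist (Fin b) Infty \<le> \<rho>"
            using uniformly_perfect_near_Infty[OF up'] a0(1) Infty by metis
          define \<rho> where "\<rho> = min (\<rho>0 / 2) ((2 * \<delta> - dist (Fin w) Infty) / 2)"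
          have \<rho>: "0 < \<rho>" "\<rho> < \<rho>0" "\<rho> < 2 * \<delta> - dist (Fin w) Infty"
            using \<eta>'(1) a0(2) Infty by (auto simp: \<rho>_def min_def)
          then obtain b where b: "Fin b \<in> E" "dist (Fin b) Infty \<le> \<rho>" using \<eta>'(2) by blast
          have "dist (Fin w) (Fin b) \<le> dist (Fin w) Infty + dist (Fin b) Infty"
            by (rule dist_triangle2)
          thus ?thesis using b \<rho> by (intro that[of b]) auto
        qed (use a0 that in auto)
      qed
      obtain b where b: "Fin b \<in> E" "\<kappa> * \<delta> \<le> dist (Fin a) (Fin b)" "dist (Fin a) (Fin b) \<le> 2 * \<delta>"
        using \<kappa>(3)[OF a(1) \<delta> \<delta>s(1)] by blast
      \<comment> \<open>Two boundary points at distance \<open>d0\<close> cannot both be closer than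
        d0/2 to \<open>a\<close>.\<close>
      obtain e where e: "e \<in> E" "d0 / 2 \<le> dist (Fin a) e"
        using xy dist_triangle2[of x y "Fin a"] that
        by (cases "d0 / 2 \<le> dist (Fin a) x") (auto simp: d0_def dist_commute)
      define u v where "u = dist (Fin b) e" and "v = dist (Fin w) e"
      have u: "d0 / 4 \<le> u" "u \<le> 1"
        unfolding u_def using dist_triangle[of "Fin a" e "Fin b"] e(2) b(3) \<delta>s(2) d0(1)
          dist_csphere_le_1[of "Fin b" e] by linarith+
      have v: "d0 / 4 \<le> v" "v \<le> 1"
        unfolding v_def using dist_triangle3[of "Fin a" e "Fin w"] e(2) a(2) \<delta>s(2) d0(1)
          dist_csphere_le_1[of "Fin w" e] by linarith+
      define t where "t = dist (Fin a) (Fin b)"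
      have t: "\<kappa> * \<delta> \<le> t" "t \<le> 2 * \<delta>" "0 < t"
        using b(2,3) mult_pos_pos[OF \<kappa>(1) \<delta>] unfolding t_def by linarith+
      have ne: "a \<noteq> b" "e \<noteq> Fin a" "e \<noteq> Fin b"
        using t(3) e(2) u(1) d0(1) by (auto simp: t_def u_def)
      have "dist (Fin w) (Fin a) * u / (v * t) \<le> 2 * \<delta> * 1 / (d0 / 4 * (\<kappa> * \<delta>))"
        using a u v t d0 \<kappa>(1) \<delta> by (intro frac_le mult_mono) auto
      also have "\<dots> = R" using \<delta> by (simp add: R_def)
      finally have "u * dist (Fin a) e / (v\<^sup>2 * t) \<le> landau_bound R * \<mu>"
        using sph_hyp_density_lower(1)[OF \<Omega> w Eout[OF a(1)] Eout[OF b(1)] Eout[OF e(1)] ne, of R]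
        by (simp add: u_def v_def t_def \<mu>_def)
      moreover have "d0 / 4 * (d0 / 2) / (1 * (2 * \<delta>)) \<le> u * dist (Fin a) e / (v\<^sup>2 * t)"
        using u v t e d0 by (intro frac_le mult_mono) (auto simp: power_le_one)
      ultimately have "d0\<^sup>2 / (16 * \<delta>) \<le> landau_bound R * \<mu>"
        by (simp add: power2_eq_square)
      hence "d0\<^sup>2 / (16 * landau_bound R) \<le> \<delta> * \<mu>"
        using \<delta> landau_bound_pos[of R] by (simp add: field_simps)
      thus ?thesis by (simp add: c_def \<delta>_def \<mu>_def)
    qed
  qed
  have "c \<le> delta \<Omega> x * sph_hyp_density \<Omega> x" if "x \<in> \<Omega>" for x
  proof (rule le_sph_hyp_density_Infty[OF \<Omega> that _ fin])
    show "continuous_on UNIV (delta \<Omega>)"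
      unfolding delta_def[abs_def] by (intro continuous_on_infdist continuous_on_id)
  qed
  with c show ?thesis using that by blast
qed

section \<open>Thick annuli in the complement of the boundary\<close>

lemma annulus_density_le:
  assumes \<Omega>: "hyperbolic_domain \<Omega>" and k: "0 < l" "0 < s" "cmod (z - a) = s"
    and ann: "\<And>x. s * exp (- l) < cmod (x - a) \<Longrightarrow> cmod (x - a) < s * exp l \<Longrightarrow> Fin x \<in> \<Omega>"
  shows "s * l * hyp_density \<Omega> (Fin z) \<le> 1"
proof -
  \<comment> \<open>The exponential turns |Re| < 1 into the annulus of logarithmic half-width
    \<open>l\<close>. The derivative at 0 has modulus s l, and this factor \<open>l\<close> makes
    the density small.\<close>
  define g where "g = (\<lambda>\<zeta>. a + (z - a) * exp (of_real l * \<zeta>))"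
  have "Fin (g \<zeta>) \<in> \<Omega>" if "cmod \<zeta> < 1" for \<zeta>
  proof (rule ann)
    have "\<bar>Re \<zeta>\<bar> < 1" using abs_Re_le_cmod[of \<zeta>] that by linarith
    hence "l * (-1) < l * Re \<zeta>" "l * Re \<zeta> < l * 1"
      using k(1) by (intro mult_strict_left_mono; linarith)+
    moreover have "cmod (g \<zeta> - a) = s * exp (l * Re \<zeta>)"
      using k by (simp add: g_def norm_mult)
    ultimately show "s * exp (- l) < cmod (g \<zeta> - a)" "cmod (g \<zeta> - a) < s * exp l"
      using k(2) by simp_all
  qed
  hence "Fin ` g ` ball 0 1 \<subseteq> \<Omega>" by auto
  moreover have "g holomorphic_on ball 0 1" unfolding g_def by (intro holomorphic_intros)
  ultimately have "cmod (deriv g 0) * hyp_density \<Omega> (Fin (g 0)) \<le> 1"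
    by (intro hyp_density_upper[OF \<Omega>])
  moreover have "(g has_field_derivative (z - a) * of_real l) (at 0)"
    unfolding g_def by (auto intro!: derivative_eq_intros)
  hence "deriv g 0 = (z - a) * of_real l" by (rule DERIV_imp_deriv)
  ultimately show ?thesis using k by (simp add: norm_mult g_def)
qed

text \<open>Converts the chordal distance to the boundary into the Euclidean radius
  \<open>s\<close>. If \<open>Z\<close> is comparable to \<open>A\<close>, the inner point
  \<open>a\<close> does it. Otherwise |a| is small against \<open>s\<close>, so \<open>b\<close>
  lies outside radius 3s or is \<open>Infty\<close>, and the distance to \<open>b\<close> times
  \<open>Z\<close> squared is at most 2 Z.\<close>

lemma min_dist_mult_le:
  assumes s: "cmod (z - a) = s" "0 < s" and b: "\<And>b'. b = Fin b' \<Longrightarrow> 4 * s \<le> cmod (b' - a)"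
  shows "min (dist (Fin z) (Fin a)) (dist (Fin z) b) * (1 + (cmod z)\<^sup>2) \<le> 8 * s"
proof -
  define A Z where "A = sqrt (1 + (cmod a)\<^sup>2)" and "Z = sqrt (1 + (cmod z)\<^sup>2)"
  have AZ: "0 < A" "0 < Z" "1 + (cmod z)\<^sup>2 = Z\<^sup>2" "cmod a \<le> A" "cmod z \<le> Z"
    using one_plus_norm_sq_pos sqrt_one_plus_norm_sq_ge by (auto simp: A_def Z_def)
  have ZA: "Z \<le> A + s" using sqrt_one_plus_norm_sq_lipschitz[of z a] s by (simp add: A_def Z_def)
  show ?thesis
  proof (cases "Z \<le> 8 * A")
    case True
    have "dist (Fin z) (Fin a) * Z\<^sup>2 = s * Z / A"
      unfolding dist_Fin_Fin A_def[symmetric] Z_def[symmetric] s using AZ(1,2) by (simp add: power2_eq_square)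
    also have "\<dots> \<le> s * (8 * A) / A"
      using True s AZ by (intro divide_right_mono mult_left_mono) auto
    finally have "dist (Fin z) (Fin a) * Z\<^sup>2 \<le> 8 * s" using AZ by simp
    moreover have "min (dist (Fin z) (Fin a)) (dist (Fin z) b) * Z\<^sup>2 \<le> dist (Fin z) (Fin a) * Z\<^sup>2"
      by (intro mult_right_mono) auto
    ultimately show ?thesis unfolding AZ(3) by linarith
  next
    case False
    hence As: "A < s / 7" "Z \<le> 8 / 7 * s" using ZA by linarith+
    have "dist (Fin z) b * Z\<^sup>2 \<le> 8 * s"
    proof (cases b)
      case Infty
      have "dist (Fin z) b * Z\<^sup>2 = Z"
        unfolding Infty dist_Fin_Infty Z_def[symmetric] using AZ(2) by (simp add: power2_eq_square)
      thus ?thesis using As s by simp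
    next
      case (Fin b')
      define B where "B = sqrt (1 + (cmod b')\<^sup>2)"
      have "4 * s \<le> cmod (b' - a)" using b[OF Fin] .
      moreover have "cmod (b' - a) \<le> cmod b' + cmod a" by (rule norm_triangle_ineq4)
      moreover have bB: "cmod b' \<le> B" using sqrt_one_plus_norm_sq_ge by (simp add: B_def)
      ultimately have B: "3 * s \<le> B" using As AZ by linarith
      have B0: "0 < B" using B s by linarith
      have "dist (Fin z) b * Z\<^sup>2 = cmod (z - b') * Z / B"
        unfolding Fin dist_Fin_Fin B_def[symmetric] Z_def[symmetric] using AZ(2) B0 by (simp add: power2_eq_square)
      also have "\<dots> \<le> (2 * B) * Z / B"
      proof -
        have "cmod (z - b') \<le> cmod z + cmod b'" by (rule norm_triangle_ineq4)
        hence "cmod (z - b') \<le> 2 * B" using AZ As bB B s by linarith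
        thus ?thesis using AZ B0 by (intro divide_right_mono mult_right_mono) auto
      qed
      also have "\<dots> \<le> 8 * s" using B0 As s by simp
      finally show ?thesis .
    qed
    moreover have "min (dist (Fin z) (Fin a)) (dist (Fin z) b) * Z\<^sup>2 \<le> dist (Fin z) b * Z\<^sup>2"
      by (intro mult_right_mono) auto
    ultimately show ?thesis unfolding AZ(3) by linarith
  qed
qed

text \<open>If the circle of radius \<open>s\<close> missed the domain, its inside and outside would
  disconnect it, each being a neighbourhood of a boundary point. So the annulus meets the domain
  and, being connected and free of boundary points, lies in it.\<close>

lemma separating_annulus_subset:
  assumes \<Omega>: "open \<Omega>" "connected \<Omega>"
    and a: "Fin a \<in> frontier \<Omega>" and b: "b \<in> frontier \<Omega>" "\<And>b'. b = Fin b' \<Longrightarrow> R \<le> cmod (b' - a)"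
    and no: "\<And>z. r < cmod (z - a) \<Longrightarrow> cmod (z - a) < R \<Longrightarrow> Fin z \<notin> frontier \<Omega>"
    and s: "0 < r" "r < s" "s < R"
  shows "Fin ` {z. r < cmod (z - a) \<and> cmod (z - a) < R} \<subseteq> \<Omega>"
proof -
  define N where "N = {z. r < cmod (z - a) \<and> cmod (z - a) < R}"
  have "\<exists>z. Fin z \<in> \<Omega> \<and> cmod (z - a) = s"
  proof (rule ccontr)
    assume n: "\<nexists>z. Fin z \<in> \<Omega> \<and> cmod (z - a) = s"
    define X Y where "X = Fin ` ball a s" and "Y = - (Fin ` cball a s)"
    have "open X" unfolding X_def by (intro open_image_Fin) auto
    moreover have "open Y"
      unfolding Y_def by (intro open_Compl compact_imp_closed compact_continuous_image continuous_on_Fin compact_cball)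
    moreover have "X \<inter> Y \<inter> \<Omega> = {}" by (auto simp: X_def Y_def)
    moreover have "\<Omega> \<subseteq> X \<union> Y"
    proof
      fix x assume x: "x \<in> \<Omega>"
      show "x \<in> X \<union> Y"
      proof (cases x)
        case (Fin z)
        hence "cmod (z - a) \<noteq> s" using n x by auto
        thus ?thesis using Fin by (auto simp: X_def Y_def dist_norm norm_minus_commute)
      qed (auto simp: Y_def)
    qed
    moreover have "X \<inter> \<Omega> \<noteq> {}"
    proof -
      have "Fin a \<in> X" "Fin a \<in> closure \<Omega>" using s a by (auto simp: X_def frontier_def)
      thus ?thesis using \<open>open X\<close> open_Int_closure_eq_empty by blast
    qed
    moreover have "Y \<inter> \<Omega> \<noteq> {}"
    proof -
      have "b \<in> Y" using b(2) s by (cases b) (force simp: Y_def dist_norm norm_minus_commute)+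
      moreover have "b \<in> closure \<Omega>" using b by (auto simp: frontier_def)
      ultimately show ?thesis using \<open>open Y\<close> open_Int_closure_eq_empty by blast
    qed
    ultimately show False using connectedD[OF \<Omega>(2), of X Y] by blast
  qed
  then obtain z where z: "Fin z \<in> \<Omega>" "z \<in> N" using s by (auto simp: N_def)
  have "connected (Fin ` N)"
    unfolding N_def by (intro connected_continuous_image continuous_on_Fin connected_annulus) auto
  moreover have "Fin ` N \<inter> frontier \<Omega> = {}" using no by (auto simp: N_def)
  moreover have "Fin ` N \<inter> \<Omega> \<noteq> {}" using z by blast
  ultimately have "Fin ` N - \<Omega> = {}" using connected_Int_frontier by metis
  thus ?thesis by (auto simp: N_def)
qed

lemma uniformly_perfect_frontier:
  assumes \<Omega>: "hyperbolic_domain \<Omega>" and C: "0 < C"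
    and le: "\<And>x. x \<in> \<Omega> \<Longrightarrow> C \<le> delta \<Omega> x * sph_hyp_density \<Omega> x"
  shows "uniformly_perfect (frontier \<Omega>)"
proof -
  define E where "E = frontier \<Omega>"
  have \<Omega>': "open \<Omega>" "connected \<Omega>" using \<Omega> by (auto simp: hyperbolic_domain_def)
  have "compact E" unfolding E_def by (rule compact_csphere) simp
  moreover have "\<exists>x\<in>E. \<exists>y\<in>E. x \<noteq> y"
    using hyperbolic_domainE[OF \<Omega>] unfolding E_def by metis
  moreover
  \<comment> \<open>The summand 2 gives exp l at least 4, so that the outer boundary point is at
    least 4s away. The summand 8/C gives C l > 8, while the final chain of estimates yields C l at
    most 8.\<close>
  define l where "l = 2 + 8 / C"
  have l: "2 \<le> l" "8 < C * l" using C by (auto simp: l_def field_simps)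
  \<comment> \<open>The ratio of the radii when the annulus has logarithmic half-width
    \<open>l\<close> about its middle circle of radius exp(-l) r.\<close>
  define k where "k = exp (- (2 * l))"
  have el: "4 \<le> exp l"
  proof -
    have "4 = (1 + 1) * (1 + 1 :: real)" by simp
    also have "\<dots> \<le> exp 1 * exp 1" using exp_ge_add_one_self[of 1] by (intro mult_mono) auto
    also have "\<dots> = exp 2" by (simp flip: exp_add)
    also have "\<dots> \<le> exp l" using l by simp
    finally show ?thesis .
  qed
  have kl: "k = exp (- l) * exp (- l)" by (simp add: k_def flip: exp_add)
  have em: "exp (- l) \<le> 1 / 4" using el by (simp add: exp_minus field_simps)
  have k: "0 < k" "k < 1 / 2"
  proof -
    show "0 < k" by (simp add: k_def)
    have "k \<le> 1 / 4 * (1 / 4)" unfolding kl using em by (intro mult_mono) auto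
    thus "k < 1 / 2" by simp
  qed
  have "\<exists>z. Fin z \<in> E \<and> k * r < cmod (z - a) \<and> cmod (z - a) < r"
    if a: "Fin a \<in> E" and r: "0 < r" "ereal r < euclid_diameter E" for a r
  proof (rule ccontr)
    assume n: "\<nexists>z. Fin z \<in> E \<and> k * r < cmod (z - a) \<and> cmod (z - a) < r"
    \<comment> \<open>Without a boundary point at distance at least \<open>r\<close>, the whole
      boundary would lie within k r of \<open>a\<close>; its diameter would be at most 2 k r, below
      \<open>r\<close>, against the choice of \<open>r\<close>.\<close>
    obtain b where b: "b \<in> E" "\<And>b'. b = Fin b' \<Longrightarrow> r \<le> cmod (b' - a)"
    proof -
      consider "Infty \<in> E" | b' where "Fin b' \<in> E" "r \<le> cmod (b' - a)"
        | "Infty \<notin> E" "\<And>b'. Fin b' \<in> E \<Longrightarrow> cmod (b' - a) < r" by force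
      thus ?thesis
      proof cases
        case 3
        have *: "cmod (x - a) \<le> k * r" if "Fin x \<in> E" for x using 3(2)[OF that] n that by force
        have "dist x y \<le> 2 * (k * r)" if "Fin x \<in> E" "Fin y \<in> E" for x y
          using *[OF that(1)] *[OF that(2)] dist_triangle2[of x y a] by (simp add: dist_norm)
        hence "diameter (Fin -` E) \<le> 2 * (k * r)"
          using a by (intro diameter_le) (auto simp: dist_norm)
        moreover have "2 * (k * r) < r" using k r by simp
        ultimately show ?thesis using r(2) 3(1) by (simp add: euclid_diameter_def)
      qed (use that in auto)
    qed
    define s where "s = exp (- l) * r"
    have s: "0 < s" "4 * s \<le> r" "s * exp (- l) = k * r" "s * exp l = r" "k * r < s" "s < r"
    proof -
      show "0 < s" using r by (simp add: s_def)
      have "exp (- l) * r \<le> 1 / 4 * r" using em r by (intro mult_right_mono) auto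
      thus "4 * s \<le> r" by (simp add: s_def)
      thus "s < r" using \<open>0 < s\<close> by linarith
      show *: "s * exp (- l) = k * r" by (simp add: s_def kl)
      show "s * exp l = r" by (simp add: s_def exp_minus)
      have "s * exp (- l) \<le> s * (1 / 4)" using em \<open>0 < s\<close> by (intro mult_left_mono) auto
      thus "k * r < s" using \<open>0 < s\<close> * by linarith
    qed
    have ann: "Fin ` {z. k * r < cmod (z - a) \<and> cmod (z - a) < r} \<subseteq> \<Omega>"
      using n a b k r s by (intro separating_annulus_subset[OF \<Omega>', of a b r "k * r" s]) (auto simp: E_def)
    define z where "z = a + of_real s"
    have z: "cmod (z - a) = s" using s(1) by (simp add: z_def)
    have zW: "Fin z \<in> \<Omega>" using ann z s(5,6) by blast
    have "s * l * hyp_density \<Omega> (Fin z) \<le> 1"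
      using ann l s by (intro annulus_density_le[OF \<Omega> _ s(1) z]) auto
    moreover have "delta \<Omega> (Fin z) * (1 + (cmod z)\<^sup>2) \<le> 8 * s"
    proof -
      have "delta \<Omega> (Fin z) \<le> min (dist (Fin z) (Fin a)) (dist (Fin z) b)"
        using infdist_le[of _ E "Fin z"] a b(1) by (auto simp: delta_def E_def)
      hence "delta \<Omega> (Fin z) * (1 + (cmod z)\<^sup>2) \<le> min (dist (Fin z) (Fin a)) (dist (Fin z) b) * (1 + (cmod z)\<^sup>2)"
        by (intro mult_right_mono) auto
      also have "\<dots> \<le> 8 * s"
        using b(2) s(2) by (intro min_dist_mult_le[OF z s(1)]) force
      finally show ?thesis .
    qed
    moreover have hp: "0 < hyp_density \<Omega> (Fin z)"
      using sph_hyp_density_pos[OF \<Omega> zW] one_plus_norm_sq_pos[of z] by (simp add: zero_less_mult_iff)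
    ultimately have "delta \<Omega> (Fin z) * (1 + (cmod z)\<^sup>2) * hyp_density \<Omega> (Fin z) \<le> 8 * s * hyp_density \<Omega> (Fin z)"
      by (intro mult_right_mono) auto
    hence "C \<le> 8 * (s * hyp_density \<Omega> (Fin z))"
      using le[OF zW] by (simp add: mult.assoc)
    hence "C * l \<le> 8 * (s * hyp_density \<Omega> (Fin z)) * l"
      using l by (intro mult_right_mono) auto
    also have "\<dots> = 8 * (s * l * hyp_density \<Omega> (Fin z))" by simp
    also have "\<dots> \<le> 8" using \<open>s * l * hyp_density \<Omega> (Fin z) \<le> 1\<close> by simp
    finally show False using l by simp
  qed
  ultimately show ?thesis
    using k unfolding uniformly_perfect_def E_def[symmetric] by (intro conjI exI[of _ k]) auto
qed

section \<open>Comparison of \<open>delta\<close> and \<open>epsilon\<close>\<close>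

lemma dist_le_tau: "ennreal (dist x y) \<le> tau x y"
proof (cases "dist x y = 1")
  case False
  have d: "0 \<le> dist x y" "dist x y < 1" using dist_csphere_le_1[of x y] False by auto
  have "(dist x y)\<^sup>2 < 1" using d by (simp add: power_less_one_iff)
  hence "0 < sqrt (1 - (dist x y)\<^sup>2)" "sqrt (1 - (dist x y)\<^sup>2) \<le> 1" by auto
  hence "dist x y / 1 \<le> dist x y / sqrt (1 - (dist x y)\<^sup>2)"
    by (intro divide_left_mono) auto
  thus ?thesis using False by (simp add: tau_def ennreal_leI)
qed (simp add: tau_def)

lemma tau_le_dist:
  assumes "dist x y \<le> 1 / 2"
  shows "tau x y \<le> ennreal (2 * dist x y)"
proof -
  have "(dist x y)\<^sup>2 \<le> (1 / 2)\<^sup>2" using assms by (intro power_mono) auto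
  hence "(1 / 2)\<^sup>2 \<le> 1 - (dist x y)\<^sup>2" by (simp add: power2_eq_square)
  hence "1 / 2 \<le> sqrt (1 - (dist x y)\<^sup>2)" by (rule real_le_rsqrt)
  hence "dist x y / sqrt (1 - (dist x y)\<^sup>2) \<le> dist x y / (1 / 2)"
    by (intro frac_le) auto
  thus ?thesis using assms by (simp add: tau_def ennreal_leI)
qed

lemma delta_le_epsilon: "ennreal (delta \<Omega> x) \<le> epsilon \<Omega> x"
  unfolding epsilon_def
proof (rule INF_greatest)
  fix a assume "a \<in> frontier \<Omega>"
  hence "ennreal (delta \<Omega> x) \<le> ennreal (dist x a)"
    unfolding delta_def by (intro ennreal_leI infdist_le)
  also note dist_le_tau
  finally show "ennreal (delta \<Omega> x) \<le> tau x a" .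
qed

text \<open>The threshold 1/4 leaves room for a boundary point within twice the infimum, hence
  closer than 1/2, where \<open>tau_le_dist\<close> applies.\<close>

lemma epsilon_le_delta:
  assumes \<Omega>: "hyperbolic_domain \<Omega>" "x \<in> \<Omega>" and "delta \<Omega> x < 1 / 4"
  shows "epsilon \<Omega> x \<le> ennreal (4 * delta \<Omega> x)"
proof -
  have "frontier \<Omega> \<noteq> {}" using hyperbolic_domainE[OF \<Omega>(1)] by blast
  then obtain a where a: "a \<in> frontier \<Omega>" "dist x a < 2 * delta \<Omega> x"
    using infdist_less_obtain[of "frontier \<Omega>" x "2 * delta \<Omega> x"] delta_pos[OF \<Omega>] by (auto simp: delta_def)
  have "epsilon \<Omega> x \<le> tau x a" unfolding epsilon_def using a(1) by (rule INF_lower)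
  also have "\<dots> \<le> ennreal (2 * dist x a)" using a assms(3) by (intro tau_le_dist) auto
  also have "\<dots> \<le> ennreal (4 * delta \<Omega> x)" using a by (intro ennreal_leI) auto
  finally show ?thesis .
qed

lemma C_tilde_pos_iff:
  assumes \<Omega>: "hyperbolic_domain \<Omega>"
  shows "C_tilde \<Omega> > 0 \<longleftrightarrow> (\<exists>c>0. \<forall>x\<in>\<Omega>. c \<le> delta \<Omega> x * sph_hyp_density \<Omega> x)"
proof
  obtain m where m: "0 < m" "\<And>x. x \<in> \<Omega> \<Longrightarrow> m \<le> sph_hyp_density \<Omega> x"
    using sph_hyp_density_bounded_below[OF \<Omega>] by metis
  assume "C_tilde \<Omega> > 0"
  moreover have "C_tilde \<Omega> \<le> delta \<Omega> x * sph_hyp_density \<Omega> x" if "x \<in> \<Omega>" for x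
    unfolding C_tilde_def
  proof (rule cINF_lower[OF _ that])
    \<comment> \<open>A real \<open>INF\<close> is a lower bound only for a family bounded below,
      here by 0.\<close>
    show "bdd_below ((\<lambda>z. delta \<Omega> z * sph_hyp_density \<Omega> z) ` \<Omega>)"
    proof (rule bdd_belowI2[of _ 0])
      fix x assume x: "x \<in> \<Omega>"
      show "0 \<le> delta \<Omega> x * sph_hyp_density \<Omega> x"
        using delta_pos[OF \<Omega> x] m(1) m(2)[OF x] by simp
    qed
  qed
  ultimately show "\<exists>c>0. \<forall>x\<in>\<Omega>. c \<le> delta \<Omega> x * sph_hyp_density \<Omega> x" by blast
next
  have "\<Omega> \<noteq> {}" using \<Omega> by (simp add: hyperbolic_domain_def)
  assume "\<exists>c>0. \<forall>x\<in>\<Omega>. c \<le> delta \<Omega> x * sph_hyp_density \<Omega> x"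
  then obtain c where c: "0 < c" "\<And>x. x \<in> \<Omega> \<Longrightarrow> c \<le> delta \<Omega> x * sph_hyp_density \<Omega> x" by blast
  have "c \<le> C_tilde \<Omega>"
    unfolding C_tilde_def using \<open>\<Omega> \<noteq> {}\<close> c(2) by (intro cINF_greatest)
  thus "C_tilde \<Omega> > 0" using c(1) by linarith
qed

lemma C_hat_pos_iff:
  assumes \<Omega>: "hyperbolic_domain \<Omega>"
  shows "C_hat \<Omega> > 0 \<longleftrightarrow> (\<exists>c>0. \<forall>x\<in>\<Omega>. c \<le> delta \<Omega> x * sph_hyp_density \<Omega> x)"
proof
  obtain m where m: "0 < m" "\<And>x. x \<in> \<Omega> \<Longrightarrow> m \<le> sph_hyp_density \<Omega> x"
    using sph_hyp_density_bounded_below[OF \<Omega>] by metis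
  assume "C_hat \<Omega> > 0"
  \<comment> \<open>\<open>C_hat\<close> could a priori be infinite, so a finite positive number
    below it is used.\<close>
  then obtain h where h: "0 < ennreal h" "ennreal h < C_hat \<Omega>"
    by (metis dense ennreal_cases less_top_ennreal order_less_imp_not_less top_greatest leD)
  hence h0: "0 < h" by (simp add: ennreal_less_zero_iff)
  have "min (m / 4) (h / 4) \<le> delta \<Omega> x * sph_hyp_density \<Omega> x" if x: "x \<in> \<Omega>" for x
  proof -
    define \<delta> \<mu> where "\<delta> = delta \<Omega> x" and "\<mu> = sph_hyp_density \<Omega> x"
    have pos: "0 < \<delta>" "m \<le> \<mu>" using delta_pos[OF \<Omega> x] m(2)[OF x] by (auto simp: \<delta>_def \<mu>_def)
    show ?thesis
    proof (cases "\<delta> < 1 / 4")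
      case True
      have "ennreal h \<le> C_hat \<Omega>" using h(2) by simp
      also have "\<dots> \<le> epsilon \<Omega> x * ennreal \<mu>"
        unfolding C_hat_def \<mu>_def using x by (rule INF_lower)
      also have "\<dots> \<le> ennreal (4 * \<delta>) * ennreal \<mu>"
        using epsilon_le_delta[OF \<Omega> x] True by (intro mult_right_mono) (auto simp: \<delta>_def)
      also have "\<dots> = ennreal (4 * \<delta> * \<mu>)" using pos m(1) by (simp add: ennreal_mult)
      finally have "h \<le> 4 * \<delta> * \<mu>" using pos m(1) by (simp add: ennreal_le_iff)
      thus ?thesis by (simp add: \<delta>_def \<mu>_def)
    next
      case False
      \<comment> \<open>Here \<open>epsilon\<close> may be far larger than \<open>delta\<close>,
        even infinite. The lower bound on the density takes over.\<close>
      have "1 / 4 * m \<le> \<delta> * \<mu>" using False pos m(1) by (intro mult_mono) auto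
      thus ?thesis by (simp add: \<delta>_def \<mu>_def)
    qed
  qed
  thus "\<exists>c>0. \<forall>x\<in>\<Omega>. c \<le> delta \<Omega> x * sph_hyp_density \<Omega> x"
    using m(1) h0 by (intro exI[of _ "min (m / 4) (h / 4)"]) auto
next
  assume "\<exists>c>0. \<forall>x\<in>\<Omega>. c \<le> delta \<Omega> x * sph_hyp_density \<Omega> x"
  then obtain c where c: "0 < c" "\<And>x. x \<in> \<Omega> \<Longrightarrow> c \<le> delta \<Omega> x * sph_hyp_density \<Omega> x" by blast
  have "ennreal c \<le> C_hat \<Omega>"
    unfolding C_hat_def
  proof (rule INF_greatest)
    fix x assume x: "x \<in> \<Omega>"
    have "ennreal c \<le> ennreal (delta \<Omega> x * sph_hyp_density \<Omega> x)"
      using c(2)[OF x] by (rule ennreal_leI)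
    also have "\<dots> = ennreal (delta \<Omega> x) * ennreal (sph_hyp_density \<Omega> x)"
      using delta_pos[OF \<Omega> x] by (intro ennreal_mult') simp
    also have "\<dots> \<le> epsilon \<Omega> x * ennreal (sph_hyp_density \<Omega> x)"
      by (intro mult_right_mono delta_le_epsilon) simp
    finally show "ennreal c \<le> epsilon \<Omega> x * ennreal (sph_hyp_density \<Omega> x)" .
  qed
  moreover have "0 < ennreal c" using c(1) by simp
  ultimately show "C_hat \<Omega> > 0" by (rule less_le_trans[rotated])
qed

theorem corollary1p5:
  fixes \<Omega> :: "csphere set"
  assumes "hyperbolic_domain \<Omega>"
  shows "(uniformly_perfect (frontier \<Omega>) \<longleftrightarrow> C_tilde \<Omega> > 0) \<and> (C_tilde \<Omega> > 0 \<longleftrightarrow> C_hat \<Omega> > 0)"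
proof -
  have "uniformly_perfect (frontier \<Omega>) \<longleftrightarrow> (\<exists>c>0. \<forall>x\<in>\<Omega>. c \<le> delta \<Omega> x * sph_hyp_density \<Omega> x)"
  proof
    assume "uniformly_perfect (frontier \<Omega>)"
    from delta_mult_density_lower[OF assms this]
    show "\<exists>c>0. \<forall>x\<in>\<Omega>. c \<le> delta \<Omega> x * sph_hyp_density \<Omega> x" by metis
  next
    assume "\<exists>c>0. \<forall>x\<in>\<Omega>. c \<le> delta \<Omega> x * sph_hyp_density \<Omega> x"
    thus "uniformly_perfect (frontier \<Omega>)"
      using uniformly_perfect_frontier[OF assms] by metis
  qed
  thus ?thesis
    by (simp only: C_tilde_pos_iff[OF assms] C_hat_pos_iff[OF assms] simp_thms)
qed

end
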